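(* Let $S$ be a closed oriented surface every component of which has genus at least $2$, let $m_1$ and $m_2$ be homologous multicurves in $S$ in a nontrivial homology class $\alpha$, and let $m_1,\gamma_1,\dots,\gamma_j,m_2$ be the path in $\mathcal{HC}(S,\alpha)$ produced by the path construction algorithm applied to $(m_1,m_2)$. If $m_1$ and $m_2$ had been interchanged in the path construction algorithm, the same unoriented path would have been obtained.
   Context: A curve in $S$ is a piecewise smooth injective map $S^1\to S$ that is not null homotopic. A multicurve is a union of pairwise disjoint oriented curves on $S$; it is allowed to contain null homologous submulticurves. For a nontrivial class $\alpha\in H_1(S,\mathbb{Z})$, $\mathcal{HC}(S,\alpha)$ is the simplicial complex whose vertices are the homotopy classes of oriented multicurves in the class $\alpha$; a set of vertices spans a simplex if the classes have pairwise disjoint representatives. A path in $\mathcal{HC}(S,\alpha)$ is written as a sequence of multicurves representing its successive vertices. Overlap function: for homologous multicurves $m_1,m_2$, the overlap function $f$ of $m_1$ and $m_2$ (i.e. of $m_2-m_1$) is the locally constant function on $S\setminus(m_1\cup m_2)$ with minimum value zero such that, for any two points $x,y$, $f(x)-f(y)$ is the algebraic intersection number of $m_2-m_1$ with an oriented arc with starting point $y$ and endpoint $x$ ($f$ increases by one when crossing an arc of $m_2-m_1$ from right to left). Representatives of the homotopy classes are assumed chosen so that the maximum of $f$ is as small as possible; this maximum is the homological distance $\delta(m_1,m_2)$. $S_{max}(m_1,m_2)$ denotes the subsurface of $S$ on which $f$ takes its maximum. Minimal position: $m_1$ and $m_2$ are in minimal position if they are in general position, the number of times they intersect equals the geometric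 intersection number $i(m_1,m_2)$, and, whenever $m_2-m_1$ contains homotopic curves, these are positioned so that the overlap function is minimised. Path construction algorithm: suppose $m_1$ and $m_2$ are in minimal position, and regard their union as a one dimensional oriented cell complex on $S$. Orient $\partial S_{max}(m_1,m_2)$ so that $S_{max}(m_1,m_2)$ is on its left; as a chain it is the sum of the arcs of $m_2$ on $\partial S_{max}(m_1,m_2)$ minus the sum of the arcs of $m_1$ on it. Put $\gamma_1=m_1+\partial S_{max}(m_1,m_2)$ (as chains in the cell complex), and successively $\gamma_{i+1}=\gamma_i+\partial S_{max}(\gamma_i,m_2)$, where $S_{max}(\gamma_i,m_2)$ is defined in the same way using the overlap function of $\gamma_i$ and $m_2$. The construction ends with $\gamma_j$ when $\delta(\gamma_j,m_2)=1$; then $S_{max}(\gamma_j,m_2)$ is the subsurface bounded by $m_2-\gamma_j$. Once all the $\gamma_i$ are constructed, trivial curves bounding disks are discarded from each $\gamma_i$. The output is the path $m_1,\gamma_1,\dots,\gamma_j,m_2$ in $\mathcal{HC}(S,\alpha)$. *)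

theory Defs
  imports "HOL-Analysis.Analysis" "HOL-Homology.Homology"
begin

section \<open>Closed oriented smooth surfaces\<close>

primrec Ck_on :: "nat \<Rightarrow> ('b::real_normed_vector \<Rightarrow> 'c::real_normed_vector) \<Rightarrow> 'b set \<Rightarrow> bool" where
  "Ck_on 0 f U = continuous_on U f"
| "Ck_on (Suc k) f U =
     (\<exists>f'. (\<forall>x\<in>U. (f has_derivative f' x) (at x)) \<and> (\<forall>v. Ck_on k (\<lambda>x. f' x v) U))"

definition smooth_on :: "('b::real_normed_vector \<Rightarrow> 'c::real_normed_vector) \<Rightarrow> 'b set \<Rightarrow> bool" where
  "smooth_on f U \<longleftrightarrow> (\<forall>k. Ck_on k f U)"

type_synonym 'a chart = "'a set \<times> ('a \<Rightarrow> complex)"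

text \<open>Charts take values in \<^typ>\<open>complex\<close>, used as the oriented real plane. The determinant of a
  real-linear map \<open>D\<close> of the plane is \<open>Im (cnj (D 1) * D \<i>)\<close>.\<close>

definition smooth_oriented_atlas :: "'a topology \<Rightarrow> 'a chart set \<Rightarrow> bool" where
  "smooth_oriented_atlas X A \<longleftrightarrow>
     topspace X = \<Union> (fst ` A) \<and>
     (\<forall>(U, \<phi>)\<in>A. openin X U \<and> open (\<phi> ` U) \<and>
        homeomorphic_map (subtopology X U) (top_of_set (\<phi> ` U)) \<phi>) \<and>
     (\<forall>(U, \<phi>)\<in>A. \<forall>(V, \<psi>)\<in>A.
        smooth_on (\<lambda>z. \<psi> (inv_into U \<phi> z)) (\<phi> ` (U \<inter> V)) \<and>
        (\<forall>z\<in>\<phi> ` (U \<inter> V). \<forall>D. ((\<lambda>z. \<psi> (inv_into U \<phi> z)) has_derivative D) (at z) \<longrightarrow>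
           0 < Im (cnj (D 1) * D \<i>)))"

definition closed_oriented_surface :: "'a topology \<Rightarrow> 'a chart set \<Rightarrow> bool" where
  "closed_oriented_surface X A \<longleftrightarrow>
     compact_space X \<and> Hausdorff_space X \<and> smooth_oriented_atlas X A"

definition has_genus :: "'a topology \<Rightarrow> nat \<Rightarrow> bool" where
  "has_genus X g \<longleftrightarrow> homology_group 1 X \<cong> free_Abelian_group {..<2 * g}"

section \<open>Curves, multicurves and the homology curve complex\<close>

text \<open>\<open>smooth_arc A \<gamma> a b\<close>: on \<open>{a..b}\<close>, the map \<open>\<gamma>\<close> is smooth up to the endpoints (it extends
  locally to a smooth map on an open interval) with nowhere vanishing velocity.\<close>

definition smooth_arc :: "'a chart set \<Rightarrow> (real \<Rightarrow> 'a) \<Rightarrow> real \<Rightarrow> real \<Rightarrow> bool" where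
  "smooth_arc A \<gamma> a b \<longleftrightarrow>
     (\<forall>t\<in>{a..b}. \<exists>(U, \<phi>)\<in>A. \<exists>\<epsilon>>0. \<exists>g.
        smooth_on g {t-\<epsilon><..<t+\<epsilon>} \<and>
        (\<forall>s\<in>{t-\<epsilon><..<t+\<epsilon>}. vector_derivative g (at s) \<noteq> 0) \<and>
        (\<forall>s\<in>{a..b} \<inter> {t-\<epsilon><..<t+\<epsilon>}. \<gamma> s \<in> U \<and> \<phi> (\<gamma> s) = g s))"

definition regular_at :: "'a chart set \<Rightarrow> (real \<Rightarrow> 'a) \<Rightarrow> real \<Rightarrow> bool" where
  "regular_at A \<gamma> t \<longleftrightarrow> (\<exists>\<epsilon>>0. smooth_arc A \<gamma> (t-\<epsilon>) (t+\<epsilon>))"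

abbreviation circle :: "complex set" where
  "circle \<equiv> sphere 0 1"

abbreviation angular :: "(complex \<Rightarrow> 'a) \<Rightarrow> real \<Rightarrow> 'a" where
  "angular c \<equiv> (\<lambda>t. c (cis t))"

text \<open>A closed curve that is allowed to be null homotopic.\<close>

definition simple_loop :: "'a topology \<Rightarrow> 'a chart set \<Rightarrow> (complex \<Rightarrow> 'a) \<Rightarrow> bool" where
  "simple_loop X A c \<longleftrightarrow>
     continuous_map (top_of_set circle) X c \<and> inj_on c circle \<and>
     (\<exists>B. finite B \<and>
        (\<forall>a b. a < b \<and> cis ` {a<..<b} \<inter> B = {} \<longrightarrow> smooth_arc A (angular c) a b))"

definition null_homotopic :: "'a topology \<Rightarrow> (complex \<Rightarrow> 'a) \<Rightarrow> bool" where
  "null_homotopic X c \<longleftrightarrow>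
     (\<exists>p\<in>topspace X. homotopic_with (\<lambda>_. True) (top_of_set circle) X c (\<lambda>_. p))"

definition loop_system :: "'a topology \<Rightarrow> 'a chart set \<Rightarrow> (complex \<Rightarrow> 'a) set \<Rightarrow> bool" where
  "loop_system X A L \<longleftrightarrow>
     finite L \<and> (\<forall>c\<in>L. simple_loop X A c) \<and> disjoint_family_on (\<lambda>c. c ` circle) L"

definition multicurve :: "'a topology \<Rightarrow> 'a chart set \<Rightarrow> (complex \<Rightarrow> 'a) set \<Rightarrow> bool" where
  "multicurve X A m \<longleftrightarrow> loop_system X A m \<and> (\<forall>c\<in>m. \<not> null_homotopic X c)"

definition locus :: "(complex \<Rightarrow> 'a) set \<Rightarrow> 'a set" where
  "locus m = (\<Union>c\<in>m. c ` circle)"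

definition homology_class :: "'a topology \<Rightarrow> (complex \<Rightarrow> 'a) set \<Rightarrow> 'a chain set" where
  "homology_class X m =
     homologous_rel_set 1 X {}
       (\<Sum>c\<in>m. frag_of (restrict (\<lambda>x. angular c (2 * pi * x 1)) (standard_simplex 1)))"

definition homotopic_multicurves ::
    "'a topology \<Rightarrow> (complex \<Rightarrow> 'a) set \<Rightarrow> (complex \<Rightarrow> 'a) set \<Rightarrow> bool" where
  "homotopic_multicurves X m m' \<longleftrightarrow>
     (\<exists>h. bij_betw h m m' \<and>
        (\<forall>c\<in>m. homotopic_with (\<lambda>_. True) (top_of_set circle) X c (h c)))"

definition homotopy_class ::
    "'a topology \<Rightarrow> 'a chart set \<Rightarrow> (complex \<Rightarrow> 'a) set \<Rightarrow> (complex \<Rightarrow> 'a) set set" where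
  "homotopy_class X A m = {m'. multicurve X A m' \<and> homotopic_multicurves X m m'}"

definition HC_vertices ::
    "'a topology \<Rightarrow> 'a chart set \<Rightarrow> 'a chain set \<Rightarrow> (complex \<Rightarrow> 'a) set set set" where
  "HC_vertices X A \<alpha> = homotopy_class X A ` {m. multicurve X A m \<and> homology_class X m = \<alpha>}"

definition HC_simplices ::
    "'a topology \<Rightarrow> 'a chart set \<Rightarrow> 'a chain set \<Rightarrow> (complex \<Rightarrow> 'a) set set set set" where
  "HC_simplices X A \<alpha> =
     {\<sigma>. finite \<sigma> \<and> \<sigma> \<noteq> {} \<and> \<sigma> \<subseteq> HC_vertices X A \<alpha> \<and>
        (\<exists>r. (\<forall>v\<in>\<sigma>. r v \<in> v) \<and> disjoint_family_on (\<lambda>v. locus (r v)) \<sigma>)}"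

definition HC_path ::
    "'a topology \<Rightarrow> 'a chart set \<Rightarrow> 'a chain set \<Rightarrow> (complex \<Rightarrow> 'a) set set list \<Rightarrow> bool" where
  "HC_path X A \<alpha> P \<longleftrightarrow>
     P \<noteq> [] \<and> set P \<subseteq> HC_vertices X A \<alpha> \<and> successively (\<lambda>v w. {v, w} \<in> HC_simplices X A \<alpha>) P"

section \<open>Crossings and general position\<close>

abbreviation velocity :: "('a \<Rightarrow> complex) \<Rightarrow> (real \<Rightarrow> 'a) \<Rightarrow> real \<Rightarrow> complex" where
  "velocity \<phi> \<gamma> t \<equiv> vector_derivative (\<phi> \<circ> \<gamma>) (at t)"

text \<open>\<open>crosses_leftward A \<gamma> s \<eta> t\<close>: at the common point \<open>\<gamma> s = \<eta> t\<close>, the path \<open>\<eta>\<close> crosses \<open>\<gamma>\<close>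
  transversely from the right of \<open>\<gamma>\<close> to its left. Equivalently \<open>\<gamma>\<close> crosses \<open>\<eta>\<close> from left to right,
  so a crossing in the other direction is obtained by exchanging the two paths. The sign of the
  determinant does not depend on the chart.\<close>

definition crosses_leftward ::
    "'a chart set \<Rightarrow> (real \<Rightarrow> 'a) \<Rightarrow> real \<Rightarrow> (real \<Rightarrow> 'a) \<Rightarrow> real \<Rightarrow> bool" where
  "crosses_leftward A \<gamma> s \<eta> t \<longleftrightarrow>
     \<gamma> s = \<eta> t \<and> regular_at A \<gamma> s \<and> regular_at A \<eta> t \<and>
     (\<exists>(U, \<phi>)\<in>A. \<gamma> s \<in> U \<and> 0 < Im (cnj (velocity \<phi> \<gamma> s) * velocity \<phi> \<eta> t))"

definition transverse_at ::
    "'a chart set \<Rightarrow> (real \<Rightarrow> 'a) \<Rightarrow> real \<Rightarrow> (real \<Rightarrow> 'a) \<Rightarrow> real \<Rightarrow> bool" where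
  "transverse_at A \<gamma> s \<eta> t \<longleftrightarrow> crosses_leftward A \<gamma> s \<eta> t \<or> crosses_leftward A \<eta> t \<gamma> s"

definition general_position ::
    "'a chart set \<Rightarrow> (complex \<Rightarrow> 'a) set \<Rightarrow> (complex \<Rightarrow> 'a) set \<Rightarrow> bool" where
  "general_position A m n \<longleftrightarrow>
     finite (locus m \<inter> locus n) \<and>
     (\<forall>c\<in>m. \<forall>d\<in>n. \<forall>s t. c (cis s) = d (cis t) \<longrightarrow>
        transverse_at A (angular c) s (angular d) t)"

definition geometric_intersection ::
    "'a topology \<Rightarrow> 'a chart set \<Rightarrow> (complex \<Rightarrow> 'a) set \<Rightarrow> (complex \<Rightarrow> 'a) set \<Rightarrow> nat" where
  "geometric_intersection X A m n =
     Inf {card (locus m' \<inter> locus n') | m' n'.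
            m' \<in> homotopy_class X A m \<and> n' \<in> homotopy_class X A n \<and> general_position A m' n'}"

section \<open>The cell complex of two multicurves\<close>

text \<open>Besides the intersection points, the finitely many corners of the curves are vertices. A curve
  with neither intersections nor corners is a single one-cell. One-cells are oriented as the curves
  containing them; a one-chain is an integer-valued function on one-cells.\<close>

definition zero_cells :: "'a chart set \<Rightarrow> (complex \<Rightarrow> 'a) set \<Rightarrow> (complex \<Rightarrow> 'a) set \<Rightarrow> 'a set" where
  "zero_cells A m n =
     (locus m \<inter> locus n) \<union>
     {c (cis s) | c s. c \<in> m \<union> n \<and> \<not> regular_at A (angular c) s}"

definition skeleton ::
    "'a topology \<Rightarrow> 'a chart set \<Rightarrow> (complex \<Rightarrow> 'a) set \<Rightarrow> (complex \<Rightarrow> 'a) set \<Rightarrow> 'a topology" where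
  "skeleton X A m n = subtopology X (locus m \<union> locus n - zero_cells A m n)"

definition one_cells ::
    "'a topology \<Rightarrow> 'a chart set \<Rightarrow> (complex \<Rightarrow> 'a) set \<Rightarrow> (complex \<Rightarrow> 'a) set \<Rightarrow> 'a set set" where
  "one_cells X A m n = connected_components_of (skeleton X A m n)"

abbreviation one_cell_at ::
    "'a topology \<Rightarrow> 'a chart set \<Rightarrow> (complex \<Rightarrow> 'a) set \<Rightarrow> (complex \<Rightarrow> 'a) set \<Rightarrow> 'a \<Rightarrow> 'a set" where
  "one_cell_at X A m n p \<equiv> connected_component_of_set (skeleton X A m n) p"

definition complement ::
    "'a topology \<Rightarrow> (complex \<Rightarrow> 'a) set \<Rightarrow> (complex \<Rightarrow> 'a) set \<Rightarrow> 'a set" where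
  "complement X m n = topspace X - (locus m \<union> locus n)"

type_synonym 'a one_chain = "'a set \<Rightarrow> int"

text \<open>\<open>cellular X A m n k\<close> is \<open>k\<close> (meant for \<open>k = m\<close> or \<open>k = n\<close>) as a chain in the cell complex
  of \<open>m\<close> and \<open>n\<close>.\<close>

definition cellular ::
    "'a topology \<Rightarrow> 'a chart set \<Rightarrow> (complex \<Rightarrow> 'a) set \<Rightarrow> (complex \<Rightarrow> 'a) set \<Rightarrow>
     (complex \<Rightarrow> 'a) set \<Rightarrow> 'a one_chain" where
  "cellular X A m n k e = of_bool (e \<in> one_cells X A m n \<and> e \<subseteq> locus k)"

text \<open>\<open>lies_beside A K \<sigma> R e\<close>: the region \<open>R\<close> lies to the left (for \<open>\<sigma> = 1\<close>) or to the right
  (for \<open>\<sigma> = -1\<close>) of the one-cell \<open>e\<close>, oriented by the curves of \<open>K\<close>. In an oriented chart the left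
  normal of a velocity \<open>v\<close> is \<open>\<i> * v\<close>.\<close>

definition lies_beside ::
    "'a chart set \<Rightarrow> (complex \<Rightarrow> 'a) set \<Rightarrow> real \<Rightarrow> 'a set \<Rightarrow> 'a set \<Rightarrow> bool" where
  "lies_beside A K \<sigma> R e \<longleftrightarrow>
     (\<exists>d\<in>K. \<exists>s. d (cis s) \<in> e \<and>
        (\<exists>(U, \<phi>)\<in>A. d (cis s) \<in> U \<and>
           (\<forall>\<^sub>F u in at_right 0.
              inv_into U \<phi> (\<phi> (d (cis s)) + of_real (\<sigma> * u) * (\<i> * velocity \<phi> (angular d) s)) \<in> R)))"

text \<open>The boundary of a union \<open>R\<close> of faces, oriented with \<open>R\<close> on its left; a one-cell with \<open>R\<close> on
  both sides cancels.\<close>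

definition boundary_chain ::
    "'a topology \<Rightarrow> 'a chart set \<Rightarrow> (complex \<Rightarrow> 'a) set \<Rightarrow> (complex \<Rightarrow> 'a) set \<Rightarrow>
     'a set \<Rightarrow> 'a one_chain" where
  "boundary_chain X A m n R e =
     (if e \<in> one_cells X A m n
      then of_bool (lies_beside A (m \<union> n) 1 R e) - of_bool (lies_beside A (m \<union> n) (-1) R e)
      else 0)"

section \<open>Overlap functions\<close>

definition oriented_arc :: "'a topology \<Rightarrow> 'a chart set \<Rightarrow> (real \<Rightarrow> 'a) \<Rightarrow> bool" where
  "oriented_arc X A \<eta> \<longleftrightarrow>
     pathin X \<eta> \<and> inj_on \<eta> {0..1} \<and>
     (\<exists>B. finite B \<and>
        (\<forall>a b. 0 \<le> a \<and> a < b \<and> b \<le> 1 \<and> {a<..<b} \<inter> B = {} \<longrightarrow> smooth_arc A \<eta> a b))"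

definition arc_general_position ::
    "'a topology \<Rightarrow> 'a chart set \<Rightarrow> (complex \<Rightarrow> 'a) set \<Rightarrow> (complex \<Rightarrow> 'a) set \<Rightarrow>
     (real \<Rightarrow> 'a) \<Rightarrow> bool" where
  "arc_general_position X A m n \<eta> \<longleftrightarrow>
     \<eta> 0 \<in> complement X m n \<and> \<eta> 1 \<in> complement X m n \<and>
     finite {t\<in>{0..1}. \<eta> t \<in> locus m \<union> locus n} \<and>
     (\<forall>t\<in>{0..1}. \<eta> t \<notin> zero_cells A m n \<and>
        (\<forall>c\<in>m \<union> n. \<forall>s. c (cis s) = \<eta> t \<longrightarrow> transverse_at A (angular c) s \<eta> t))"

definition crossing_sign ::
    "'a chart set \<Rightarrow> (complex \<Rightarrow> 'a) set \<Rightarrow> (real \<Rightarrow> 'a) \<Rightarrow> real \<Rightarrow> int" where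
  "crossing_sign A K \<eta> t =
     of_bool (\<exists>c\<in>K. \<exists>s. crosses_leftward A (angular c) s \<eta> t) -
     of_bool (\<exists>c\<in>K. \<exists>s. crosses_leftward A \<eta> t (angular c) s)"

definition algebraic_intersection ::
    "'a topology \<Rightarrow> 'a chart set \<Rightarrow> (complex \<Rightarrow> 'a) set \<Rightarrow> (complex \<Rightarrow> 'a) set \<Rightarrow>
     'a one_chain \<Rightarrow> (real \<Rightarrow> 'a) \<Rightarrow> int" where
  "algebraic_intersection X A m n a \<eta> =
     (\<Sum>t\<in>{t\<in>{0..1}. \<eta> t \<in> locus m \<union> locus n}.
        a (one_cell_at X A m n (\<eta> t)) * crossing_sign A (m \<union> n) \<eta> t)"

definition overlap_function ::
    "'a topology \<Rightarrow> 'a chart set \<Rightarrow> (complex \<Rightarrow> 'a) set \<Rightarrow> (complex \<Rightarrow> 'a) set \<Rightarrow>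
     'a one_chain \<Rightarrow> ('a \<Rightarrow> int) \<Rightarrow> bool" where
  "overlap_function X A m n a f \<longleftrightarrow>
     continuous_map (subtopology X (complement X m n)) (discrete_topology UNIV) f \<and>
     (\<forall>x\<in>complement X m n. 0 \<le> f x) \<and> (\<exists>x\<in>complement X m n. f x = 0) \<and>
     (\<forall>\<eta>. oriented_arc X A \<eta> \<and> arc_general_position X A m n \<eta> \<longrightarrow>
        f (\<eta> 1) - f (\<eta> 0) = algebraic_intersection X A m n a \<eta>)"

definition attains_max :: "('a \<Rightarrow> int) \<Rightarrow> 'a set \<Rightarrow> int \<Rightarrow> bool" where
  "attains_max f D M \<longleftrightarrow> (\<exists>x\<in>D. f x = M) \<and> (\<forall>x\<in>D. f x \<le> M)"

text \<open>On a connected surface the overlap function of a chain is unique. On a disconnected one, arcs do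
  not compare the values on different components; the least possible maximum is required.\<close>

definition tight_overlap ::
    "'a topology \<Rightarrow> 'a chart set \<Rightarrow> (complex \<Rightarrow> 'a) set \<Rightarrow> (complex \<Rightarrow> 'a) set \<Rightarrow>
     'a one_chain \<Rightarrow> ('a \<Rightarrow> int) \<Rightarrow> int \<Rightarrow> bool" where
  "tight_overlap X A m n a f M \<longleftrightarrow>
     overlap_function X A m n a f \<and> attains_max f (complement X m n) M \<and>
     (\<forall>g N. overlap_function X A m n a g \<and> attains_max g (complement X m n) N \<longrightarrow> M \<le> N)"

definition overlap_height ::
    "'a topology \<Rightarrow> 'a chart set \<Rightarrow> (complex \<Rightarrow> 'a) set \<Rightarrow> (complex \<Rightarrow> 'a) set \<Rightarrow> int \<Rightarrow> bool" where
  "overlap_height X A m n M \<longleftrightarrow>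
     (\<exists>f. tight_overlap X A m n (\<lambda>e. cellular X A m n n e - cellular X A m n m e) f M)"

definition homological_distance ::
    "'a topology \<Rightarrow> 'a chart set \<Rightarrow> (complex \<Rightarrow> 'a) set \<Rightarrow> (complex \<Rightarrow> 'a) set \<Rightarrow> nat" where
  "homological_distance X A m n =
     Inf {M. \<exists>m'\<in>homotopy_class X A m. \<exists>n'\<in>homotopy_class X A n.
               general_position A m' n' \<and> overlap_height X A m' n' (int M)}"

definition minimal_position ::
    "'a topology \<Rightarrow> 'a chart set \<Rightarrow> (complex \<Rightarrow> 'a) set \<Rightarrow> (complex \<Rightarrow> 'a) set \<Rightarrow> bool" where
  "minimal_position X A m n \<longleftrightarrow>
     general_position A m n \<and>
     card (locus m \<inter> locus n) = geometric_intersection X A m n \<and>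
     overlap_height X A m n (int (homological_distance X A m n))"

section \<open>The path construction\<close>

text \<open>\<open>construction X A m n \<gamma>s\<close>: the list \<open>\<gamma>s\<close> is \<open>m, \<gamma>\<^sub>1, \<dots>, \<gamma>\<^sub>j\<close>, as chains in the cell complex of
  \<open>m\<close> and \<open>n\<close>. All overlap functions are taken off the one-skeleton of this fixed complex, where the
  chain \<open>n - \<gamma>\<^sub>i\<close> may vanish on some one-cells.\<close>

definition construction ::
    "'a topology \<Rightarrow> 'a chart set \<Rightarrow> (complex \<Rightarrow> 'a) set \<Rightarrow> (complex \<Rightarrow> 'a) set \<Rightarrow>
     'a one_chain list \<Rightarrow> bool" where
  "construction X A m n \<gamma>s \<longleftrightarrow>
     \<gamma>s \<noteq> [] \<and> \<gamma>s ! 0 = cellular X A m n m \<and>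
     (\<forall>i<length \<gamma>s. \<exists>f M.
        tight_overlap X A m n (\<lambda>e. cellular X A m n n e - (\<gamma>s ! i) e) f M \<and>
        (if Suc i = length \<gamma>s then M = 1
         else M \<noteq> 1 \<and>
           \<gamma>s ! Suc i =
             (\<lambda>e. (\<gamma>s ! i) e + boundary_chain X A m n {x\<in>complement X m n. f x = M} e)))"

definition runs_along ::
    "'a chart set \<Rightarrow> (complex \<Rightarrow> 'a) set \<Rightarrow> (complex \<Rightarrow> 'a) set \<Rightarrow> 'a set \<Rightarrow> bool" where
  "runs_along A L K e \<longleftrightarrow>
     e \<subseteq> locus L \<and>
     (\<forall>c\<in>L. \<forall>d\<in>K. \<forall>s t.
        c (cis s) = d (cis t) \<and> c (cis s) \<in> e \<and> regular_at A (angular c) s \<longrightarrow>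
        (\<exists>(U, \<phi>)\<in>A. c (cis s) \<in> U \<and>
           (\<exists>r>0. velocity \<phi> (angular c) s = of_real r * velocity \<phi> (angular d) t)))"

text \<open>The loops of \<open>L\<close> trace out the chain \<open>a\<close>. Coefficients 0 and 1 suffice: near each
  intersection point a chain of the construction consists of one incoming and one outgoing one-cell,
  with their own orientations.\<close>

definition realizes ::
    "'a topology \<Rightarrow> 'a chart set \<Rightarrow> (complex \<Rightarrow> 'a) set \<Rightarrow> (complex \<Rightarrow> 'a) set \<Rightarrow>
     'a one_chain \<Rightarrow> (complex \<Rightarrow> 'a) set \<Rightarrow> bool" where
  "realizes X A m n a L \<longleftrightarrow>
     loop_system X A L \<and> locus L \<subseteq> locus m \<union> locus n \<and>
     (\<forall>e\<in>one_cells X A m n.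
        a e = 1 \<and> runs_along A L (m \<union> n) e \<or> a e = 0 \<and> e \<inter> locus L = {})"

text \<open>The homotopy class of the multicurve that remains of the chain \<open>a\<close> once the loops bounding
  discs, i.e. the null homotopic ones, are discarded.\<close>

definition chain_class ::
    "'a topology \<Rightarrow> 'a chart set \<Rightarrow> (complex \<Rightarrow> 'a) set \<Rightarrow> (complex \<Rightarrow> 'a) set \<Rightarrow>
     'a one_chain \<Rightarrow> (complex \<Rightarrow> 'a) set set" where
  "chain_class X A m n a =
     {m'. \<exists>L. realizes X A m n a L \<and> m' \<in> homotopy_class X A {c\<in>L. \<not> null_homotopic X c}}"

definition constructed_path ::
    "'a topology \<Rightarrow> 'a chart set \<Rightarrow> (complex \<Rightarrow> 'a) set \<Rightarrow> (complex \<Rightarrow> 'a) set \<Rightarrow>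
     (complex \<Rightarrow> 'a) set set list \<Rightarrow> bool" where
  "constructed_path X A m n P \<longleftrightarrow>
     (\<exists>\<gamma>s. construction X A m n \<gamma>s \<and>
        P = homotopy_class X A m # map (chain_class X A m n) (tl \<gamma>s) @ [homotopy_class X A n])"

end

theory Submission
  imports Defs
begin

text \<open>The union of two multicurves \<open>m\<close> and \<open>n\<close> in minimal position cuts the surface into faces, and every
  one-cell \<open>e\<close> of the union has one face on its left and one on its right. An overlap function of a chain \<open>a\<close> is
  the same as a function \<open>f\<close> on the faces, with minimum 0, whose coboundary \<open>f (left of e) - f (right of e)\<close> is
  \<open>a e\<close> for every \<open>e\<close> (\<open>overlap_function_iff\<close>), and the boundary of a union of faces is the coboundary of its
  indicator function (\<open>boundary_chain_eq\<close>). Thus the path construction takes place on the dual graph.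

  Let \<open>f\<^sub>0, \<dots>, f\<^sub>j\<close> be the overlap functions used on the way from \<open>m\<close> to \<open>n\<close>, and let \<open>R\<^sub>i\<close> be the region where
  \<open>f\<^sub>i\<close> is maximal, so that \<open>\<gamma>\<^sub>i\<^sub>+\<^sub>1 = \<gamma>\<^sub>i + \<partial>R\<^sub>i\<close>; this includes \<open>n = \<gamma>\<^sub>j + \<partial>R\<^sub>j\<close>, since \<open>f\<^sub>j\<close> has only the values 0
  and 1. On a connected surface \<open>f\<^sub>i\<^sub>+\<^sub>1\<close> is \<open>f\<^sub>i\<close> lowered by one on \<open>R\<^sub>i\<close>. Hence the maximum drops by one
  in each step and \<open>R\<^sub>0 \<subseteq> R\<^sub>1 \<subseteq> \<dots>\<close>. The function that counts the indices \<open>i \<le> p\<close> with \<open>x\<close> outside \<open>R\<^sub>i\<close> has the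
  coboundary \<open>m - \<gamma>\<^sub>p\<^sub>+\<^sub>1\<close>, and by the inclusions its maximum \<open>p + 1\<close> is attained exactly outside \<open>R\<^sub>p\<close>. So the
  interchanged construction adds \<open>- \<partial>R\<^sub>p\<close> to \<open>\<gamma>\<^sub>p\<^sub>+\<^sub>1\<close> and arrives at \<open>\<gamma>\<^sub>p\<close>.

  On a disconnected surface overlap functions are unique only up to constants on the components, and a component
  may be left unchanged in some steps. The regions \<open>R\<^sub>i\<close> that split a given component are still nested there
  (\<open>peak_mono\<close>), and the counting function is corrected by a constant on each component (\<open>retrace\<close>); its
  height is computed from the subadditivity of heights (\<open>start_range\<close>). The result is \<open>descent_reverse\<close>.

  The translation to the dual graph rests on \<open>local_model\<close>: off the vertices, the union of the two multicurves is
  locally an arc with two connected sides, and paths leaving the arc transversely enter the expected side. If the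
  surface is connected, a function on the faces without coboundary is constant (\<open>kernel_const\<close>), so the
  overlap functions, and with them the constructed path, are unique.\<close>

section \<open>Descent on a dual graph\<close>

text \<open>The dual graph of a cell complex. Its vertices are the faces, represented by their points: \<open>V\<close> is the
  set of all points of faces, and \<open>face x\<close> is the face through \<open>x\<close>. There is one edge for every one-cell \<open>e\<close>,
  running from a point \<open>r e\<close> of the face on its right to a point \<open>l e\<close> of the face on its left.\<close>

locale dual_graph =
  fixes V :: "'v set" and face :: "'v \<Rightarrow> 'v set" and E :: "'e set" and l r :: "'e \<Rightarrow> 'v"
  assumes l_in [simp]: "e \<in> E \<Longrightarrow> l e \<in> V" and r_in [simp]: "e \<in> E \<Longrightarrow> r e \<in> V"
begin

text \<open>Constant on every face.\<close>

definition loc_const :: "('v \<Rightarrow> int) \<Rightarrow> bool" where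
  "loc_const f \<longleftrightarrow> (\<forall>x\<in>V. \<forall>y\<in>V \<inter> face x. f y = f x)"

text \<open>The coboundary of a function on faces, as a one-chain: its increase from right to left.\<close>

definition cobd :: "('v \<Rightarrow> int) \<Rightarrow> 'e \<Rightarrow> int" where
  "cobd f e = (if e \<in> E then f (l e) - f (r e) else 0)"

text \<open>The combinatorial form of an overlap function of the chain \<open>a\<close>.\<close>

definition overlap :: "('e \<Rightarrow> int) \<Rightarrow> ('v \<Rightarrow> int) \<Rightarrow> bool" where
  "overlap a f \<longleftrightarrow>
     loc_const f \<and> (\<forall>x\<in>V. 0 \<le> f x) \<and> (\<exists>x\<in>V. f x = 0) \<and> (\<forall>e\<in>E. a e = cobd f e)"

text \<open>An overlap function whose maximum \<open>M\<close>, the height of the chain, is as small as possible.\<close>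

definition tight :: "('e \<Rightarrow> int) \<Rightarrow> ('v \<Rightarrow> int) \<Rightarrow> int \<Rightarrow> bool" where
  "tight a f M \<longleftrightarrow> overlap a f \<and> attains_max f V M \<and>
     (\<forall>g N. overlap a g \<and> attains_max g V N \<longrightarrow> M \<le> N)"

text \<open>The path construction from \<open>m\<close> to \<open>n\<close> on the dual graph: \<open>\<gamma>s\<close> lists \<open>m\<close> and the successive chains, the
  target \<open>n\<close> excluded.\<close>

definition descent :: "('e \<Rightarrow> int) \<Rightarrow> ('e \<Rightarrow> int) \<Rightarrow> ('e \<Rightarrow> int) list \<Rightarrow> bool" where
  "descent m n \<gamma>s \<longleftrightarrow>
     \<gamma>s \<noteq> [] \<and> \<gamma>s ! 0 = m \<and>
     (\<forall>i<length \<gamma>s. \<exists>f M. tight (\<lambda>e. n e - (\<gamma>s ! i) e) f M \<and>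
        (if Suc i = length \<gamma>s then M = 1
         else M \<noteq> 1 \<and> \<gamma>s ! Suc i = (\<lambda>e. (\<gamma>s ! i) e + cobd (\<lambda>x. of_bool (f x = M)) e)))"

text \<open>Shifting a bounded function by its minimum gives an overlap function, so the height of a chain is at
  most the oscillation of any function with that coboundary. All height estimates use \<open>tight_le\<close>.\<close>

lemma overlap_of_bounded:
  assumes "loc_const h" "\<forall>e\<in>E. a e = cobd h e" "\<forall>x\<in>V. L \<le> h x \<and> h x \<le> N" "V \<noteq> {}"
  obtains g M where "overlap a g" "attains_max g V M" "M \<le> N - L"
proof -
  have "h ` V \<subseteq> {L..N}" using assms(3) by auto
  then have fin: "finite (h ` V)" using finite_subset by blast
  have ne: "h ` V \<noteq> {}" using assms(4) by simp
  define \<mu> where "\<mu> = Min (h ` V)"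
  define M where "M = Max (h ` V)"
  obtain x0 where x0: "x0 \<in> V" "h x0 = \<mu>" using Min_in[OF fin ne] unfolding \<mu>_def by auto
  obtain x1 where x1: "x1 \<in> V" "h x1 = M" using Max_in[OF fin ne] unfolding M_def by auto
  have ge: "\<mu> \<le> h x" if "x \<in> V" for x using that fin unfolding \<mu>_def by auto
  have le: "h x \<le> M" if "x \<in> V" for x using that fin unfolding M_def by auto
  show ?thesis
  proof
    show "overlap a (\<lambda>x. h x - \<mu>)"
      using assms(1,2) ge x0 unfolding overlap_def loc_const_def cobd_def by auto
    show "attains_max (\<lambda>x. h x - \<mu>) V (M - \<mu>)"
      unfolding attains_max_def using le x1 by auto
    show "M - \<mu> \<le> N - L" using assms(3)[rule_format, OF x0(1)] assms(3)[rule_format, OF x1(1)] x0(2) x1(2) by linarith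
  qed
qed

lemma tight_le:
  assumes "tight a f M" "loc_const h" "\<forall>e\<in>E. a e = cobd h e" "\<forall>x\<in>V. L \<le> h x \<and> h x \<le> N"
  shows "M \<le> N - L"
proof -
  have "V \<noteq> {}" using assms(1) unfolding tight_def attains_max_def by auto
  then obtain g M' where "overlap a g" "attains_max g V M'" "M' \<le> N - L"
    using overlap_of_bounded assms(2-4) by metis
  then show ?thesis using assms(1) unfolding tight_def by force
qed

text \<open>The functions without coboundary. They are constant on the connected components of the dual graph;
  \<open>linked\<close> is the relation of lying in the same component, expressed through them.\<close>

definition kernel :: "('v \<Rightarrow> int) set" where
  "kernel = {k. loc_const k \<and> (\<forall>e\<in>E. k (l e) = k (r e))}"

definition linked :: "'v \<Rightarrow> 'v \<Rightarrow> bool" where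
  "linked x y \<longleftrightarrow> x \<in> V \<and> y \<in> V \<and> (\<forall>k\<in>kernel. k x = k y)"

lemma linked_refl: "x \<in> V \<Longrightarrow> linked x x"
  by (simp add: linked_def)

lemma linked_cong: "linked x y \<Longrightarrow> linked x z \<longleftrightarrow> linked y z"
  unfolding linked_def by metis

lemma linked_sides: "e \<in> E \<Longrightarrow> linked (l e) (r e)"
  by (auto simp: linked_def kernel_def)

lemma linked_face: "x \<in> V \<Longrightarrow> y \<in> V \<Longrightarrow> y \<in> face x \<Longrightarrow> linked x y"
  by (auto simp: linked_def kernel_def loc_const_def)

text \<open>The set \<open>R\<close> splits the component of \<open>x\<close>, i.e. it neither contains it nor misses it.\<close>

definition cuts :: "'v set \<Rightarrow> 'v \<Rightarrow> bool" where
  "cuts R x \<longleftrightarrow> (\<exists>y z. linked x y \<and> linked x z \<and> y \<in> R \<and> z \<notin> R)"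

lemma cuts_cong: "linked x y \<Longrightarrow> cuts R x \<longleftrightarrow> cuts R y"
  unfolding cuts_def by (meson linked_cong)

lemma not_cuts: "\<not> cuts R x \<Longrightarrow> linked x y \<Longrightarrow> linked x z \<Longrightarrow> y \<in> R \<longleftrightarrow> z \<in> R"
  unfolding cuts_def by blast

end

text \<open>A completed run of the construction: \<open>\<gamma> 0\<close> is the start, \<open>\<gamma> (Suc j)\<close> the target, and \<open>f i\<close> the overlap
  function of height \<open>M i\<close> used in step \<open>i\<close>. Since \<open>M j = 1\<close>, the passage from \<open>\<gamma> j\<close> to the target is a
  step of the same kind as the others.\<close>

locale descending_chain = dual_graph V face E l r
  for V :: "'v set" and face :: "'v \<Rightarrow> 'v set" and E :: "'e set" and l r :: "'e \<Rightarrow> 'v" +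
  fixes \<gamma> :: "nat \<Rightarrow> 'e \<Rightarrow> int" and f :: "nat \<Rightarrow> 'v \<Rightarrow> int" and M :: "nat \<Rightarrow> int" and j :: nat
  assumes tight: "i \<le> j \<Longrightarrow> tight (\<lambda>e. \<gamma> (Suc j) e - \<gamma> i e) (f i) (M i)"
    and last: "M j = 1"
    and step: "i \<le> j \<Longrightarrow> \<gamma> (Suc i) = (\<lambda>e. \<gamma> i e + cobd (\<lambda>x. of_bool (f i x = M i)) e)"
begin

text \<open>The region whose boundary is added in step \<open>i\<close>.\<close>

definition peak :: "nat \<Rightarrow> 'v set" where
  "peak i = {x \<in> V. f i x = M i}"

lemma f_const: "i \<le> j \<Longrightarrow> loc_const (f i)"
  and f_nonneg: "i \<le> j \<Longrightarrow> x \<in> V \<Longrightarrow> 0 \<le> f i x"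
  and f_le: "i \<le> j \<Longrightarrow> x \<in> V \<Longrightarrow> f i x \<le> M i"
  and f_cobd: "i \<le> j \<Longrightarrow> e \<in> E \<Longrightarrow> \<gamma> (Suc j) e - \<gamma> i e = f i (l e) - f i (r e)"
  using tight[of i] unfolding tight_def overlap_def attains_max_def cobd_def by auto

lemma step_at: "i \<le> j \<Longrightarrow> e \<in> E \<Longrightarrow>
    \<gamma> (Suc i) e = \<gamma> i e + (of_bool (l e \<in> peak i) - of_bool (r e \<in> peak i))"
  using step[of i] by (simp add: cobd_def peak_def)

text \<open>A chain of height 0 would be left unchanged by its step, so the height could never become 1 later.\<close>

lemma height_pos:
  assumes "i \<le> j" shows "1 \<le> M i"
  using assms
proof (induction rule: inc_induct)
  case base
  show ?case by (simp add: last)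
next
  case (step i)
  show ?case
  proof (rule ccontr)
    assume "\<not> 1 \<le> M i"
    then have z: "f i x = 0 \<and> M i = 0" if "x \<in> V" for x
      using that f_nonneg[of i x] f_le[of i x] step.hyps by force
    have e: "\<gamma> (Suc j) e - \<gamma> (Suc i) e = 0" if "e \<in> E" for e
      using that step_at[of i e] f_cobd[of i e] z[of "l e"] z[of "r e"] step.hyps
      by (simp add: peak_def)
    have "M (Suc i) \<le> 0 - 0"
      by (rule tight_le[OF tight, where h="\<lambda>_. 0"]) (use step.hyps e in \<open>auto simp: loc_const_def cobd_def\<close>)
    then show False using step.IH by simp
  qed
qed

text \<open>Lowering \<open>f i\<close> by one on its peak gives a function for \<open>\<gamma> (Suc i)\<close>; conversely, raising \<open>f (Suc i)\<close> by
  one on that peak gives a function for \<open>\<gamma> i\<close>.\<close>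

lemma height_Suc:
  assumes "i < j" shows "M (Suc i) = M i - 1"
proof -
  have i: "i \<le> j" "Suc i \<le> j" using assms by auto
  have "M (Suc i) \<le> (M i - 1) - 0"
  proof (rule tight_le[OF tight[OF i(2)], where h="\<lambda>x. f i x - of_bool (f i x = M i)"])
    show "loc_const (\<lambda>x. f i x - of_bool (f i x = M i))"
      using f_const[OF i(1)] by (auto simp: loc_const_def)
    show "\<forall>e\<in>E. \<gamma> (Suc j) e - \<gamma> (Suc i) e = cobd (\<lambda>x. f i x - of_bool (f i x = M i)) e"
      using step_at[OF i(1)] f_cobd[OF i(1)] by (force simp: cobd_def peak_def)
    show "\<forall>x\<in>V. 0 \<le> f i x - of_bool (f i x = M i) \<and> f i x - of_bool (f i x = M i) \<le> M i - 1"
    proof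
      fix x assume "x \<in> V"
      then show "0 \<le> f i x - of_bool (f i x = M i) \<and> f i x - of_bool (f i x = M i) \<le> M i - 1"
        using f_nonneg[OF i(1), of x] f_le[OF i(1), of x] height_pos[OF i(1)]
        by (cases "f i x = M i") auto
    qed
  qed
  moreover have "M i \<le> (M (Suc i) + 1) - 0"
  proof (rule tight_le[OF tight[OF i(1)], where h="\<lambda>x. f (Suc i) x + of_bool (f i x = M i)"])
    show "loc_const (\<lambda>x. f (Suc i) x + of_bool (f i x = M i))"
      using f_const[OF i(1)] f_const[OF i(2)] by (auto simp: loc_const_def)
    show "\<forall>e\<in>E. \<gamma> (Suc j) e - \<gamma> i e = cobd (\<lambda>x. f (Suc i) x + of_bool (f i x = M i)) e"
      using step_at[OF i(1)] f_cobd[OF i(2)] by (force simp: cobd_def peak_def)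
    show "\<forall>x\<in>V. 0 \<le> f (Suc i) x + of_bool (f i x = M i) \<and>
        f (Suc i) x + of_bool (f i x = M i) \<le> M (Suc i) + 1"
      using f_nonneg[OF i(2)] f_le[OF i(2)] by (auto simp: add_increasing2 intro!: add_mono)
  qed
  ultimately show ?thesis by simp
qed

lemma height: "i \<le> j \<Longrightarrow> M i = int (Suc j - i)"
proof (induction rule: inc_induct)
  case base then show ?case by (simp add: last)
next
  case (step i) then show ?case using height_Suc[of i] by simp
qed

text \<open>On a single component, \<open>f (Suc i)\<close> is \<open>f i\<close> lowered on its peak, up to a constant. The constant depends
  on the component, because overlap functions are not unique on a disconnected surface.\<close>

lemma f_Suc_linked:
  assumes "i < j" "linked x y"
  shows "f (Suc i) y - f (Suc i) x
       = (f i y - of_bool (y \<in> peak i)) - (f i x - of_bool (x \<in> peak i))"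
proof -
  define k where "k = (\<lambda>x. f (Suc i) x - f i x + of_bool (f i x = M i))"
  have i: "i \<le> j" "Suc i \<le> j" using assms by auto
  have "k \<in> kernel"
    unfolding kernel_def k_def
    using f_const[OF i(1)] f_const[OF i(2)] step_at[OF i(1)] f_cobd[OF i(1)] f_cobd[OF i(2)]
    by (force simp: loc_const_def peak_def)
  then have "k x = k y" and V: "x \<in> V" "y \<in> V" using assms(2) by (auto simp: linked_def)
  then show ?thesis unfolding k_def peak_def by simp
qed

text \<open>A point of a peak keeps the largest value on its component in all later steps. Hence the peaks that
  cut a component increase (\<open>peak_mono\<close>).\<close>

lemma peak_persists:
  assumes "i \<le> p" "p \<le> j" "x \<in> peak i" "linked x y"
  shows "f p y \<le> f p x"
  using assms(1,2,4)
proof (induction p arbitrary: y rule: dec_induct)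
  case base
  then show ?case using assms(3) f_le[of i] by (auto simp: peak_def linked_def)
next
  case (step q)
  have q: "q < j" using step.prems(1) by simp
  have xy: "x \<in> V" "y \<in> V" using step.prems by (auto simp: linked_def)
  have "f q y \<le> f q x" "f q x \<le> M q" using step.IH step.prems f_le[of q x] q xy by simp_all
  then show ?case
    using f_Suc_linked[OF q step.prems(2)] xy
    by (cases "f q x = M q"; cases "f q y = M q") (simp_all add: peak_def)
qed

lemma peak_mono:
  assumes "i \<le> p" "p \<le> j" "x \<in> peak i" "cuts (peak p) x"
  shows "x \<in> peak p"
proof -
  have x: "x \<in> V" using assms(3) by (simp add: peak_def)
  obtain y where "linked x y" "y \<in> peak p" using assms(4) by (auto simp: cuts_def)
  then have "M p \<le> f p x" using peak_persists[OF assms(1-3)] by (force simp: peak_def)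
  then show ?thesis using f_le[OF assms(2) x] x by (simp add: peak_def)
qed

text \<open>A lower bound for the heights of the interchanged construction: the distance from the start to the
  target is at most the sum of the distances to \<open>\<gamma> (Suc p)\<close>.\<close>

lemma start_range:
  assumes "p \<le> j" "loc_const g" "\<forall>e\<in>E. \<gamma> 0 e - \<gamma> (Suc p) e = cobd g e"
    "\<forall>x\<in>V. L \<le> g x \<and> g x \<le> N"
  shows "int (Suc p) \<le> N - L"
proof (cases "p = j")
  case True
  have "M 0 \<le> (- L) - (- N)"
    by (rule tight_le[OF tight, where h="\<lambda>x. - g x"])
      (use assms True in \<open>force simp: loc_const_def cobd_def\<close>)+
  then show ?thesis using True height[of 0] by simp
next
  case False
  then have p: "Suc p \<le> j" using assms(1) by simp
  have "M 0 \<le> (M (Suc p) - L) - (0 - N)"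
  proof (rule tight_le[OF tight, where h="\<lambda>x. f (Suc p) x - g x"])
    show "loc_const (\<lambda>x. f (Suc p) x - g x)"
      using f_const[OF p] assms(2) by (auto simp: loc_const_def)
    show "\<forall>e\<in>E. \<gamma> (Suc j) e - \<gamma> 0 e = cobd (\<lambda>x. f (Suc p) x - g x) e"
      using f_cobd[OF p] assms(3) by (force simp: cobd_def)
    show "\<forall>x\<in>V. 0 - N \<le> f (Suc p) x - g x \<and> f (Suc p) x - g x \<le> M (Suc p) - L"
    proof
      fix x assume "x \<in> V"
      then show "0 - N \<le> f (Suc p) x - g x \<and> f (Suc p) x - g x \<le> M (Suc p) - L"
        using f_nonneg[OF p, of x] f_le[OF p, of x] assms(4) by force
    qed
  qed simp
  then show ?thesis using height[OF p] height[of 0] p by simp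
qed

text \<open>The overlap function from \<open>\<gamma> (Suc p)\<close> back to \<open>\<gamma> 0\<close>: it counts the peaks up to \<open>p\<close> that do not contain
  \<open>x\<close>. A peak that does not cut the component of \<open>x\<close> has no boundary there. Such peaks add a constant,
  chosen to be 1 exactly if peak \<open>p\<close> cuts the component, so that the maximum \<open>Suc p\<close> is attained on the
  components that are to be changed and on no others.\<close>

definition retrace :: "nat \<Rightarrow> 'v \<Rightarrow> int" where
  "retrace p x = (\<Sum>i\<le>p. if cuts (peak i) x then of_bool (x \<notin> peak i) else of_bool (cuts (peak p) x))"

lemma retrace_const: "p \<le> j \<Longrightarrow> loc_const (retrace p)"
  unfolding loc_const_def
proof (intro ballI)
  fix x y assume p: "p \<le> j" and x: "x \<in> V" and y: "y \<in> V \<inter> face x"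
  have lk: "linked x y" using linked_face x y by blast
  have "x \<in> peak i \<longleftrightarrow> y \<in> peak i" if "i \<le> p" for i
    using f_const[of i] p that x y by (auto simp: loc_const_def peak_def)
  then show "retrace p y = retrace p x"
    unfolding retrace_def using cuts_cong[OF lk] by (intro sum.cong) auto
qed

lemma chain_telescope:
  assumes "p \<le> j" "e \<in> E"
  shows "\<gamma> (Suc p) e - \<gamma> 0 e = (\<Sum>i\<le>p. of_bool (l e \<in> peak i) - of_bool (r e \<in> peak i))"
  using assms
proof (induction p)
  case 0 then show ?case using step_at[of 0 e] by simp
next
  case (Suc p) then show ?case using step_at[of "Suc p" e] by simp
qed

lemma retrace_cobd:
  assumes "p \<le> j" "e \<in> E"
  shows "\<gamma> 0 e - \<gamma> (Suc p) e = cobd (retrace p) e"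
proof -
  have lk: "linked (l e) (r e)" using linked_sides assms by blast
  have "cobd (retrace p) e = (\<Sum>i\<le>p. - (of_bool (l e \<in> peak i) - of_bool (r e \<in> peak i)))"
    unfolding cobd_def retrace_def using assms(2) cuts_cong[OF lk]
      not_cuts[OF _ linked_refl[OF l_in[OF assms(2)]] lk]
    by (simp only: if_True simp_thms flip: sum_subtractf) (intro sum.cong, auto)
  then show ?thesis using chain_telescope[OF assms] by (simp only: sum_negf)
qed

lemma retrace_range:
  shows "0 \<le> retrace p x" "retrace p x \<le> int (Suc p)"
proof -
  show "0 \<le> retrace p x" unfolding retrace_def by (intro sum_nonneg) auto
  have "retrace p x \<le> (\<Sum>i\<le>p. 1)" unfolding retrace_def by (intro sum_mono) auto
  then show "retrace p x \<le> int (Suc p)" by simp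
qed

lemma retrace_peak:
  assumes "p \<le> j" "x \<in> V"
  shows "retrace p x = int (Suc p) \<longleftrightarrow> cuts (peak p) x \<and> x \<notin> peak p"
proof
  assume eq: "retrace p x = int (Suc p)"
  let ?t = "\<lambda>i. if cuts (peak i) x then of_bool (x \<notin> peak i) else of_bool (cuts (peak p) x) :: int"
  have "retrace p x = (\<Sum>i<p. ?t i) + ?t p"
    unfolding retrace_def by (simp flip: lessThan_Suc_atMost)
  also have "(\<Sum>i<p. ?t i) \<le> (\<Sum>i<p. 1)" by (intro sum_mono) auto
  finally have "1 \<le> ?t p" using eq by simp
  then show "cuts (peak p) x \<and> x \<notin> peak p" by (auto split: if_splits simp: of_bool_def)
next
  assume *: "cuts (peak p) x \<and> x \<notin> peak p"
  have "x \<notin> peak i" if "i \<le> p" for i using peak_mono[OF that assms(1)] * by blast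
  then have "retrace p x = (\<Sum>i\<le>p. 1)" unfolding retrace_def using * by (intro sum.cong) auto
  then show "retrace p x = int (Suc p)" by simp
qed

lemma retrace_tight:
  assumes "p \<le> j"
  shows "tight (\<lambda>e. \<gamma> 0 e - \<gamma> (Suc p) e) (retrace p) (int (Suc p))"
  unfolding tight_def overlap_def
proof (intro conjI allI impI)
  note c = retrace_const[OF assms] and d = retrace_cobd[OF assms]
  show "loc_const (retrace p)" by fact
  show "\<forall>x\<in>V. 0 \<le> retrace p x" using retrace_range by blast
  show "\<forall>e\<in>E. \<gamma> 0 e - \<gamma> (Suc p) e = cobd (retrace p) e" using d by blast
  show "\<exists>x\<in>V. retrace p x = 0"
  proof (rule ccontr)
    assume neg: "\<not> ?thesis"
    have "1 \<le> retrace p x \<and> retrace p x \<le> int (Suc p)" if "x \<in> V" for x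
    proof -
      have "retrace p x \<noteq> 0" using neg that by blast
      then show ?thesis using retrace_range[of p x] by linarith
    qed
    then have "\<forall>x\<in>V. 1 \<le> retrace p x \<and> retrace p x \<le> int (Suc p)" by blast
    from start_range[OF assms c _ this] d show False by simp
  qed
  have "\<exists>x\<in>V. retrace p x = int (Suc p)"
  proof (rule ccontr)
    assume neg: "\<not> ?thesis"
    have "0 \<le> retrace p x \<and> retrace p x \<le> int p" if "x \<in> V" for x
    proof -
      have "retrace p x \<noteq> int (Suc p)" using neg that by blast
      then show ?thesis using retrace_range[of p x] by linarith
    qed
    then have "\<forall>x\<in>V. 0 \<le> retrace p x \<and> retrace p x \<le> int p" by blast
    from start_range[OF assms c _ this] d show False by simp
  qed
  then show "attains_max (retrace p) V (int (Suc p))"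
    using retrace_range by (auto simp: attains_max_def simp del: of_nat_Suc)
next
  fix g N
  assume "((loc_const g \<and> (\<forall>x\<in>V. 0 \<le> g x) \<and> (\<exists>x\<in>V. g x = 0) \<and>
    (\<forall>e\<in>E. \<gamma> 0 e - \<gamma> (Suc p) e = cobd g e)) \<and> attains_max g V N)"
  then show "int (Suc p) \<le> N" using start_range[OF assms, of g 0 N] by (auto simp: attains_max_def)
qed

text \<open>The region where \<open>retrace p\<close> is largest is, on each component cut by peak \<open>p\<close>, the complement of that
  peak, so its boundary is the negative of the one added in step \<open>p\<close>.\<close>

lemma retrace_step:
  assumes "p \<le> j"
  shows "\<gamma> p = (\<lambda>e. \<gamma> (Suc p) e + cobd (\<lambda>x. of_bool (retrace p x = int (Suc p))) e)"
proof
  fix e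
  show "\<gamma> p e = \<gamma> (Suc p) e + cobd (\<lambda>x. of_bool (retrace p x = int (Suc p))) e"
  proof (cases "e \<in> E")
    case True
    have lk: "linked (l e) (r e)" using linked_sides True by blast
    show ?thesis
      using step_at[OF assms True] retrace_peak[OF assms l_in[OF True]] retrace_peak[OF assms r_in[OF True]]
        cuts_cong[OF lk, of "peak p"] not_cuts[OF _ linked_refl[OF l_in[OF True]] lk, of "peak p"] True
      unfolding cobd_def by (simp del: of_nat_Suc add: of_bool_def)
  next
    case False
    then show ?thesis using step[OF assms] by (simp add: cobd_def)
  qed
qed

lemma descent_back:
  "descent (\<gamma> (Suc j)) (\<gamma> 0) (map (\<lambda>k. \<gamma> (Suc j - k)) [0..<Suc j])"
  unfolding descent_def
proof (intro conjI allI impI)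
  let ?gs = "map (\<lambda>k. \<gamma> (Suc j - k)) [0..<Suc j]"
  show "?gs \<noteq> []" by simp
  show "?gs ! 0 = \<gamma> (Suc j)" by (simp del: upt_Suc)
  fix k assume k: "k < length ?gs"
  define p where "p = j - k"
  have p: "p \<le> j" "Suc j - k = Suc p" using k by (auto simp: p_def)
  show "\<exists>g N. tight (\<lambda>e. \<gamma> 0 e - (?gs ! k) e) g N \<and>
      (if Suc k = length ?gs then N = 1
       else N \<noteq> 1 \<and> ?gs ! Suc k = (\<lambda>e. (?gs ! k) e + cobd (\<lambda>x. of_bool (g x = N)) e))"
  proof (intro exI[of _ "retrace p"] exI[of _ "int (Suc p)"] conjI)
    have gk: "?gs ! k = \<gamma> (Suc p)" using k p by (simp del: upt_Suc)
    show "tight (\<lambda>e. \<gamma> 0 e - (?gs ! k) e) (retrace p) (int (Suc p))"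
      using retrace_tight[OF p(1)] gk by simp
    show "if Suc k = length ?gs then int (Suc p) = 1
       else int (Suc p) \<noteq> 1 \<and>
         ?gs ! Suc k = (\<lambda>e. (?gs ! k) e + cobd (\<lambda>x. of_bool (retrace p x = int (Suc p))) e)"
    proof (cases "k = j")
      case True then show ?thesis by (simp add: p_def)
    next
      case False
      then have "Suc k < Suc j" using k by simp
      moreover have "?gs ! Suc k = \<gamma> p" using \<open>Suc k < Suc j\<close> by (simp del: upt_Suc add: p_def)
      ultimately show ?thesis using retrace_step[OF p(1)] gk by (simp add: p_def)
    qed
  qed
qed

end

context dual_graph
begin

lemma descent_reverse:
  assumes "descent m n \<gamma>s" and m0: "\<And>e. e \<notin> E \<Longrightarrow> m e = 0" and n0: "\<And>e. e \<notin> E \<Longrightarrow> n e = 0"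
  shows "descent n m (n # rev (tl \<gamma>s))"
proof -
  define j where "j = length \<gamma>s - 1"
  have ne: "\<gamma>s \<noteq> []" and hd: "\<gamma>s ! 0 = m" and len: "length \<gamma>s = Suc j"
    using assms(1) by (auto simp: descent_def j_def)
  define \<gamma> where "\<gamma> i = (if i \<le> j then \<gamma>s ! i else n)" for i
  have "\<forall>i. \<exists>f M. i \<le> j \<longrightarrow> tight (\<lambda>e. n e - (\<gamma>s ! i) e) f M \<and> (if i = j then M = 1
         else M \<noteq> 1 \<and> \<gamma>s ! Suc i = (\<lambda>e. (\<gamma>s ! i) e + cobd (\<lambda>x. of_bool (f x = M)) e))"
  proof
    fix i
    show "\<exists>f M. i \<le> j \<longrightarrow> tight (\<lambda>e. n e - (\<gamma>s ! i) e) f M \<and> (if i = j then M = 1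
         else M \<noteq> 1 \<and> \<gamma>s ! Suc i = (\<lambda>e. (\<gamma>s ! i) e + cobd (\<lambda>x. of_bool (f x = M)) e))"
    proof (cases "i \<le> j")
      case True
      then have "i < length \<gamma>s" using len by simp
      from assms(1)[unfolded descent_def, THEN conjunct2, THEN conjunct2, rule_format, OF this]
      show ?thesis unfolding len nat.inject by blast
    qed simp
  qed
  from choice[OF this] obtain f where
    "\<forall>i. \<exists>M. i \<le> j \<longrightarrow> tight (\<lambda>e. n e - (\<gamma>s ! i) e) (f i) M \<and> (if i = j then M = 1
         else M \<noteq> 1 \<and> \<gamma>s ! Suc i = (\<lambda>e. (\<gamma>s ! i) e + cobd (\<lambda>x. of_bool (f i x = M)) e))" ..
  from choice[OF this] obtain M where
    fM_all: "\<forall>i. i \<le> j \<longrightarrow> tight (\<lambda>e. n e - (\<gamma>s ! i) e) (f i) (M i) \<and> (if i = j then M i = 1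
         else M i \<noteq> 1 \<and> \<gamma>s ! Suc i = (\<lambda>e. (\<gamma>s ! i) e + cobd (\<lambda>x. of_bool (f i x = M i)) e))" ..
  have fM: "tight (\<lambda>e. n e - (\<gamma>s ! i) e) (f i) (M i)" if "i \<le> j" for i
    using fM_all that by blast
  have Mj: "M j = 1" using fM_all[rule_format, of j] by simp
  have st: "\<gamma>s ! Suc i = (\<lambda>e. (\<gamma>s ! i) e + cobd (\<lambda>x. of_bool (f i x = M i)) e)" if "i < j" for i
    using fM_all[rule_format, of i] that by simp
  have off: "(\<gamma>s ! i) e = 0" if "i \<le> j" "e \<notin> E" for i e
    using that(1)
  proof (induction i)
    case 0 then show ?case using hd m0 that by simp
  next
    case (Suc i) then show ?case using st[of i] that by (simp add: cobd_def)
  qed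
  \<comment> \<open>A function with values 0 and 1 is the indicator of its peak, so the last step reaches the target.\<close>
  have target: "n = (\<lambda>e. (\<gamma>s ! j) e + cobd (\<lambda>x. of_bool (f j x = M j)) e)"
  proof
    fix e
    show "n e = (\<gamma>s ! j) e + cobd (\<lambda>x. of_bool (f j x = M j)) e"
    proof (cases "e \<in> E")
      case True
      have b: "f j x = of_bool (f j x = 1)" if "x \<in> V" for x
      proof -
        have "0 \<le> f j x" "f j x \<le> 1"
          using fM[of j] Mj that by (auto simp: tight_def overlap_def attains_max_def)
        then show ?thesis by auto
      qed
      have "n e - (\<gamma>s ! j) e = f j (l e) - f j (r e)"
        using fM[of j] True by (simp add: tight_def overlap_def cobd_def)
      then show ?thesis using b[of "l e"] b[of "r e"] True Mj by (simp add: cobd_def)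
    next
      case False then show ?thesis using off[of j e] n0 by (simp add: cobd_def)
    qed
  qed
  interpret descending_chain V face E l r \<gamma> f M j
  proof
    show "tight (\<lambda>e. \<gamma> (Suc j) e - \<gamma> i e) (f i) (M i)" if "i \<le> j" for i
      using fM[OF that] that by (simp add: \<gamma>_def)
    show "M j = 1" by fact
    show "\<gamma> (Suc i) = (\<lambda>e. \<gamma> i e + cobd (\<lambda>x. of_bool (f i x = M i)) e)" if "i \<le> j" for i
      using that st[of i] target by (cases "i = j") (auto simp: \<gamma>_def)
  qed
  have "n # rev (tl \<gamma>s) = map (\<lambda>k. \<gamma> (Suc j - k)) [0..<Suc j]"
  proof (rule nth_equalityI)
    show "length (n # rev (tl \<gamma>s)) = length (map (\<lambda>k. \<gamma> (Suc j - k)) [0..<Suc j])"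
      using len by simp
    fix k assume "k < length (n # rev (tl \<gamma>s))"
    then show "(n # rev (tl \<gamma>s)) ! k = map (\<lambda>k. \<gamma> (Suc j - k)) [0..<Suc j] ! k"
      using len by (cases k) (auto simp: \<gamma>_def rev_nth nth_tl Suc_diff_le Suc_diff_Suc simp del: upt_Suc)
  qed
  moreover have "\<gamma> (Suc j) = n" "\<gamma> 0 = m" using hd by (auto simp: \<gamma>_def)
  ultimately show ?thesis using descent_back by simp
qed

lemma tight_unique:
  assumes conn: "\<And>k x y. k \<in> kernel \<Longrightarrow> x \<in> V \<Longrightarrow> y \<in> V \<Longrightarrow> k x = k y"
    and "tight a f M" "tight a g N"
  shows "M = N \<and> (\<forall>x\<in>V. f x = g x)"
proof -
  have f: "overlap a f" "attains_max f V M" and g: "overlap a g" "attains_max g V N"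
    using assms(2,3) by (auto simp: tight_def)
  have "(\<lambda>x. f x - g x) \<in> kernel"
    using f(1) g(1) unfolding kernel_def overlap_def loc_const_def cobd_def by force
  then have *: "f x - g x = f y - g y" if "x \<in> V" "y \<in> V" for x y using conn that by blast
  obtain x y where x: "x \<in> V" "f x = 0" and y: "y \<in> V" "g y = 0"
    using f(1) g(1) by (auto simp: overlap_def)
  have "0 \<le> f y" "0 \<le> g x" using f(1) g(1) x y by (auto simp: overlap_def)
  then have "f y = 0" using *[OF x(1) y(1)] x y by simp
  then have eq: "f z = g z" if "z \<in> V" for z using *[OF that y(1)] y by simp
  moreover have "M = N"
    using f(2) g(2) eq by (force simp: attains_max_def intro: antisym)
  ultimately show ?thesis by blast
qed

text \<open>If only constants lack coboundary, then overlap functions are unique and the construction is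
  deterministic.\<close>

lemma descent_unique:
  assumes conn: "\<And>k x y. k \<in> kernel \<Longrightarrow> x \<in> V \<Longrightarrow> y \<in> V \<Longrightarrow> k x = k y"
    and d: "descent m n \<gamma>s" "descent m n \<delta>s"
  shows "\<gamma>s = \<delta>s"
proof -
  have prefix: "length \<gamma>s \<le> length \<delta>s \<and> (\<forall>i<length \<gamma>s. \<gamma>s ! i = \<delta>s ! i)"
    if d: "descent m n \<gamma>s" "descent m n \<delta>s" for \<gamma>s \<delta>s
  proof -
    have "i < length \<delta>s \<and> \<gamma>s ! i = \<delta>s ! i" if "i < length \<gamma>s" for i
      using that
    proof (induction i)
      case 0 then show ?case using d by (simp add: descent_def)
    next
      case (Suc i)
      then have i: "i < length \<gamma>s" "i < length \<delta>s" and eq: "\<gamma>s ! i = \<delta>s ! i" by auto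
      obtain f M where f: "tight (\<lambda>e. n e - (\<gamma>s ! i) e) f M" "M \<noteq> 1"
          "\<gamma>s ! Suc i = (\<lambda>e. (\<gamma>s ! i) e + cobd (\<lambda>x. of_bool (f x = M)) e)"
        using d(1)[unfolded descent_def, THEN conjunct2, THEN conjunct2, rule_format, OF i(1)]
          Suc.prems by auto
      obtain g N where g: "tight (\<lambda>e. n e - (\<delta>s ! i) e) g N"
          "if Suc i = length \<delta>s then N = 1 else N \<noteq> 1 \<and>
             \<delta>s ! Suc i = (\<lambda>e. (\<delta>s ! i) e + cobd (\<lambda>x. of_bool (g x = N)) e)"
        using d(2)[unfolded descent_def, THEN conjunct2, THEN conjunct2, rule_format, OF i(2)]
        by blast
      have *: "M = N" "\<And>x. x \<in> V \<Longrightarrow> f x = g x"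
        using tight_unique[OF conn f(1) g(1)[folded eq]] by blast+
      have "cobd (\<lambda>x. of_bool (f x = M)) = cobd (\<lambda>x. of_bool (g x = N))"
        using * by (auto simp: cobd_def)
      then show ?case using f g(2) * eq i by (auto split: if_splits)
    qed
    note * = this
    have "length \<gamma>s \<le> length \<delta>s"
      by (rule leI, rule notI) (use *[of "length \<delta>s"] in simp)
    then show ?thesis using * by blast
  qed
  show ?thesis using prefix[OF d] prefix[OF d(2,1)] by (auto intro: nth_equalityI)
qed

end

section \<open>Calculus in the plane\<close>

text \<open>\<open>Im (cnj a * b)\<close> is the determinant of the vectors \<open>a\<close> and \<open>b\<close> of the plane; a real-linear map multiplies
  it by its own determinant.\<close>

lemma det_linear:
  assumes "linear D"
  shows "Im (cnj (D a) * D b) = Im (cnj (D 1) * D \<i>) * Im (cnj a * b)"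
proof -
  have D: "D z = Re z *\<^sub>R D 1 + Im z *\<^sub>R D \<i>" for z
  proof -
    have "z = Re z *\<^sub>R 1 + Im z *\<^sub>R \<i>" by (simp add: complex_eq_iff)
    then have "D z = D (Re z *\<^sub>R 1 + Im z *\<^sub>R \<i>)" by simp
    then show ?thesis by (simp only: linear_add[OF assms] linear_scale[OF assms])
  qed
  show ?thesis
    unfolding D[of a] D[of b] by (simp add: algebra_simps)
qed

lemma smooth_on_imp_C1:
  fixes g :: "real \<Rightarrow> 'b::real_normed_vector"
  assumes "smooth_on g S"
  obtains g' where "\<And>s. s \<in> S \<Longrightarrow> (g has_vector_derivative g' s) (at s)" "continuous_on S g'"
proof -
  have "Ck_on (Suc 0) g S" using assms by (simp add: smooth_on_def)
  then obtain f' where f': "\<And>x. x \<in> S \<Longrightarrow> (g has_derivative f' x) (at x)"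
    and c: "\<And>v. continuous_on S (\<lambda>x. f' x v)" by auto
  have "(g has_vector_derivative f' s 1) (at s)" if "s \<in> S" for s
  proof -
    have "f' s x = x *\<^sub>R f' s 1" for x
      using linear_scale[OF has_derivative_linear[OF f'[OF that]], of x 1] by simp
    then have "f' s = (\<lambda>x. x *\<^sub>R f' s 1)" by blast
    then show ?thesis using f'[OF that] unfolding has_vector_derivative_def by simp
  qed
  then show thesis using that[of "\<lambda>s. f' s 1"] c[of 1] by blast
qed

text \<open>A regular arc \<open>g\<close> in the plane is straightened near \<open>g t\<close> by the inverse \<open>\<Psi>\<close> of
  \<open>\<Phi> z = g (Re z) + Im z * (\<i> * g' t)\<close>: the arc becomes the real axis, and at points of the arc the
  derivative of \<open>\<Psi>\<close> sends vectors pointing to the left of the arc into the upper half plane. That \<open>\<Phi>\<close> is an open map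
  comes from invariance of domain.\<close>

lemma straighten:
  fixes g g' :: "real \<Rightarrow> complex"
  assumes "0 < \<epsilon>" and g: "\<And>s. \<bar>s - t\<bar> < \<epsilon> \<Longrightarrow> (g has_vector_derivative g' s) (at s)"
    and g': "continuous_on {s. \<bar>s - t\<bar> < \<epsilon>} g'" and nz: "g' t \<noteq> 0"
  obtains \<delta> \<Phi> \<Psi> where "0 < \<delta>" "\<delta> \<le> \<epsilon>"
    and "\<And>s. \<Phi> (complex_of_real s) = g s"
    and "continuous_on {z. \<bar>Re z - t\<bar> < \<delta>} \<Phi>"
    and "\<And>z. \<bar>Re z - t\<bar> < \<delta> \<Longrightarrow> \<Psi> (\<Phi> z) = z"
    and "\<And>T. open T \<Longrightarrow> T \<subseteq> {z. \<bar>Re z - t\<bar> < \<delta>} \<Longrightarrow> open (\<Phi> ` T)"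
    and "\<And>s. \<bar>s - t\<bar> < \<delta> \<Longrightarrow>
      \<exists>\<Psi>' c. (\<Psi> has_derivative \<Psi>') (at (g s)) \<and> 0 < c \<and> (\<forall>w. Im (\<Psi>' w) = c * Im (cnj (g' s) * w))"
proof -
  define v where "v = g' t"
  have "continuous (at t) g'"
    using g' \<open>0 < \<epsilon>\<close>
    by (subst (asm) continuous_on_eq_continuous_at) (auto intro!: open_Collect_less continuous_intros)
  then have "isCont (\<lambda>s. Re (cnj (g' s) * v)) t"
    unfolding isCont_def by (intro tendsto_intros)
  moreover have "0 < Re (cnj (g' t) * v)" using nz unfolding v_def
    by (simp add: complex_neq_0 flip: power2_eq_square)
  ultimately have "\<forall>\<^sub>F s in at t. 0 < Re (cnj (g' s) * v)"
    unfolding isCont_def by (rule order_tendstoD)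
  then obtain \<delta>0 where \<delta>0: "0 < \<delta>0" "\<And>s. s \<noteq> t \<Longrightarrow> dist s t < \<delta>0 \<Longrightarrow> 0 < Re (cnj (g' s) * v)"
    unfolding eventually_at by auto
  define \<delta> where "\<delta> = min \<delta>0 \<epsilon>"
  have \<delta>: "0 < \<delta>" "\<delta> \<le> \<epsilon>" using \<delta>0 assms(1) by (auto simp: \<delta>_def)
  have pos: "0 < Re (cnj (g' s) * v)" if "\<bar>s - t\<bar> < \<delta>" for s
    using \<delta>0(2)[of s] that \<open>0 < Re (cnj (g' t) * v)\<close> by (cases "s = t") (auto simp: \<delta>_def dist_real_def)
  have gd: "(g has_vector_derivative g' s) (at s)" if "\<bar>s - t\<bar> < \<delta>" for s
    using g that \<delta> by auto
  define S where "S = {z. \<bar>Re z - t\<bar> < \<delta>}"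
  have oS: "open S" unfolding S_def by (intro open_Collect_less continuous_intros)
  define \<Phi> where "\<Phi> z = g (Re z) + Im z *\<^sub>R (\<i> * v)" for z
  define \<Psi> where "\<Psi> = inv_into S \<Phi>"
  have cg: "continuous_on {s. \<bar>s - t\<bar> < \<delta>} g"
    by (intro differentiable_imp_continuous_on) (auto simp: differentiable_on_def intro: gd vector_derivative_works[THEN iffD2] differentiableI_vector differentiable_at_withinI)
  have cont: "continuous_on S \<Phi>"
    unfolding \<Phi>_def by (intro continuous_intros continuous_on_compose2[OF cg]) (auto simp: S_def)
  \<comment> \<open>Injectivity: the component of the arc along its initial velocity is strictly increasing.\<close>
  have mono: "Re (cnj v * g a) < Re (cnj v * g b)" if "a < b" "\<bar>a - t\<bar> < \<delta>" "\<bar>b - t\<bar> < \<delta>" for a b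
  proof (rule DERIV_pos_imp_increasing[OF that(1)])
    fix x assume "a \<le> x" "x \<le> b"
    then have x: "\<bar>x - t\<bar> < \<delta>" using that by auto
    have "((\<lambda>x. Re (cnj v * g x)) has_vector_derivative Re (cnj v * g' x)) (at x)"
      by (intro derivative_intros bounded_linear.has_vector_derivative[OF bounded_linear_Re] gd[OF x]
          bounded_linear.has_vector_derivative[OF bounded_linear_mult_right])
    then have "((\<lambda>x. Re (cnj v * g x)) has_real_derivative Re (cnj v * g' x)) (at x)"
      by (simp add: has_real_derivative_iff_has_vector_derivative)
    moreover have "0 < Re (cnj v * g' x)" using pos[OF x] by (simp add: algebra_simps)
    ultimately show "\<exists>y. ((\<lambda>x. Re (cnj v * g x)) has_real_derivative y) (at x) \<and> 0 < y" by blast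
  qed
  have inj: "inj_on \<Phi> S"
  proof (rule inj_onI)
    fix z z' assume z: "z \<in> S" "z' \<in> S" and eq: "\<Phi> z = \<Phi> z'"
    have "Re (cnj v * \<Phi> z) = Re (cnj v * g (Re z))" for z
      by (simp add: \<Phi>_def algebra_simps)
    then have "Re (cnj v * g (Re z)) = Re (cnj v * g (Re z'))" using eq by metis
    then have "Re z = Re z'"
      using mono[of "Re z" "Re z'"] mono[of "Re z'" "Re z"] z unfolding S_def by (cases "Re z" "Re z'" rule: linorder_cases) auto
    moreover have "Im z = Im z'" using eq \<open>Re z = Re z'\<close> nz by (simp add: \<Phi>_def v_def)
    ultimately show "z = z'" by (simp add: complex_eq_iff)
  qed
  have opn: "open (\<Phi> ` T)" if "open T" "T \<subseteq> S" for T
    using invariance_of_domain[of T \<Phi>] that cont inj by (meson continuous_on_subset inj_on_subset)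
  have left: "\<Psi> (\<Phi> z) = z" if "z \<in> S" for z
    using that inj by (simp add: \<Psi>_def inv_into_f_f)
  have right: "\<Phi> (\<Psi> y) = y" if "y \<in> \<Phi> ` S" for y
    using that by (simp add: \<Psi>_def f_inv_into_f)
  have contI: "continuous_on (\<Phi> ` S) \<Psi>"
  proof (rule continuous_on_inverse_open_map[OF cont refl left])
    fix U assume "openin (top_of_set S) U"
    then have "open U" "U \<subseteq> S" using oS by (auto simp: openin_open_eq)
    then show "openin (top_of_set (\<Phi> ` S)) (\<Phi> ` U)"
      using opn[of U] opn[OF oS] by (auto simp: openin_open_eq)
  qed
  have der: "\<exists>\<Psi>' c. (\<Psi> has_derivative \<Psi>') (at (g s)) \<and> 0 < c \<and> (\<forall>w. Im (\<Psi>' w) = c * Im (cnj (g' s) * w))"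
    if s: "\<bar>s - t\<bar> < \<delta>" for s
  proof -
    define q where "q = Re (cnj (g' s) * v)"
    have q: "0 < q" using pos[OF s] by (simp add: q_def)
    have sS: "complex_of_real s \<in> S" using s by (simp add: S_def)
    define \<Phi>' where "\<Phi>' z = Re z *\<^sub>R g' s + Im z *\<^sub>R (\<i> * v)" for z
    define \<Psi>' where "\<Psi>' w = (Re (cnj v * w) / q) *\<^sub>R 1 + (Im (cnj (g' s) * w) / q) *\<^sub>R \<i>" for w
    have "((\<lambda>z. g (Re z)) has_derivative (\<lambda>z. Re z *\<^sub>R g' s)) (at (complex_of_real s))"
      using has_derivative_compose[OF bounded_linear_imp_has_derivative[OF bounded_linear_Re], of g "\<lambda>x. x *\<^sub>R g' s" "complex_of_real s" UNIV]
        gd[OF s] by (simp add: has_vector_derivative_def)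
    moreover have "((\<lambda>z. Im z *\<^sub>R (\<i> * v)) has_derivative (\<lambda>z. Im z *\<^sub>R (\<i> * v))) (at (complex_of_real s))"
      by (intro bounded_linear_imp_has_derivative bounded_linear_intros bounded_linear_Im)
    ultimately have d\<Phi>: "(\<Phi> has_derivative \<Phi>') (at (complex_of_real s))"
      unfolding \<Phi>_def \<Phi>'_def by (intro has_derivative_add)
    have bl: "bounded_linear \<Psi>'"
      unfolding \<Psi>'_def linear_conv_bounded_linear[symmetric]
      by (rule linearI) (simp_all add: complex_eq_iff algebra_simps add_divide_distrib diff_divide_distrib)
    have "\<Psi>' (\<Phi>' z) = z" for z
    proof -
      have "Re (cnj v * \<Phi>' z) = Re z * q" "Im (cnj (g' s) * \<Phi>' z) = Im z * q"
        by (simp_all add: \<Phi>'_def q_def algebra_simps)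
      then show ?thesis using q by (simp add: \<Psi>'_def complex_eq_iff)
    qed
    then have id: "\<Psi>' \<circ> \<Phi>' = id" by auto
    have gs: "\<Phi> (complex_of_real s) = g s" by (simp add: \<Phi>_def)
    have gsin: "g s \<in> \<Phi> ` S" using sS gs by (metis imageI)
    have "continuous (at (\<Phi> (complex_of_real s))) \<Psi>"
      using contI opn[OF oS subset_refl] gsin gs by (metis continuous_on_eq_continuous_at)
    then have "(\<Psi> has_derivative \<Psi>') (at (\<Phi> (complex_of_real s)))"
      using left[OF sS] opn[OF oS subset_refl] gsin gs right
      by (intro has_derivative_inverse_basic_x[where T = "\<Phi> ` S", OF d\<Phi> bl id]) auto
    then have "(\<Psi> has_derivative \<Psi>') (at (g s))" using gs by simp
    moreover have "Im (\<Psi>' w) = (1 / q) * Im (cnj (g' s) * w)" for w by (simp add: \<Psi>'_def)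
    ultimately show ?thesis using q by (metis zero_less_divide_1_iff)
  qed
  show thesis
    by (rule that[of \<delta> \<Phi> \<Psi>]) (use \<delta> cont left opn der in \<open>auto simp: S_def \<Phi>_def\<close>)
qed

section \<open>Charts of an oriented surface\<close>

lemma has_vector_derivative_tendsto:
  "(f has_vector_derivative w) (at t within S) \<Longrightarrow> (f \<longlongrightarrow> f t) (at t within S)"
  using has_vector_derivative_continuous continuous_within by blast

lemma velocity_shift:
  assumes "\<And>x. \<gamma> (s + x) = \<eta> (t + x)"
  shows "velocity \<phi> \<gamma> s = velocity \<phi> \<eta> t"
proof -
  have *: "((\<phi> \<circ> \<eta>) has_vector_derivative w) (at t) \<Longrightarrow> ((\<phi> \<circ> \<gamma>) has_vector_derivative w) (at s)"
    if "\<And>x. \<gamma> (s + x) = \<eta> (t + x)" for s t w and \<gamma> \<eta> :: "real \<Rightarrow> 'a"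
  proof -
    assume d: "((\<phi> \<circ> \<eta>) has_vector_derivative w) (at t)"
    have "((\<lambda>x. x + (t - s)) has_vector_derivative 1) (at s)"
      by (auto intro!: derivative_eq_intros)
    then have "((\<phi> \<circ> \<eta>) \<circ> (\<lambda>x. x + (t - s)) has_vector_derivative 1 *\<^sub>R w) (at s)"
      by (rule vector_diff_chain_at) (use d in simp)
    moreover have "(\<phi> \<circ> \<eta>) \<circ> (\<lambda>x. x + (t - s)) = \<phi> \<circ> \<gamma>"
    proof
      fix x show "((\<phi> \<circ> \<eta>) \<circ> (\<lambda>x. x + (t - s))) x = (\<phi> \<circ> \<gamma>) x"
        using that[of "x - s"] by (simp add: algebra_simps)
    qed
    ultimately show ?thesis by simp
  qed
  have "((\<phi> \<circ> \<gamma>) has_vector_derivative w) (at s) \<longleftrightarrow> ((\<phi> \<circ> \<eta>) has_vector_derivative w) (at t)" for w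
    using *[of \<gamma> s \<eta> t] *[of \<eta> t \<gamma> s] assms by metis
  then show ?thesis unfolding vector_derivative_def by simp
qed

lemma cis_eq_iff: "cis s = cis t \<longleftrightarrow> (\<exists>k::int. s = t + 2 * pi * k)"
  using sin_cos_eq_iff[of s t] by (auto simp: complex_eq_iff)

lemma circle_split:
  assumes "0 < \<delta>"
  shows "circle = cis ` {t - \<delta><..<t + \<delta>} \<union> cis ` {t + \<delta>..t + 2 * pi - \<delta>}"
proof
  show "circle \<subseteq> cis ` {t - \<delta><..<t + \<delta>} \<union> cis ` {t + \<delta>..t + 2 * pi - \<delta>}"
  proof
    fix z :: complex assume "z \<in> circle"
    then have z: "z = cis (Arg z)" using rcis_cmod_Arg[of z] by (simp add: rcis_def)
    define k where "k = \<lfloor>(Arg z - (t - \<delta>)) / (2 * pi)\<rfloor>"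
    define s where "s = Arg z - 2 * pi * k"
    have zs: "z = cis s" using z cis_eq_iff[of s "Arg z"] unfolding s_def
      by (metis add_uminus_conv_diff mult_minus_right of_int_minus)
    have "k \<le> (Arg z - (t - \<delta>)) / (2 * pi)" "(Arg z - (t - \<delta>)) / (2 * pi) < k + 1"
      unfolding k_def by linarith+
    then have "t - \<delta> \<le> s" "s < t - \<delta> + 2 * pi"
      unfolding s_def by (simp_all add: field_simps)
    show "z \<in> cis ` {t - \<delta><..<t + \<delta>} \<union> cis ` {t + \<delta>..t + 2 * pi - \<delta>}"
    proof (cases "s = t - \<delta>")
      case True
      have "cis (t + 2 * pi - \<delta>) = z"
        unfolding zs True cis_eq_iff by (intro exI[of _ 1]) simp
      show ?thesis
      proof (cases "\<delta> \<le> pi")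
        case True
        then have "t + 2 * pi - \<delta> \<in> {t + \<delta>..t + 2 * pi - \<delta>}" by simp
        then show ?thesis using \<open>cis _ = z\<close> by blast
      next
        case False
        then have "t + 2 * pi - \<delta> \<in> {t - \<delta><..<t + \<delta>}" by simp
        then show ?thesis using \<open>cis _ = z\<close> by blast
      qed
    next
      case False
      then have "s \<in> {t - \<delta><..<t + \<delta>} \<or> s \<in> {t + \<delta>..t + 2 * pi - \<delta>}"
        using \<open>t - \<delta> \<le> s\<close> \<open>s < t - \<delta> + 2 * pi\<close> by auto
      then show ?thesis using zs by blast
    qed
  qed
qed auto

lemma cis_far:
  assumes "0 < \<delta>" shows "cis t \<notin> cis ` {t + \<delta>..t + 2 * pi - \<delta>}"
proof
  assume "cis t \<in> cis ` {t + \<delta>..t + 2 * pi - \<delta>}"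
  then obtain s where s: "t + \<delta> \<le> s" "s \<le> t + 2 * pi - \<delta>" "cis s = cis t" by auto
  then obtain k :: int where "s = t + 2 * pi * k" by (auto simp: cis_eq_iff)
  then have "0 < 2 * pi * k" "2 * pi * k < 2 * pi" using s assms by linarith+
  then have "0 < k" by (simp add: zero_less_mult_iff)
  moreover have "real_of_int k < 1"
    using \<open>2 * pi * k < 2 * pi\<close> mult_less_cancel_left_pos[of "2 * pi" "real_of_int k" 1] by simp
  ultimately show False by linarith
qed

text \<open>The path \<open>\<xi>\<close>, considered for times \<open>u \<ge> 0\<close> only, starts in the domain of the chart \<open>C\<close> with velocity \<open>w\<close>
  there.\<close>

definition initial_velocity :: "'a chart \<Rightarrow> (real \<Rightarrow> 'a) \<Rightarrow> complex \<Rightarrow> bool" where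
  "initial_velocity C \<xi> w \<longleftrightarrow> \<xi> 0 \<in> fst C \<and> (\<forall>\<^sub>F u in at_right 0. \<xi> u \<in> fst C) \<and>
     ((\<lambda>u. snd C (\<xi> u)) has_vector_derivative w) (at 0 within {0..})"

locale oriented_surface =
  fixes X :: "'a topology" and A :: "'a chart set"
  assumes surface: "closed_oriented_surface X A"
begin

lemma Hausdorff: "Hausdorff_space X"
  using surface by (simp add: closed_oriented_surface_def)

lemma atlas: "smooth_oriented_atlas X A"
  using surface by (simp add: closed_oriented_surface_def)

lemma chart_at:
  assumes "p \<in> topspace X" obtains U \<phi> where "(U, \<phi>) \<in> A" "p \<in> U"
  using assms atlas unfolding smooth_oriented_atlas_def by fastforce

lemma chart:
  assumes "(U, \<phi>) \<in> A"
  shows chart_openin: "openin X U" and chart_open: "open (\<phi> ` U)"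
    and chart_homeo: "homeomorphic_map (subtopology X U) (top_of_set (\<phi> ` U)) \<phi>"
    and chart_sub: "U \<subseteq> topspace X" and chart_inj: "inj_on \<phi> U"
proof -
  have *: "openin X U \<and> open (\<phi> ` U) \<and> homeomorphic_map (subtopology X U) (top_of_set (\<phi> ` U)) \<phi>"
    using atlas assms unfolding smooth_oriented_atlas_def by blast
  then show "openin X U" "open (\<phi> ` U)"
    "homeomorphic_map (subtopology X U) (top_of_set (\<phi> ` U)) \<phi>" by auto
  show U: "U \<subseteq> topspace X" using * openin_subset by blast
  show "inj_on \<phi> U" using *[THEN conjunct2, THEN conjunct2, THEN homeomorphic_imp_injective_map] U
    by (simp add: inf_absorb2)
qed

lemma chart_image_open:
  assumes "(U, \<phi>) \<in> A" "openin X W" shows "open (\<phi> ` (U \<inter> W))"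
proof -
  have "openin (subtopology X U) (U \<inter> W)"
    using assms(2) by (auto simp: openin_subtopology)
  then have "openin (top_of_set (\<phi> ` U)) (\<phi> ` (U \<inter> W))"
    using homeomorphic_imp_open_map[OF chart_homeo[OF assms(1)]] by (simp add: open_map_def)
  then show ?thesis using chart_open[OF assms(1)] openin_open_trans by blast
qed

lemma chart_vimage_open:
  assumes "(U, \<phi>) \<in> A" "open S" shows "openin X {x \<in> U. \<phi> x \<in> S}"
proof -
  have "continuous_map (subtopology X U) euclidean \<phi>"
    using homeomorphic_imp_continuous_map[OF chart_homeo[OF assms(1)]] continuous_map_in_subtopology by blast
  then have "openin (subtopology X U) {x \<in> topspace (subtopology X U). \<phi> x \<in> S}"
    using assms(2) by (intro openin_continuous_map_preimage) auto
  moreover have "topspace (subtopology X U) = U" using chart_sub[OF assms(1)] by auto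
  ultimately show ?thesis using chart_openin[OF assms(1)] openin_trans_full by fastforce
qed

lemma chart_inverse:
  assumes "(U, \<phi>) \<in> A"
  shows "x \<in> U \<Longrightarrow> inv_into U \<phi> (\<phi> x) = x"
    and "z \<in> \<phi> ` U \<Longrightarrow> \<phi> (inv_into U \<phi> z) = z" and "z \<in> \<phi> ` U \<Longrightarrow> inv_into U \<phi> z \<in> U"
  using chart_inj[OF assms] by (auto simp: f_inv_into_f inv_into_into)

lemma chart_inverse_continuous:
  assumes "(U, \<phi>) \<in> A"
  shows "continuous_map (top_of_set (\<phi> ` U)) X (inv_into U \<phi>)"
  unfolding continuous_map_def
proof (intro conjI allI impI)
  show "inv_into U \<phi> \<in> topspace (top_of_set (\<phi> ` U)) \<rightarrow> topspace X"
    using chart_inverse(3)[OF assms] chart_sub[OF assms] by auto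
  fix G assume "openin X G"
  then have "open (\<phi> ` (U \<inter> G))" by (rule chart_image_open[OF assms])
  moreover have "{z \<in> topspace (top_of_set (\<phi> ` U)). inv_into U \<phi> z \<in> G} = \<phi> ` (U \<inter> G)"
    using chart_inverse[OF assms] by (auto intro!: image_eqI[OF sym])
  ultimately show "openin (top_of_set (\<phi> ` U)) {z \<in> topspace (top_of_set (\<phi> ` U)). inv_into U \<phi> z \<in> G}"
    using chart_open[OF assms] by (auto simp: openin_open_eq)
qed

lemma chart_limit:
  assumes C: "(U, \<phi>) \<in> A" and p: "p \<in> U" and ev: "\<forall>\<^sub>F u in F. \<xi> u \<in> U"
    and lim: "((\<lambda>u. \<phi> (\<xi> u)) \<longlongrightarrow> \<phi> p) F"
  shows "limitin X \<xi> p F"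
  unfolding limitin_def
proof (intro conjI allI impI)
  show "p \<in> topspace X" using chart_sub[OF C] p by blast
  fix W assume W: "openin X W \<and> p \<in> W"
  have "\<forall>\<^sub>F u in F. \<phi> (\<xi> u) \<in> \<phi> ` (U \<inter> W)"
    using lim chart_image_open[OF C] W p by (intro topological_tendstoD) auto
  then show "\<forall>\<^sub>F u in F. \<xi> u \<in> W"
    using ev
  proof eventually_elim
    case (elim u)
    then obtain y where "y \<in> U \<inter> W" "\<phi> (\<xi> u) = \<phi> y" by auto
    then show ?case using chart_inj[OF C] elim(2) by (metis IntE inj_onD)
  qed
qed

lemma limit_chart:
  assumes C: "(U, \<phi>) \<in> A" and p: "p \<in> U" and lim: "limitin X \<xi> p F"
  shows "\<forall>\<^sub>F u in F. \<xi> u \<in> U" "((\<lambda>u. \<phi> (\<xi> u)) \<longlongrightarrow> \<phi> p) F"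
proof -
  show "\<forall>\<^sub>F u in F. \<xi> u \<in> U" using lim chart_openin[OF C] p by (auto simp: limitin_def)
  show "((\<lambda>u. \<phi> (\<xi> u)) \<longlongrightarrow> \<phi> p) F"
  proof (rule topological_tendstoI)
    fix S assume "open S" "\<phi> p \<in> S"
    then have "\<forall>\<^sub>F u in F. \<xi> u \<in> {x \<in> U. \<phi> x \<in> S}"
      using lim chart_vimage_open[OF C] p unfolding limitin_def by blast
    then show "\<forall>\<^sub>F u in F. \<phi> (\<xi> u) \<in> S" by (rule eventually_mono) auto
  qed
qed

text \<open>A change of charts acts on velocities, including one-sided ones, by a linear map of positive
  determinant.\<close>

lemma transition:
  assumes C: "(U, \<phi>) \<in> A" "(U', \<psi>) \<in> A" and p: "p \<in> U" "p \<in> U'"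
  obtains D where "linear D" "0 < Im (cnj (D 1) * D \<i>)"
    and "\<And>\<xi> w t S. \<xi> t = p \<Longrightarrow> t \<in> S \<Longrightarrow> \<forall>\<^sub>F u in at t within S. \<xi> u \<in> U \<Longrightarrow>
      ((\<lambda>u. \<phi> (\<xi> u)) has_vector_derivative w) (at t within S) \<Longrightarrow>
      ((\<lambda>u. \<psi> (\<xi> u)) has_vector_derivative D w) (at t within S)"
proof -
  define T where "T = (\<lambda>z. \<psi> (inv_into U \<phi> z))"
  have "smooth_on T (\<phi> ` (U \<inter> U'))" and
    det: "\<And>z D. z \<in> \<phi> ` (U \<inter> U') \<Longrightarrow> (T has_derivative D) (at z) \<Longrightarrow> 0 < Im (cnj (D 1) * D \<i>)"
    using atlas[unfolded smooth_oriented_atlas_def, THEN conjunct2, THEN conjunct2, THEN bspec, OF C(1),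
        unfolded prod.case, THEN bspec, OF C(2), unfolded prod.case] unfolding T_def by blast+
  then have "Ck_on (Suc 0) T (\<phi> ` (U \<inter> U'))" by (simp add: smooth_on_def)
  moreover have "\<phi> p \<in> \<phi> ` (U \<inter> U')" using p by blast
  ultimately obtain D where D: "(T has_derivative D) (at (\<phi> p))"
    unfolding Ck_on.simps by blast
  show thesis
  proof
    show lin: "linear D" using D by (rule has_derivative_linear)
    show "0 < Im (cnj (D 1) * D \<i>)" using det[OF \<open>\<phi> p \<in> _\<close> D] .
    fix \<xi> w and t :: real and S
    assume \<xi>: "\<xi> t = p" "t \<in> S" "\<forall>\<^sub>F u in at t within S. \<xi> u \<in> U"
      "((\<lambda>u. \<phi> (\<xi> u)) has_vector_derivative w) (at t within S)"
    have "((\<lambda>u. \<phi> (\<xi> u)) has_derivative (\<lambda>x. x *\<^sub>R w)) (at t within S)"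
      using \<xi>(4) by (simp add: has_vector_derivative_def)
    then have "((\<lambda>u. T (\<phi> (\<xi> u))) has_derivative (\<lambda>x. D (x *\<^sub>R w))) (at t within S)"
      by (rule has_derivative_compose) (use D \<xi> in simp)
    then have "((\<lambda>u. \<psi> (\<xi> u)) has_derivative (\<lambda>x. D (x *\<^sub>R w))) (at t within S)"
    proof (rule has_derivative_transform_eventually)
      show "\<forall>\<^sub>F u in at t within S. T (\<phi> (\<xi> u)) = \<psi> (\<xi> u)"
        using \<xi>(3) by (rule eventually_mono) (simp add: T_def chart_inverse[OF C(1)])
    qed (use \<xi> p in \<open>simp_all add: T_def chart_inverse[OF C(1)]\<close>)
    then show "((\<lambda>u. \<psi> (\<xi> u)) has_vector_derivative D w) (at t within S)"
      by (simp add: has_vector_derivative_def linear_scale[OF lin])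
  qed
qed

lemma regular_chart:
  assumes "regular_at A \<gamma> t"
  obtains U \<phi> \<epsilon> g g' where "(U, \<phi>) \<in> A" "0 < \<epsilon>"
    and "\<And>s. \<bar>s - t\<bar> < \<epsilon> \<Longrightarrow> \<gamma> s \<in> U \<and> \<phi> (\<gamma> s) = g s"
    and "\<And>s. \<bar>s - t\<bar> < \<epsilon> \<Longrightarrow> (g has_vector_derivative g' s) (at s) \<and> g' s \<noteq> 0"
    and "continuous_on {s. \<bar>s - t\<bar> < \<epsilon>} g'"
proof -
  obtain \<epsilon>0 where e0: "0 < \<epsilon>0" "smooth_arc A \<gamma> (t - \<epsilon>0) (t + \<epsilon>0)"
    using assms by (auto simp: regular_at_def)
  then have "t \<in> {t - \<epsilon>0..t + \<epsilon>0}" by simp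
  then obtain U \<phi> \<epsilon>1 g where C: "(U, \<phi>) \<in> A" and e1: "0 < \<epsilon>1"
    and sm: "smooth_on g {t-\<epsilon>1<..<t+\<epsilon>1}"
    and nz: "\<forall>s\<in>{t-\<epsilon>1<..<t+\<epsilon>1}. vector_derivative g (at s) \<noteq> 0"
    and eq: "\<forall>s\<in>{t - \<epsilon>0..t + \<epsilon>0} \<inter> {t-\<epsilon>1<..<t+\<epsilon>1}. \<gamma> s \<in> U \<and> \<phi> (\<gamma> s) = g s"
    using e0(2) unfolding smooth_arc_def by fast
  obtain g' where g': "\<And>s. s \<in> {t-\<epsilon>1<..<t+\<epsilon>1} \<Longrightarrow> (g has_vector_derivative g' s) (at s)"
    "continuous_on {t-\<epsilon>1<..<t+\<epsilon>1} g'" using smooth_on_imp_C1[OF sm] by blast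
  have sub: "s \<in> {t - \<epsilon>0..t + \<epsilon>0} \<inter> {t-\<epsilon>1<..<t+\<epsilon>1}" if "\<bar>s - t\<bar> < min \<epsilon>0 \<epsilon>1" for s
    using that by auto
  show thesis
  proof (rule that[OF C, of "min \<epsilon>0 \<epsilon>1" g g'])
    show "0 < min \<epsilon>0 \<epsilon>1" using e0 e1 by simp
    show "\<gamma> s \<in> U \<and> \<phi> (\<gamma> s) = g s" if "\<bar>s - t\<bar> < min \<epsilon>0 \<epsilon>1" for s
      using eq sub[OF that] by blast
    show "(g has_vector_derivative g' s) (at s) \<and> g' s \<noteq> 0" if "\<bar>s - t\<bar> < min \<epsilon>0 \<epsilon>1" for s
      using g'(1) nz sub[OF that] vector_derivative_at by (metis IntE)
    show "continuous_on {s. \<bar>s - t\<bar> < min \<epsilon>0 \<epsilon>1} g'"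
      by (rule continuous_on_subset[OF g'(2)]) auto
  qed
qed

lemma velocity_in_chart:
  assumes reg: "\<And>s. \<bar>s - t\<bar> < \<epsilon> \<Longrightarrow> \<gamma> s \<in> U \<and> \<phi> (\<gamma> s) = g s" and e: "0 < \<epsilon>"
    and g: "(g has_vector_derivative w) (at t)"
  shows "((\<lambda>s. \<phi> (\<gamma> s)) has_vector_derivative w) (at t)" "\<forall>\<^sub>F s in at t. \<gamma> s \<in> U"
proof -
  have "open {s. \<bar>s - t\<bar> < \<epsilon>}" by (intro open_Collect_less continuous_intros)
  then show "((\<lambda>s. \<phi> (\<gamma> s)) has_vector_derivative w) (at t)"
    using reg e by (intro has_vector_derivative_transform_within_open[OF g]) auto
  show "\<forall>\<^sub>F s in at t. \<gamma> s \<in> U"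
    unfolding eventually_at using e reg by (intro exI[of _ \<epsilon>]) (auto simp: dist_real_def)
qed

lemma regular_velocity:
  assumes "regular_at A \<gamma> t" "(U, \<phi>) \<in> A" "\<gamma> t \<in> U"
  shows "((\<lambda>s. \<phi> (\<gamma> s)) has_vector_derivative velocity \<phi> \<gamma> t) (at t)"
    and "velocity \<phi> \<gamma> t \<noteq> 0" and "limitin X \<gamma> (\<gamma> t) (at t)"
proof -
  obtain U' \<psi> \<epsilon> g g' where C: "(U', \<psi>) \<in> A" and e: "0 < \<epsilon>"
    and reg: "\<And>s. \<bar>s - t\<bar> < \<epsilon> \<Longrightarrow> \<gamma> s \<in> U' \<and> \<psi> (\<gamma> s) = g s"
    and g: "\<And>s. \<bar>s - t\<bar> < \<epsilon> \<Longrightarrow> (g has_vector_derivative g' s) (at s) \<and> g' s \<noteq> 0"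
    using regular_chart[OF assms(1)] by metis
  have gt: "(g has_vector_derivative g' t) (at t)" "g' t \<noteq> 0" "\<gamma> t \<in> U'" using g[of t] reg[of t] e by auto
  note v = velocity_in_chart[of t \<epsilon> \<gamma> U' \<psi>, OF reg e gt(1)]
  obtain D where D: "linear D" "0 < Im (cnj (D 1) * D \<i>)"
    and tr: "\<And>\<xi> w s S. \<xi> s = \<gamma> t \<Longrightarrow> s \<in> S \<Longrightarrow> \<forall>\<^sub>F u in at s within S. \<xi> u \<in> U' \<Longrightarrow>
      ((\<lambda>u. \<psi> (\<xi> u)) has_vector_derivative w) (at s within S) \<Longrightarrow>
      ((\<lambda>u. \<phi> (\<xi> u)) has_vector_derivative D w) (at s within S)"
    using transition[OF C assms(2) gt(3) assms(3)] by metis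
  have d: "((\<lambda>s. \<phi> (\<gamma> s)) has_vector_derivative D (g' t)) (at t)"
    using tr[of \<gamma> t UNIV "g' t"] v by simp
  then have vel: "velocity \<phi> \<gamma> t = D (g' t)" by (simp add: vector_derivative_at comp_def)
  then show "((\<lambda>s. \<phi> (\<gamma> s)) has_vector_derivative velocity \<phi> \<gamma> t) (at t)" using d by simp
  have "Im (cnj (D (g' t)) * D (\<i> * g' t)) = Im (cnj (D 1) * D \<i>) * Im (cnj (g' t) * (\<i> * g' t))"
    by (rule det_linear[OF D(1)])
  moreover have "Im (cnj (g' t) * (\<i> * g' t)) = (cmod (g' t))\<^sup>2"
    unfolding cmod_power2 by (simp add: power2_eq_square)
  ultimately have "Im (cnj (D (g' t)) * D (\<i> * g' t)) > 0" using D(2) gt(2) by simp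
  then show "velocity \<phi> \<gamma> t \<noteq> 0" using vel by auto
  show "limitin X \<gamma> (\<gamma> t) (at t)"
    using chart_limit[OF C gt(3) v(2)] has_vector_derivative_tendsto[OF v(1)] by blast
qed

end

section \<open>The two sides of a pair of multicurves\<close>

text \<open>Two systems of disjoint simple loops that meet in finitely many points. Their union \<open>graph\<close> is the
  one-skeleton of the cell complex, with the zero-cells \<open>vertices\<close>; \<open>faces\<close> is the union of all faces, and \<open>edge_at p\<close> the one-cell
  through \<open>p\<close>.\<close>

locale curve_pair = oriented_surface X A
  for X :: "'a topology" and A :: "'a chart set" +
  fixes m n :: "(complex \<Rightarrow> 'a) set"
  assumes loops_m: "loop_system X A m" and loops_n: "loop_system X A n"
    and finite_meet: "finite (locus m \<inter> locus n)"
begin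

abbreviation "graph \<equiv> locus m \<union> locus n"
abbreviation "vertices \<equiv> zero_cells A m n"
abbreviation "faces \<equiv> complement X m n"
abbreviation "edge_at \<equiv> one_cell_at X A m n"

lemma curve_loop: "c \<in> m \<union> n \<Longrightarrow> simple_loop X A c"
  using loops_m loops_n by (auto simp: loop_system_def)

lemma curve_in_graph: "c \<in> m \<union> n \<Longrightarrow> c (cis s) \<in> graph"
  unfolding locus_def using norm_cis by (fastforce simp: image_iff)

lemma graph_cases:
  assumes "x \<in> graph" obtains c s where "c \<in> m \<union> n" "x = c (cis s)"
proof -
  obtain c z where cz: "c \<in> m \<union> n" "z \<in> circle" "x = c z"
    using assms unfolding locus_def by blast
  then have "z = cis (Arg z)" using rcis_cmod_Arg[of z] by (simp add: rcis_def)
  then show thesis using that cz by metis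
qed

lemma curve_regular: "c \<in> m \<union> n \<Longrightarrow> c (cis s) \<notin> vertices \<Longrightarrow> regular_at A (angular c) s"
  unfolding zero_cells_def by blast

lemma curve_unique:
  assumes "c \<in> m \<union> n" "d \<in> m \<union> n" "z \<in> circle" "z' \<in> circle" "c z = d z'" "c z \<notin> vertices"
  shows "c = d \<and> z = z'"
proof -
  have "c z \<notin> locus m \<inter> locus n" using assms(6) by (simp add: zero_cells_def)
  moreover have "c \<in> k \<Longrightarrow> c z \<in> locus k" "d \<in> k \<Longrightarrow> c z \<in> locus k" for k
    unfolding locus_def using assms(3-5) by blast+
  ultimately have "c \<in> m \<and> d \<in> m \<or> c \<in> n \<and> d \<in> n"
    using assms(1,2) by blast
  moreover have "c ` circle \<inter> d ` circle \<noteq> {}" using assms(3-5) by blast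
  ultimately have "c = d"
    using loops_m loops_n unfolding loop_system_def disjoint_family_on_def by blast
  then show ?thesis
    using curve_loop[OF assms(1)] assms by (auto simp: simple_loop_def inj_on_def)
qed

lemma graph_sub: "graph \<subseteq> topspace X"
proof
  fix x assume "x \<in> graph"
  then obtain c z where cz: "c \<in> m \<union> n" "z \<in> circle" "x = c z" unfolding locus_def by blast
  then show "x \<in> topspace X"
    using curve_loop[OF cz(1)] continuous_map_image_subset_topspace[of "top_of_set circle" X c]
    by (auto simp: simple_loop_def)
qed

lemma vertices_graph: "vertices \<subseteq> graph"
  by (auto simp: zero_cells_def locus_def)

lemma finite_vertices: "finite vertices"
proof -
  have "\<exists>B. finite B \<and> (\<forall>s. \<not> regular_at A (angular c) s \<longrightarrow> cis s \<in> B)" if c: "c \<in> m \<union> n" for c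
  proof -
    obtain B where B1: "finite B"
      and B2: "\<forall>a b. a < b \<and> cis ` {a<..<b} \<inter> B = {} \<longrightarrow> smooth_arc A (angular c) a b"
      using curve_loop[OF c] unfolding simple_loop_def by metis
    note B = B1 B2[rule_format, OF conjI]
    have "cis s \<in> B" if "\<not> regular_at A (angular c) s" for s
    proof (rule ccontr)
      assume "cis s \<notin> B"
      then have "open (- B)" "cis s \<in> - B" using B(1) finite_imp_closed by auto
      moreover have "isCont (\<lambda>s. cis s) s" unfolding cis_conv_exp by (intro continuous_intros)
      ultimately have "\<forall>\<^sub>F u in nhds s. cis u \<in> - B"
        by (metis continuous_at_imp_continuous_within eventually_nhds_conv_at isCont_def topological_tendstoD)
      then obtain e where e: "0 < e" "\<And>u. dist u s < e \<Longrightarrow> cis u \<notin> B"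
        unfolding eventually_nhds_metric by auto
      have "cis ` {s - e<..<s + e} \<inter> B = {}" using e(2) by (auto simp: dist_real_def)
      then have "smooth_arc A (angular c) (s - e) (s + e)" using B(2) e(1) by simp
      then show False using that e(1) unfolding regular_at_def by blast
    qed
    then show ?thesis using B(1) by blast
  qed
  then obtain B where B: "\<And>c. c \<in> m \<union> n \<Longrightarrow> finite (B c) \<and> (\<forall>s. \<not> regular_at A (angular c) s \<longrightarrow> cis s \<in> B c)"
    by metis
  have "vertices \<subseteq> (locus m \<inter> locus n) \<union> (\<Union>c\<in>m \<union> n. c ` B c)"
    unfolding zero_cells_def using B by blast
  moreover have "finite (m \<union> n)" using loops_m loops_n by (simp add: loop_system_def)
  ultimately show ?thesis using finite_meet B by (meson finite_UN_I finite_UnI finite_imageI finite_subset)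
qed

lemma closed_vertices: "closedin X vertices"
  using finite_vertices vertices_graph graph_sub Hausdorff
  by (metis Hausdorff_imp_t1_space order_trans t1_space_closedin_finite)

lemma compact_curve:
  assumes "c \<in> m \<union> n" "compact S" "S \<subseteq> circle" shows "closedin X (c ` S)"
proof -
  have "compactin (top_of_set circle) S" using assms by (simp add: compactin_subtopology)
  then have "compactin X (c ` S)"
    using curve_loop[OF assms(1)] image_compactin by (auto simp: simple_loop_def)
  then show ?thesis using Hausdorff compactin_imp_closedin by blast
qed

lemma closed_graph: "closedin X graph"
proof -
  have "finite (m \<union> n)" using loops_m loops_n by (simp add: loop_system_def)
  then have "closedin X (\<Union>c\<in>m \<union> n. c ` circle)"
    by (intro closedin_Union) (auto intro: compact_curve)
  then show ?thesis by (simp add: locus_def UN_Un)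
qed

lemma open_faces: "openin X faces"
  unfolding complement_def using closed_graph by blast

lemma faces_sub: "faces \<subseteq> topspace X"
  by (simp add: complement_def)

text \<open>Near \<open>p\<close>, the set \<open>P\<close> is the left side and \<open>Q\<close> the right side of the graph, in the sense that every path
  leaving \<open>p\<close> to the left (right) of the curve through \<open>p\<close>, in any chart, runs in \<open>P\<close> (in \<open>Q\<close>) for a short time.\<close>

definition sides :: "'a \<Rightarrow> 'a set \<Rightarrow> 'a set \<Rightarrow> bool" where
  "sides p P Q \<longleftrightarrow> (\<forall>d s C \<xi> w. d \<in> m \<union> n \<longrightarrow> d (cis s) = p \<longrightarrow> C \<in> A \<longrightarrow> \<xi> 0 = p \<longrightarrow>
     initial_velocity C \<xi> w \<longrightarrow>
     (0 < Im (cnj (velocity (snd C) (angular d) s) * w) \<longrightarrow> (\<forall>\<^sub>F u in at_right 0. \<xi> u \<in> P)) \<and>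
     (Im (cnj (velocity (snd C) (angular d) s) * w) < 0 \<longrightarrow> (\<forall>\<^sub>F u in at_right 0. \<xi> u \<in> Q)))"

text \<open>At a point that is not a vertex, the graph is locally a single arc with a connected part of the faces on each
  side, and these two sets are the sides at all points of the arc.\<close>

lemma local_model:
  assumes c: "c \<in> m \<union> n" and p: "c (cis t) \<notin> vertices"
  obtains N P Q where "openin X N" "c (cis t) \<in> N" "connectedin X P" "connectedin X Q"
    "P \<subseteq> faces" "Q \<subseteq> faces" "N \<subseteq> P \<union> Q \<union> edge_at (c (cis t))"
    "P \<inter> Q = {}"
    "\<And>q. q \<in> N \<Longrightarrow> q \<in> graph \<Longrightarrow> sides q P Q"
proof -
  obtain U \<phi> \<epsilon> g g' where C: "(U, \<phi>) \<in> A" and e: "0 < \<epsilon>"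
    and reg: "\<And>s. \<bar>s - t\<bar> < \<epsilon> \<Longrightarrow> angular c s \<in> U \<and> \<phi> (angular c s) = g s"
    and g: "\<And>s. \<bar>s - t\<bar> < \<epsilon> \<Longrightarrow> (g has_vector_derivative g' s) (at s) \<and> g' s \<noteq> 0"
    and g': "continuous_on {s. \<bar>s - t\<bar> < \<epsilon>} g'"
    using regular_chart[OF curve_regular[OF c p]] by metis
  have "g' t \<noteq> 0" using g e by simp
  obtain \<delta> \<Phi> \<Psi> where \<delta>: "0 < \<delta>" "\<delta> \<le> \<epsilon>"
    and \<Phi>g: "\<And>s. \<Phi> (complex_of_real s) = g s"
    and \<Phi>c: "continuous_on {z. \<bar>Re z - t\<bar> < \<delta>} \<Phi>"
    and \<Psi>\<Phi>: "\<And>z. \<bar>Re z - t\<bar> < \<delta> \<Longrightarrow> \<Psi> (\<Phi> z) = z"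
    and \<Phi>o: "\<And>T. open T \<Longrightarrow> T \<subseteq> {z. \<bar>Re z - t\<bar> < \<delta>} \<Longrightarrow> open (\<Phi> ` T)"
    and \<Psi>d: "\<And>s. \<bar>s - t\<bar> < \<delta> \<Longrightarrow>
      \<exists>\<Psi>' k. (\<Psi> has_derivative \<Psi>') (at (g s)) \<and> 0 < k \<and> (\<forall>w. Im (\<Psi>' w) = k * Im (cnj (g' s) * w))"
    using straighten[OF e conjunct1[OF g] g' \<open>g' t \<noteq> 0\<close>] by blast
  define S where "S = {z. \<bar>Re z - t\<bar> < \<delta>}"
  have oS: "open S" unfolding S_def by (intro open_Collect_less continuous_intros)
  \<comment> \<open>The part of the graph that the neighbourhood has to avoid.\<close>
  define R where "R = (\<Union>d\<in>m \<union> n - {c}. d ` circle) \<union> c ` cis ` {t + \<delta>..t + 2 * pi - \<delta>} \<union> vertices"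
  have "closedin X R"
  proof -
    have "finite (m \<union> n)" using loops_m loops_n by (simp add: loop_system_def)
    then have "closedin X (\<Union>d\<in>m \<union> n - {c}. d ` circle)"
      by (intro closedin_Union) (auto intro!: compact_curve)
    moreover have "compact (cis ` {t + \<delta>..t + 2 * pi - \<delta>})"
      by (intro compact_continuous_image continuous_intros) auto
    then have "closedin X (c ` cis ` {t + \<delta>..t + 2 * pi - \<delta>})"
      by (intro compact_curve[OF c]) auto
    ultimately show ?thesis unfolding R_def using closed_vertices by (intro closedin_Un)
  qed
  then have oR: "openin X (topspace X - R)" by blast
  have pR: "c (cis t) \<notin> R"
  proof
    assume "c (cis t) \<in> R"
    then consider d z where "d \<in> m \<union> n" "d \<noteq> c" "z \<in> circle" "c (cis t) = d z"
      | z where "z \<in> cis ` {t + \<delta>..t + 2 * pi - \<delta>}" "c (cis t) = c z"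
      using p unfolding R_def by blast
    then show False
    proof cases
      case 1
      then show False using curve_unique[OF c 1(1) _ 1(3,4) p] by simp
    next
      case 2
      then have "cis t = z" using curve_unique[OF c c _ _ 2(2) p] by auto
      then show False using cis_far[OF \<delta>(1)] 2(1) by blast
    qed
  qed
  have pU: "c (cis t) \<in> U" "\<phi> (c (cis t)) = g t" using reg[of t] e by auto
  define W where "W = \<phi> ` (U \<inter> (topspace X - R))"
  have "open W" unfolding W_def by (rule chart_image_open[OF C oR])
  have "g t \<in> W" unfolding W_def using pU pR chart_sub[OF C] by force
  have "open (S \<inter> \<Phi> -` W)"
    using \<Phi>c oS \<open>open W\<close> unfolding S_def[symmetric] by (simp add: continuous_on_open_vimage Int_commute)
  moreover have "complex_of_real t \<in> S \<inter> \<Phi> -` W"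
    using \<open>g t \<in> W\<close> \<Phi>g \<delta> by (simp add: S_def)
  ultimately obtain r where r: "0 < r" "ball (complex_of_real t) r \<subseteq> S \<inter> \<Phi> -` W"
    by (meson openE)
  define \<rho> where "\<rho> = r / 2"
  have \<rho>: "0 < \<rho>" "r = 2 * \<rho>" using r by (simp_all add: \<rho>_def)
  define B where "B = {z. \<bar>Re z - t\<bar> < \<rho> \<and> \<bar>Im z\<bar> < \<rho>}"
  have "B = {z. \<bar>Re z - t\<bar> < \<rho>} \<inter> {z. \<bar>Im z\<bar> < \<rho>}" by (auto simp: B_def)
  then have oB: "open B" by (simp add: open_Collect_less continuous_intros open_Int)
  have BS: "B \<subseteq> S \<inter> \<Phi> -` W"
  proof
    fix z assume "z \<in> B"
    then have "dist (complex_of_real t) z < r"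
      using cmod_le[of "z - complex_of_real t"] \<rho> by (simp add: B_def dist_norm norm_minus_commute)
    then show "z \<in> S \<inter> \<Phi> -` W" using r by auto
  qed
  define \<Theta> where "\<Theta> z = inv_into U \<phi> (\<Phi> z)" for z
  have W_U: "W \<subseteq> \<phi> ` U" by (auto simp: W_def)
  have \<Theta>: "\<Theta> z \<in> U" "\<phi> (\<Theta> z) = \<Phi> z" "\<Theta> z \<notin> R" "\<Theta> z \<in> topspace X" if "z \<in> B" for z
  proof -
    have w: "\<Phi> z \<in> W" using BS that by blast
    then show "\<Theta> z \<in> U" "\<phi> (\<Theta> z) = \<Phi> z"
      unfolding \<Theta>_def using chart_inverse[OF C] W_U by blast+
    obtain x where "x \<in> U \<inter> (topspace X - R)" "\<Phi> z = \<phi> x" using w by (auto simp: W_def)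
    then show "\<Theta> z \<notin> R" "\<Theta> z \<in> topspace X" unfolding \<Theta>_def using chart_inverse[OF C] by auto
  qed
  have \<Theta>g: "\<Theta> (complex_of_real s) = c (cis s)" if "\<bar>s - t\<bar> < \<epsilon>" for s
    unfolding \<Theta>_def \<Phi>g using reg[OF that] chart_inverse(1)[OF C] by metis
  have r\<delta>: "\<bar>s - t\<bar> < \<delta>" if "\<bar>s - t\<bar> < \<rho>" for s
  proof -
    have "complex_of_real s \<in> B" using that \<rho> by (simp add: B_def)
    then show ?thesis using BS by (auto simp: S_def)
  qed
  define N where "N = {x \<in> U. \<phi> x \<in> \<Phi> ` B}"
  have oN: "openin X N" unfolding N_def
    by (intro chart_vimage_open[OF C] \<Phi>o oB) (use BS in \<open>auto simp: S_def\<close>)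
  have N_eq: "N = \<Theta> ` B"
  proof
    show "N \<subseteq> \<Theta> ` B" unfolding N_def \<Theta>_def using chart_inverse(1)[OF C] by force
    show "\<Theta> ` B \<subseteq> N" unfolding N_def using \<Theta> by blast
  qed
  have N_\<Theta>: "x = \<Theta> z" if "x \<in> U" "\<phi> x = \<Phi> z" for x z
    unfolding \<Theta>_def using that chart_inverse(1)[OF C] by metis
  have \<Theta>cont: "continuous_map (top_of_set B) X \<Theta>"
  proof -
    have "continuous_map (subtopology euclidean B) (top_of_set (\<phi> ` U)) \<Phi>"
      using \<Phi>c BS W_U by (auto simp: S_def[symmetric] continuous_map_in_subtopology intro: continuous_on_subset)
    moreover note chart_inverse_continuous[OF C]
    ultimately have "continuous_map (top_of_set B) X (inv_into U \<phi> \<circ> \<Phi>)"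
      by (rule continuous_map_compose)
    moreover have "inv_into U \<phi> \<circ> \<Phi> = \<Theta>" by (auto simp: \<Theta>_def)
    ultimately show ?thesis by simp
  qed
  define P where "P = \<Theta> ` (B \<inter> {z. 0 < Im z})"
  define Q where "Q = \<Theta> ` (B \<inter> {z. Im z < 0})"
  have cB: "convex B"
  proof -
    have "B = {z. Re z < t + \<rho>} \<inter> {z. Re z > t - \<rho>} \<inter> {z. Im z < \<rho>} \<inter> {z. Im z > - \<rho>}"
      by (auto simp: B_def abs_less_iff algebra_simps)
    then show ?thesis
      by (simp add: convex_Int convex_halfspace_Re_lt convex_halfspace_Re_gt convex_halfspace_Im_lt
          convex_halfspace_Im_gt)
  qed
  have conn: "connectedin X (\<Theta> ` (B \<inter> T))" if "convex T" for T
    using connectedin_continuous_map_image[OF \<Theta>cont, of "B \<inter> T"] convex_connected[OF convex_Int[OF cB that]]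
    by (simp add: connectedin_subtopology)
  have cP: "connectedin X P" unfolding P_def by (intro conn convex_halfspace_Im_gt)
  have cQ: "connectedin X Q" unfolding Q_def by (intro conn convex_halfspace_Im_lt)
  have cL: "connectedin X (\<Theta> ` (B \<inter> {z. Im z = 0}))" 
    using convex_hyperplane[of \<i> 0] by (intro conn) (simp add: inner_complex_def)
  have on_graph: "\<exists>s. \<bar>s - t\<bar> < \<rho> \<and> z = complex_of_real s \<and> \<Theta> z = c (cis s)"
    if z: "z \<in> B" "\<Theta> z \<in> graph" for z
  proof -
    obtain d z' where d: "d \<in> m \<union> n" "z' \<in> circle" "\<Theta> z = d z'"
      using z(2) unfolding locus_def by blast
    have "d = c" using \<Theta>(3)[OF z(1)] d unfolding R_def by blast
    moreover have "z' \<notin> cis ` {t + \<delta>..t + 2 * pi - \<delta>}"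
      using \<Theta>(3)[OF z(1)] d \<open>d = c\<close> unfolding R_def by blast
    ultimately have "z' \<in> cis ` {t - \<delta><..<t + \<delta>}"
      using d(2) circle_split[OF \<delta>(1), of t] by blast
    then obtain s where "s \<in> {t - \<delta><..<t + \<delta>}" "z' = cis s" by blast
    then have s: "\<bar>s - t\<bar> < \<delta>" "\<Theta> z = c (cis s)" using d(3) \<open>d = c\<close> by auto
    have "\<Phi> z = \<Phi> (complex_of_real s)"
      using \<Theta>(2)[OF z(1)] s reg[of s] \<delta> \<Phi>g by auto
    then have "z = complex_of_real s"
      using \<Psi>\<Phi>[of z] \<Psi>\<Phi>[of "complex_of_real s"] s(1) BS z(1) by (auto simp: S_def)
    then show ?thesis using s z(1) by (auto simp: B_def)
  qed
  have off_graph: "\<Theta> z \<in> faces" if "z \<in> B" "Im z \<noteq> 0" for z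
    using on_graph[OF that(1)] that \<Theta>(4)[OF that(1)] unfolding complement_def by auto
  show thesis
  proof (rule that[OF oN _ cP cQ])
    have tB: "complex_of_real t \<in> B" using \<rho> by (simp add: B_def)
    have \<Theta>t: "\<Theta> (complex_of_real t) = c (cis t)" using \<Theta>g e by simp
    show "c (cis t) \<in> N" unfolding N_eq using tB \<Theta>t by (metis imageI)
    show "P \<subseteq> faces" "Q \<subseteq> faces" unfolding P_def Q_def using off_graph by auto
    show "P \<inter> Q = {}"
    proof (rule ccontr)
      assume "P \<inter> Q \<noteq> {}"
      then obtain z z' where z: "z \<in> B" "0 < Im z" "z' \<in> B" "Im z' < 0" "\<Theta> z = \<Theta> z'"
        unfolding P_def Q_def by blast
      then have "\<Phi> z = \<Phi> z'" using \<Theta>(2) by metis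
      then have "z = z'" using \<Psi>\<Phi>[of z] \<Psi>\<Phi>[of z'] z(1,3) BS by (auto simp: S_def)
      then show False using z by simp
    qed
    have "\<Theta> ` (B \<inter> {z. Im z = 0}) \<subseteq> graph - vertices"
    proof
      fix x assume "x \<in> \<Theta> ` (B \<inter> {z. Im z = 0})"
      then obtain z where z: "z \<in> B" "Im z = 0" "x = \<Theta> z" by blast
      then have "z = complex_of_real (Re z)" "\<bar>Re z - t\<bar> < \<rho>" by (auto simp: complex_eq_iff B_def)
      then have "x = c (cis (Re z))" using \<Theta>g[of "Re z"] r\<delta>[of "Re z"] \<delta> z(3) by simp
      then show "x \<in> graph - vertices"
        using curve_in_graph[OF c] \<Theta>(3)[OF z(1)] z(3) by (auto simp: R_def)
    qed
    then have "connectedin (skeleton X A m n) (\<Theta> ` (B \<inter> {z. Im z = 0}))"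
      unfolding skeleton_def using cL by (simp add: connectedin_subtopology)
    moreover have "c (cis t) \<in> \<Theta> ` (B \<inter> {z. Im z = 0})" using tB \<Theta>t
      by (metis (mono_tags, lifting) IntI Im_complex_of_real image_eqI mem_Collect_eq)
    ultimately have "\<Theta> ` (B \<inter> {z. Im z = 0}) \<subseteq> edge_at (c (cis t))"
      by (rule connected_component_of_maximal)
    moreover have "N \<subseteq> P \<union> Q \<union> \<Theta> ` (B \<inter> {z. Im z = 0})"
    proof
      fix x assume "x \<in> N"
      then obtain z where z: "z \<in> B" "x = \<Theta> z" unfolding N_eq by blast
      consider "0 < Im z" | "Im z < 0" | "Im z = 0" by linarith
      then show "x \<in> P \<union> Q \<union> \<Theta> ` (B \<inter> {z. Im z = 0})"
        unfolding P_def Q_def using z by cases blast+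
    qed
    ultimately show "N \<subseteq> P \<union> Q \<union> edge_at (c (cis t))" by blast
  next
    fix q assume q: "q \<in> N" "q \<in> graph"
    then obtain z where "z \<in> B" "q = \<Theta> z" by (auto simp: N_eq)
    then obtain s0 where s0: "\<bar>s0 - t\<bar> < \<rho>" "q = c (cis s0)" "complex_of_real s0 \<in> B"
      using on_graph q(2) by blast
    have s0\<delta>: "\<bar>s0 - t\<bar> < \<delta>" "\<bar>s0 - t\<bar> < \<epsilon>" using r\<delta>[OF s0(1)] \<delta> by auto
    have q_nv: "q \<notin> vertices" using \<Theta>(3)[OF \<open>z \<in> B\<close>] \<open>q = \<Theta> z\<close> by (auto simp: R_def)
    have qU: "q \<in> U" "\<phi> q = g s0" using reg[OF s0\<delta>(2)] s0(2) by auto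
    have reg0: "\<And>s. \<bar>s - s0\<bar> < \<delta> - \<bar>s0 - t\<bar> \<Longrightarrow> angular c s \<in> U \<and> \<phi> (angular c s) = g s"
      using reg \<delta> by auto
    have vel0: "((\<lambda>s. \<phi> (angular c s)) has_vector_derivative g' s0) (at s0)"
      by (rule velocity_in_chart(1)[of s0 "\<delta> - \<bar>s0 - t\<bar>" "angular c" U \<phi> g])
        (use reg0 s0\<delta> g in auto)
    obtain \<Psi>' k where \<Psi>': "(\<Psi> has_derivative \<Psi>') (at (g s0))" "0 < k"
      and Im\<Psi>': "\<And>w. Im (\<Psi>' w) = k * Im (cnj (g' s0) * w)"
      using \<Psi>d[OF s0\<delta>(1)] by metis
    show "sides q P Q"
      unfolding sides_def
    proof (intro allI impI)
      fix d s C' \<xi> w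
      assume d: "d \<in> m \<union> n" "d (cis s) = q" and C': "C' \<in> A" and \<xi>0: "\<xi> 0 = q"
        and iv: "initial_velocity C' \<xi> w"
      obtain U' \<psi> where C'_eq: "C' = (U', \<psi>)" by (cases C')
      have C'A: "(U', \<psi>) \<in> A" using C' C'_eq by simp
      have qU': "q \<in> U'" and evU': "\<forall>\<^sub>F u in at_right 0. \<xi> u \<in> U'"
        and \<xi>d: "((\<lambda>u. \<psi> (\<xi> u)) has_vector_derivative w) (at 0 within {0..})"
        using iv \<xi>0 by (auto simp: initial_velocity_def C'_eq)
      have dc: "d = c" "cis s = cis s0" using curve_unique[OF d(1) c, of "cis s" "cis s0"] d(2) s0(2) q_nv by auto
      have "angular d (s + x) = angular c (s0 + x)" for x
        using dc by (simp flip: cis_mult)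
      then have vel_eq: "velocity \<psi> (angular d) s = velocity \<psi> (angular c) s0"
        by (rule velocity_shift)
      define v where "v = velocity \<psi> (angular c) s0"
      have reg_s0: "regular_at A (angular c) s0" using curve_regular[OF c] q_nv s0(2) by simp
      have dv: "((\<lambda>s. \<psi> (angular c s)) has_vector_derivative v) (at s0)"
        unfolding v_def using regular_velocity(1)[OF reg_s0 C'A] qU' s0(2) by simp
      obtain D where D: "linear D" "0 < Im (cnj (D 1) * D \<i>)"
        and tr: "\<And>\<xi> w s S. \<xi> s = q \<Longrightarrow> s \<in> S \<Longrightarrow> \<forall>\<^sub>F u in at s within S. \<xi> u \<in> U' \<Longrightarrow>
          ((\<lambda>u. \<psi> (\<xi> u)) has_vector_derivative w) (at s within S) \<Longrightarrow>
          ((\<lambda>u. \<phi> (\<xi> u)) has_vector_derivative D w) (at s within S)"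
        using transition[OF C'A C qU' qU(1)] by metis
      have "\<forall>\<^sub>F u in at s0. angular c u \<in> U'"
        using limit_chart(1)[OF C'A _ regular_velocity(3)[OF reg_s0 C'A]] qU' s0(2) by simp
      then have "((\<lambda>s. \<phi> (angular c s)) has_vector_derivative D v) (at s0)"
        using tr[of "angular c" s0 UNIV v] dv s0(2) by simp
      then have gD: "g' s0 = D v" using vel0 vector_derivative_unique_at by blast
      have evU'': "\<forall>\<^sub>F u in at 0 within {0..}. \<xi> u \<in> U'"
        using evU' by (simp add: at_within_Ici_at_right)
      have \<xi>\<phi>: "((\<lambda>u. \<phi> (\<xi> u)) has_vector_derivative D w) (at 0 within {0..})"
        by (rule tr[OF \<xi>0 _ evU'' \<xi>d]) simp
      have \<xi>lim: "limitin X \<xi> q (at_right 0)"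
        using chart_limit[OF C'A qU' evU'] has_vector_derivative_tendsto[OF \<xi>d] \<xi>0
        by (simp add: at_within_Ici_at_right)
      then have evN: "\<forall>\<^sub>F u in at_right 0. \<xi> u \<in> N"
        using oN q(1) by (auto simp: limitin_def)
      have "((\<lambda>u. \<phi> (\<xi> u)) has_derivative (\<lambda>x. x *\<^sub>R D w)) (at 0 within {0..})"
        using \<xi>\<phi> by (simp add: has_vector_derivative_def)
      then have "((\<lambda>u. \<Psi> (\<phi> (\<xi> u))) has_derivative (\<lambda>x. \<Psi>' (x *\<^sub>R D w))) (at 0 within {0..})"
        by (rule has_derivative_compose) (use \<Psi>'(1) \<xi>0 qU in simp)
      then have "((\<lambda>u. \<Psi> (\<phi> (\<xi> u))) has_vector_derivative \<Psi>' (D w)) (at 0 within {0..})"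
        by (simp add: has_vector_derivative_def linear_scale[OF has_derivative_linear[OF \<Psi>'(1)]])
      then have "((\<lambda>u. Im (\<Psi> (\<phi> (\<xi> u)))) has_vector_derivative Im (\<Psi>' (D w))) (at 0 within {0..})"
        by (rule bounded_linear.has_vector_derivative[OF bounded_linear_Im])
      then have height: "((\<lambda>u. Im (\<Psi> (\<phi> (\<xi> u)))) has_real_derivative Im (\<Psi>' (D w))) (at 0 within {0..})"
        by (simp add: has_real_derivative_iff_has_vector_derivative)
      \<comment> \<open>In straightened coordinates the path starts on the real axis; the sign of its vertical velocity is that of the determinant.\<close>
      have "Im (\<Psi>' (D w)) = k * (Im (cnj (D 1) * D \<i>) * Im (cnj v * w))"
        using Im\<Psi>' gD det_linear[OF D(1), of v w] by simp
      then have sgn: "Im (\<Psi>' (D w)) = (k * Im (cnj (D 1) * D \<i>)) * Im (cnj v * w)" by simp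
      have kpos: "0 < k * Im (cnj (D 1) * D \<i>)" using \<Psi>'(2) D(2) by simp
      have start: "Im (\<Psi> (\<phi> (\<xi> 0))) = 0"
        using \<Psi>\<Phi>[of "complex_of_real s0"] s0\<delta>(1) \<Phi>g \<xi>0 qU by simp
      show "(0 < Im (cnj (velocity (snd C') (angular d) s) * w) \<longrightarrow> (\<forall>\<^sub>F u in at_right 0. \<xi> u \<in> P)) \<and>
          (Im (cnj (velocity (snd C') (angular d) s) * w) < 0 \<longrightarrow> (\<forall>\<^sub>F u in at_right 0. \<xi> u \<in> Q))"
      proof (intro conjI impI)
        assume "0 < Im (cnj (velocity (snd C') (angular d) s) * w)"
        then have "0 < Im (cnj v * w)" by (simp add: C'_eq vel_eq v_def)
        then have "0 < Im (\<Psi>' (D w))" unfolding sgn using kpos by (rule mult_pos_pos[rotated])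
        from has_real_derivative_pos_inc_right[OF height this] start
        obtain b where "b > 0" "\<And>h. 0 < h \<Longrightarrow> h < b \<Longrightarrow> 0 < Im (\<Psi> (\<phi> (\<xi> h)))" by auto
        then have "\<forall>\<^sub>F u in at_right 0. 0 < Im (\<Psi> (\<phi> (\<xi> u)))"
          unfolding eventually_at_right_field by (intro exI[of _ b]) simp
        then show "\<forall>\<^sub>F u in at_right 0. \<xi> u \<in> P"
          using evN
        proof eventually_elim
          case (elim u)
          then obtain z where z: "\<xi> u = \<Theta> z" "z \<in> B" by (auto simp: N_eq)
          then have "\<Psi> (\<phi> (\<xi> u)) = z" using \<Theta>(2)[OF z(2)] \<Psi>\<Phi>[of z] BS by (auto simp: S_def)
          then show ?case using elim z by (auto simp: P_def)
        qed
      next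
        assume "Im (cnj (velocity (snd C') (angular d) s) * w) < 0"
        then have "Im (cnj v * w) < 0" by (simp add: C'_eq vel_eq v_def)
        then have "Im (\<Psi>' (D w)) < 0" unfolding sgn using kpos by (rule mult_pos_neg[rotated])
        then have "0 < - Im (\<Psi>' (D w))" by simp
        from has_real_derivative_pos_inc_right[OF DERIV_minus[OF height] this] start
        obtain b where "b > 0" "\<And>h. 0 < h \<Longrightarrow> h < b \<Longrightarrow> Im (\<Psi> (\<phi> (\<xi> h))) < 0" by auto
        then have "\<forall>\<^sub>F u in at_right 0. Im (\<Psi> (\<phi> (\<xi> u))) < 0"
          unfolding eventually_at_right_field by (intro exI[of _ b]) simp
        then show "\<forall>\<^sub>F u in at_right 0. \<xi> u \<in> Q"
          using evN
        proof eventually_elim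
          case (elim u)
          then obtain z where z: "\<xi> u = \<Theta> z" "z \<in> B" by (auto simp: N_eq)
          then have "\<Psi> (\<phi> (\<xi> u)) = z" using \<Theta>(2)[OF z(2)] \<Psi>\<Phi>[of z] BS by (auto simp: S_def)
          then show ?case using elim z by (auto simp: Q_def)
        qed
      qed
    qed
  qed
qed

end

section \<open>The dual graph of a pair of multicurves\<close>

lemma connectedin_local_const:
  assumes "connectedin X S" "x \<in> S" "y \<in> S"
    and loc: "\<And>p. p \<in> S \<Longrightarrow> \<exists>N. openin X N \<and> p \<in> N \<and> (\<forall>q\<in>N \<inter> S. f q = f p)"
  shows "f x = f y"
proof (rule ccontr)
  assume ne: "f x \<noteq> f y"
  define E1 where "E1 = \<Union>{N. openin X N \<and> (\<forall>q\<in>N \<inter> S. f q = f x)}"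
  define E2 where "E2 = \<Union>{N. openin X N \<and> (\<forall>q\<in>N \<inter> S. f q \<noteq> f x)}"
  have "openin X E1" "openin X E2" unfolding E1_def E2_def by (auto intro!: openin_Union)
  moreover have "E1 \<inter> E2 \<inter> S = {}" unfolding E1_def E2_def by blast
  moreover have "S \<subseteq> E1 \<union> E2"
  proof
    fix p assume "p \<in> S"
    then obtain N where N: "openin X N" "p \<in> N" "\<forall>q\<in>N \<inter> S. f q = f p" using loc by blast
    show "p \<in> E1 \<union> E2"
    proof (cases "f p = f x")
      case True then show ?thesis using N unfolding E1_def by auto
    next
      case False then show ?thesis using N unfolding E2_def by auto
    qed
  qed
  moreover have "x \<in> E1" using loc[OF assms(2)] unfolding E1_def by auto
  moreover have "y \<in> E2"
  proof -
    obtain N where N: "openin X N" "y \<in> N" "\<forall>q\<in>N \<inter> S. f q = f y" using loc[OF assms(3)] by blast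
    then show ?thesis using ne unfolding E2_def by auto
  qed
  ultimately show False using assms(1-3) unfolding connectedin by blast
qed

text \<open>A function on the unit interval that is locally constant off a finite set changes by the sum of its
  jumps.\<close>

lemma sum_of_jumps:
  fixes h J :: "real \<Rightarrow> int"
  assumes fin: "finite T" and T: "T \<subseteq> {0<..<1}"
    and jump: "\<And>t. t \<in> T \<Longrightarrow> \<exists>p q. (\<forall>\<^sub>F u in at_right 0. h (t + u) = p) \<and>
       (\<forall>\<^sub>F u in at_right 0. h (t - u) = q) \<and> p - q = J t"
    and const: "\<And>t. t \<in> {0..1} - T \<Longrightarrow> \<exists>e>0. \<forall>u\<in>{0..1}. \<bar>u - t\<bar> < e \<longrightarrow> h u = h t"
  shows "h 1 - h 0 = sum J T"
proof -
  obtain p q where p: "\<And>t. t \<in> T \<Longrightarrow> \<forall>\<^sub>F u in at_right 0. h (t + u) = p t"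
    and q: "\<And>t. t \<in> T \<Longrightarrow> \<forall>\<^sub>F u in at_right 0. h (t - u) = q t"
    and pq: "\<And>t. t \<in> T \<Longrightarrow> p t - q t = J t" using jump by metis
  \<comment> \<open>Subtracting the jumps already passed leaves a locally constant function.\<close>
  define G where "G t = (if t \<in> T then q t else h t) - (\<Sum>t'\<in>{t'\<in>T. t' < t}. J t')" for t
  have loc: "\<forall>\<^sub>F u in at t within {0..1}. G t = G u" if t: "t \<in> {0..1}" for t
  proof -
    obtain d where d: "0 < d" "\<And>x. x \<in> T \<Longrightarrow> x \<noteq> t \<Longrightarrow> d \<le> dist t x"
      using finite_set_avoid[OF fin] by metis
    have d': "x = t" if "x \<in> T" "\<bar>x - t\<bar> < d" for x
      using d(2)[OF that(1)] that(2) by (cases "x = t") (auto simp: dist_real_def abs_minus_commute)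
    show ?thesis
    proof (cases "t \<in> T")
      case False
      obtain e where e: "e > 0" "\<And>u. u \<in> {0..1} \<Longrightarrow> \<bar>u - t\<bar> < e \<Longrightarrow> h u = h t"
        using const[of t] t False by blast
      have "G t = G u" if u: "u \<in> {0..1}" "\<bar>u - t\<bar> < min d e" for u
      proof -
        have "{t'\<in>T. t' < u} = {t'\<in>T. t' < t}" using d' u False by (auto; smt (verit, best))
        moreover have "u \<notin> T" using d'[of u] u False by auto
        ultimately show ?thesis using e(2)[of u] u False by (simp add: G_def)
      qed
      then show ?thesis
        unfolding eventually_at using d(1) e(1) by (intro exI[of _ "min d e"]) (auto simp: dist_real_def)
    next
      case True
      obtain e1 where e1: "e1 > 0" "\<And>u. 0 < u \<Longrightarrow> u < e1 \<Longrightarrow> h (t + u) = p t"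
        using p[OF True] unfolding eventually_at_right_field by auto
      obtain e2 where e2: "e2 > 0" "\<And>u. 0 < u \<Longrightarrow> u < e2 \<Longrightarrow> h (t - u) = q t"
        using q[OF True] unfolding eventually_at_right_field by auto
      have "G t = G u" if u: "u \<noteq> t" "\<bar>u - t\<bar> < min d (min e1 e2)" for u
      proof -
        have uT: "u \<notin> T" using d'[of u] u by auto
        show ?thesis
        proof (cases "u < t")
          case True
          have "{t'\<in>T. t' < u} = {t'\<in>T. t' < t}" using d' u True by (auto; smt (verit, best))
          then show ?thesis using e2(2)[of "t - u"] u True uT \<open>t \<in> T\<close> by (simp add: G_def)
        next
          case False
          then have "{t'\<in>T. t' < u} = insert t {t'\<in>T. t' < t}"
            using d' u \<open>t \<in> T\<close> by (auto; smt (verit, best))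
          then have "(\<Sum>t'\<in>{t'\<in>T. t' < u}. J t') = J t + (\<Sum>t'\<in>{t'\<in>T. t' < t}. J t')"
            using fin by simp
          then show ?thesis
            using e1(2)[of "u - t"] u False uT \<open>t \<in> T\<close> pq[OF \<open>t \<in> T\<close>] by (simp add: G_def)
        qed
      qed
      then show ?thesis
        unfolding eventually_at using d(1) e1(1) e2(1)
        by (intro exI[of _ "min d (min e1 e2)"]) (auto simp: dist_real_def)
    qed
  qed
  have "G 0 = G 1"
    by (rule connected_local_const[of "{0..1}"]) (use loc in auto)
  moreover have "{t'\<in>T. t' < 0} = {}" "{t'\<in>T. t' < 1} = T" "0 \<notin> T" "1 \<notin> T" using T by auto
  ultimately show ?thesis by (simp add: G_def)
qed

lemma Ck_on_const: "Ck_on k (\<lambda>_. c) U"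
  by (induction k arbitrary: c) (auto intro!: exI[of _ "\<lambda>_ _. 0"])

lemma smooth_on_affine: "smooth_on (\<lambda>x::real. a + x *\<^sub>R b) U"
proof -
  have "Ck_on k (\<lambda>x::real. a + x *\<^sub>R b) U" for k
  proof (cases k)
    case 0 then show ?thesis by (auto intro!: continuous_intros)
  next
    case (Suc k)
    have "((\<lambda>x::real. a + x *\<^sub>R b) has_derivative (\<lambda>h. h *\<^sub>R b)) (at x)" for x
      by (auto intro!: derivative_eq_intros)
    then show ?thesis unfolding Suc Ck_on.simps by (intro exI[of _ "\<lambda>_ h. h *\<^sub>R b"]) (simp add: Ck_on_const)
  qed
  then show ?thesis by (simp add: smooth_on_def)
qed

context curve_pair
begin

text \<open>The face through \<open>x\<close>.\<close>

definition face :: "'a \<Rightarrow> 'a set" where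
  "face x = connected_component_of_set (subtopology X faces) x"

lemma topspace_faces: "topspace (subtopology X faces) = faces"
  using faces_sub by auto

lemma face_refl: "x \<in> faces \<Longrightarrow> x \<in> face x"
  unfolding face_def by (metis connected_component_of_refl mem_Collect_eq topspace_faces)

lemma face_sub: "face x \<subseteq> faces"
  unfolding face_def using connected_component_of_subset_topspace[of "subtopology X faces" x] topspace_faces by simp

lemma face_eq: "y \<in> face x \<Longrightarrow> face y = face x"
  unfolding face_def using connected_component_of_equiv[of "subtopology X faces" x y] by simp

lemma face_maximal: "connectedin X S \<Longrightarrow> S \<subseteq> faces \<Longrightarrow> x \<in> S \<Longrightarrow> S \<subseteq> face x"
  unfolding face_def by (intro connected_component_of_maximal) (auto simp: connectedin_subtopology)

lemma chart_ball:
  assumes "openin X W" "p \<in> W"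
  obtains U \<phi> r where "(U, \<phi>) \<in> A" "p \<in> U" "0 < r" "ball (\<phi> p) r \<subseteq> \<phi> ` U"
    "inv_into U \<phi> ` ball (\<phi> p) r \<subseteq> W" "openin X (inv_into U \<phi> ` ball (\<phi> p) r)"
    "\<And>T. connected T \<Longrightarrow> T \<subseteq> ball (\<phi> p) r \<Longrightarrow> connectedin X (inv_into U \<phi> ` T)"
proof -
  have "p \<in> topspace X" using assms openin_subset by blast
  then obtain U \<phi> where C: "(U, \<phi>) \<in> A" "p \<in> U" by (rule chart_at)
  have "open (\<phi> ` (U \<inter> W))" "\<phi> p \<in> \<phi> ` (U \<inter> W)"
    using chart_image_open[OF C(1) assms(1)] assms(2) C(2) by auto
  then obtain r where r: "0 < r" "ball (\<phi> p) r \<subseteq> \<phi> ` (U \<inter> W)" by (meson openE)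
  have sub: "ball (\<phi> p) r \<subseteq> \<phi> ` U" using r(2) by blast
  have im: "inv_into U \<phi> ` ball (\<phi> p) r = {x \<in> U. \<phi> x \<in> ball (\<phi> p) r}"
  proof
    show "inv_into U \<phi> ` ball (\<phi> p) r \<subseteq> {x \<in> U. \<phi> x \<in> ball (\<phi> p) r}"
    proof
      fix x assume "x \<in> inv_into U \<phi> ` ball (\<phi> p) r"
      then obtain z where z: "z \<in> ball (\<phi> p) r" "x = inv_into U \<phi> z" by blast
      then show "x \<in> {x \<in> U. \<phi> x \<in> ball (\<phi> p) r}" using chart_inverse[OF C(1)] sub by auto
    qed
    show "{x \<in> U. \<phi> x \<in> ball (\<phi> p) r} \<subseteq> inv_into U \<phi> ` ball (\<phi> p) r"
      using chart_inverse(1)[OF C(1)] by (metis (no_types, lifting) image_eqI mem_Collect_eq subsetI)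
  qed
  note cont = chart_inverse_continuous[OF C(1)]
  show thesis
  proof (rule that[OF C r(1) sub])
    show "inv_into U \<phi> ` ball (\<phi> p) r \<subseteq> W"
      unfolding im using r(2) chart_inj[OF C(1)] by (force dest: inj_onD)
    show "openin X (inv_into U \<phi> ` ball (\<phi> p) r)"
      unfolding im by (rule chart_vimage_open[OF C(1) open_ball])
    show "connectedin X (inv_into U \<phi> ` T)" if "connected T" "T \<subseteq> ball (\<phi> p) r" for T
      using connectedin_continuous_map_image[OF cont, of T] that sub
      by (auto simp: connectedin_subtopology)
  qed
qed

lemma open_face: "openin X (face x)"
proof (subst openin_subopen, intro ballI)
  fix y assume y: "y \<in> face x"
  then have "y \<in> faces" using face_sub by blast
  from chart_ball[OF open_faces this] obtain U \<phi> r
    where r: "(U, \<phi>) \<in> A" "y \<in> U" "0 < r" "inv_into U \<phi> ` ball (\<phi> y) r \<subseteq> faces"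
      "openin X (inv_into U \<phi> ` ball (\<phi> y) r)" "connectedin X (inv_into U \<phi> ` ball (\<phi> y) r)"
    by (metis connected_ball subset_refl)
  have "y \<in> inv_into U \<phi> ` ball (\<phi> y) r"
    using chart_inverse(1)[OF r(1,2)] r(3) by (metis centre_in_ball image_eqI)
  then show "\<exists>T. openin X T \<and> y \<in> T \<and> T \<subseteq> face x"
    using face_maximal[OF r(6,4)] face_eq[OF y] r(5) by metis
qed

lemma continuous_iff_face:
  "continuous_map (subtopology X faces) (discrete_topology UNIV) (f :: 'a \<Rightarrow> 'b) \<longleftrightarrow>
     (\<forall>x\<in>faces. \<forall>y\<in>faces \<inter> face x. f y = f x)"
proof
  assume f: "continuous_map (subtopology X faces) (discrete_topology UNIV) f"
  show "\<forall>x\<in>faces. \<forall>y\<in>faces \<inter> face x. f y = f x"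
  proof (intro ballI)
    fix x y assume x: "x \<in> faces" and y: "y \<in> faces \<inter> face x"
    have "connectedin (subtopology X faces) (face x)"
      unfolding face_def by (rule connectedin_connected_component_of)
    then have "connectedin (discrete_topology UNIV) (f ` face x)"
      by (rule connectedin_continuous_map_image[OF f])
    then obtain a where "f ` face x \<subseteq> {a}" by (auto simp: connectedin_discrete_topology)
    then show "f y = f x" using face_refl[OF x] y by blast
  qed
next
  assume f: "\<forall>x\<in>faces. \<forall>y\<in>faces \<inter> face x. f y = f x"
  show "continuous_map (subtopology X faces) (discrete_topology UNIV) f"
    unfolding continuous_map_def
  proof (intro conjI allI impI)
    fix U :: "'b set"
    have "{x \<in> faces. f x \<in> U} = \<Union>(face ` {x \<in> faces. f x \<in> U})"
    proof
      show "{x \<in> faces. f x \<in> U} \<subseteq> \<Union>(face ` {x \<in> faces. f x \<in> U})" using face_refl by blast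
      show "\<Union>(face ` {x \<in> faces. f x \<in> U}) \<subseteq> {x \<in> faces. f x \<in> U}"
      proof
        fix y assume "y \<in> \<Union>(face ` {x \<in> faces. f x \<in> U})"
        then obtain x where x: "x \<in> faces" "f x \<in> U" "y \<in> face x" by blast
        then have "y \<in> faces" using face_sub by blast
        then show "y \<in> {x \<in> faces. f x \<in> U}" using f x by auto
      qed
    qed
    moreover have "openin X (\<Union>(face ` {x \<in> faces. f x \<in> U}))" using open_face by auto
    ultimately have "openin X {x \<in> faces. f x \<in> U}" by simp
    then show "openin (subtopology X faces) {x \<in> topspace (subtopology X faces). f x \<in> U}"
      unfolding topspace_faces by (simp add: openin_open_subtopology open_faces)
  qed auto
qed

text \<open>Pushing a point of a curve off the curve along its left normal (for \<open>\<sigma> > 0\<close>), as in the definition of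
  \<^const>\<open>lies_beside\<close>.\<close>

lemma push:
  assumes d: "d \<in> m \<union> n" "d (cis s) \<notin> vertices" and C: "(U, \<phi>) \<in> A" "d (cis s) \<in> U"
    and "\<sigma> \<noteq> (0::real)"
  defines "v \<equiv> velocity \<phi> (angular d) s"
  defines "\<xi> \<equiv> \<lambda>u. inv_into U \<phi> (\<phi> (d (cis s)) + of_real (\<sigma> * u) * (\<i> * v))"
  shows "\<xi> 0 = d (cis s)" "initial_velocity (U, \<phi>) \<xi> (of_real \<sigma> * (\<i> * v))"
    "Im (cnj v * (of_real \<sigma> * (\<i> * v))) = \<sigma> * (cmod v)\<^sup>2" "v \<noteq> 0"
    "limitin X \<xi> (d (cis s)) (at_right 0)"
proof -
  show \<xi>0: "\<xi> 0 = d (cis s)" unfolding \<xi>_def using chart_inverse(1)[OF C] by simp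
  show "v \<noteq> 0" unfolding v_def using regular_velocity(2)[OF curve_regular[OF d] C(1)] C(2) by simp
  show "Im (cnj v * (of_real \<sigma> * (\<i> * v))) = \<sigma> * (cmod v)\<^sup>2"
    unfolding cmod_power2 by (simp add: power2_eq_square algebra_simps)
  define g where "g u = \<phi> (d (cis s)) + of_real (\<sigma> * u) * (\<i> * v)" for u
  have g: "(g has_vector_derivative (of_real \<sigma> * (\<i> * v))) (at 0 within {0..})"
    unfolding g_def by (auto intro!: derivative_eq_intros)
  have "g 0 \<in> \<phi> ` U" using C(2) by (simp add: g_def)
  then have "\<forall>\<^sub>F u in at 0 within {0..}. g u \<in> \<phi> ` U"
    using has_vector_derivative_tendsto[OF g] chart_open[OF C(1)] by (intro topological_tendstoD) auto
  then have ev: "\<forall>\<^sub>F u in at 0 within {0..}. \<xi> u \<in> U \<and> \<phi> (\<xi> u) = g u"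
    by (rule eventually_mono) (simp add: \<xi>_def g_def chart_inverse[OF C(1)])
  then have evU: "\<forall>\<^sub>F u in at_right 0. \<xi> u \<in> U"
    unfolding at_within_Ici_at_right by (rule eventually_mono) simp
  have "(g has_derivative (\<lambda>x. x *\<^sub>R (of_real \<sigma> * (\<i> * v)))) (at 0 within {0..})"
    using g by (simp add: has_vector_derivative_def)
  then have "((\<lambda>u. \<phi> (\<xi> u)) has_derivative (\<lambda>x. x *\<^sub>R (of_real \<sigma> * (\<i> * v)))) (at 0 within {0..})"
  proof (rule has_derivative_transform_eventually)
    show "\<forall>\<^sub>F u in at 0 within {0..}. g u = \<phi> (\<xi> u)" using ev by (rule eventually_mono) simp
    show "g 0 = \<phi> (\<xi> 0)" unfolding \<xi>0 by (simp add: g_def)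
  qed simp
  then have d\<xi>: "((\<lambda>u. \<phi> (\<xi> u)) has_vector_derivative (of_real \<sigma> * (\<i> * v))) (at 0 within {0..})"
    by (simp add: has_vector_derivative_def)
  then show "initial_velocity (U, \<phi>) \<xi> (of_real \<sigma> * (\<i> * v))"
    using evU \<xi>0 C(2) by (simp add: initial_velocity_def)
  show "limitin X \<xi> (d (cis s)) (at_right 0)"
    using chart_limit[OF C(1,2) evU] has_vector_derivative_tendsto[OF d\<xi>] \<xi>0 by (simp add: at_within_Ici_at_right)
qed

lemma sidesD:
  assumes "sides p P Q" "d \<in> m \<union> n" "d (cis s) = p" "(U, \<phi>) \<in> A" "\<xi> 0 = p" "initial_velocity (U, \<phi>) \<xi> w"
  shows "0 < Im (cnj (velocity \<phi> (angular d) s) * w) \<Longrightarrow> \<forall>\<^sub>F u in at_right 0. \<xi> u \<in> P"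
    and "Im (cnj (velocity \<phi> (angular d) s) * w) < 0 \<Longrightarrow> \<forall>\<^sub>F u in at_right 0. \<xi> u \<in> Q"
  using assms unfolding sides_def by fastforce+

lemma sides_push:
  assumes "sides (d (cis s)) P Q" "d \<in> m \<union> n" "d (cis s) \<notin> vertices" "(U, \<phi>) \<in> A" "d (cis s) \<in> U"
  shows "\<forall>\<^sub>F u in at_right 0. inv_into U \<phi> (\<phi> (d (cis s)) + of_real (1 * u) * (\<i> * velocity \<phi> (angular d) s)) \<in> P"
    and "\<forall>\<^sub>F u in at_right 0. inv_into U \<phi> (\<phi> (d (cis s)) + of_real (- 1 * u) * (\<i> * velocity \<phi> (angular d) s)) \<in> Q"
proof -
  note p = push[OF assms(2-5), of 1] and q = push[OF assms(2-5), of "-1"]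
  show "\<forall>\<^sub>F u in at_right 0. inv_into U \<phi> (\<phi> (d (cis s)) + of_real (1 * u) * (\<i> * velocity \<phi> (angular d) s)) \<in> P"
    by (rule sidesD(1)[OF assms(1,2) refl assms(4) p(1,2)]) (use p(3,4) in simp_all)
  show "\<forall>\<^sub>F u in at_right 0. inv_into U \<phi> (\<phi> (d (cis s)) + of_real (- 1 * u) * (\<i> * velocity \<phi> (angular d) s)) \<in> Q"
    by (rule sidesD(2)[OF assms(1,2) refl assms(4) q(1,2)]) (use q(3,4) in simp_all)
qed

lemma sides_nonempty:
  assumes "sides p P Q" "sides p P' Q'" "p \<in> graph" "p \<notin> vertices"
  shows "P \<inter> P' \<noteq> {}" "Q \<inter> Q' \<noteq> {}"
proof -
  obtain d s where d: "d \<in> m \<union> n" "p = d (cis s)" using graph_cases[OF assms(3)] .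
  obtain U \<phi> where C: "(U, \<phi>) \<in> A" "p \<in> U" using chart_at assms(3) graph_sub by blast
  have *: "R \<inter> R' \<noteq> {}" if "\<forall>\<^sub>F u in at_right (0::real). g u \<in> R" "\<forall>\<^sub>F u in at_right 0. g u \<in> R'"
    for R R' :: "'a set" and g
  proof -
    have "\<forall>\<^sub>F u in at_right 0. g u \<in> R \<inter> R'" using that by eventually_elim simp
    then show ?thesis using eventually_happens'[OF trivial_limit_at_right_real] by blast
  qed
  have dv: "d (cis s) \<notin> vertices" "d (cis s) \<in> U" using assms(4) C(2) d(2) by auto
  note push1 = sides_push[OF assms(1)[unfolded d(2)] d(1) dv(1) C(1) dv(2)]
    and push2 = sides_push[OF assms(2)[unfolded d(2)] d(1) dv(1) C(1) dv(2)]
  show "P \<inter> P' \<noteq> {}" "Q \<inter> Q' \<noteq> {}"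
    using *[OF push1(1) push2(1)] *[OF push1(2) push2(2)] by blast+
qed

lemma sides_mono: "sides p P Q \<Longrightarrow> P \<subseteq> P' \<Longrightarrow> Q \<subseteq> Q' \<Longrightarrow> sides p P' Q'"
  unfolding sides_def by (blast intro: eventually_mono)

text \<open>The faces on the two sides of a one-cell do not depend on the point of the cell: they are locally
  constant along it by \<open>local_model\<close>, and the cell is connected.\<close>

lemma edge_sides:
  assumes e: "e \<in> one_cells X A m n"
  shows "\<exists>x\<in>faces. \<exists>y\<in>faces. \<forall>p\<in>e. sides p (face x) (face y)"
proof -
  let ?good = "\<lambda>p F. fst F \<in> face ` faces \<and> snd F \<in> face ` faces \<and> sides p (fst F) (snd F)"
  have sk: "topspace (skeleton X A m n) = graph - vertices"
    unfolding skeleton_def using graph_sub by auto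
  have conn: "connectedin (skeleton X A m n) e" and ne: "e \<noteq> {}" and sub: "e \<subseteq> graph - vertices"
    using e connectedin_connected_components_of nonempty_connected_components_of connected_components_of_subset
    unfolding one_cells_def sk[symmetric] by blast+
  have local: "\<exists>N F. openin X N \<and> p \<in> N \<and> (\<forall>q\<in>N \<inter> graph. ?good q F)" if "p \<in> e" for p
  proof -
    have p: "p \<in> graph" "p \<notin> vertices" using sub that by auto
    obtain c t where c: "c \<in> m \<union> n" "p = c (cis t)" using graph_cases[OF p(1)] .
    obtain N P Q where N: "openin X N" "p \<in> N" and PQ: "connectedin X P" "connectedin X Q" "P \<subseteq> faces" "Q \<subseteq> faces"
      and sd: "\<And>q. q \<in> N \<Longrightarrow> q \<in> graph \<Longrightarrow> sides q P Q"
      using local_model[OF c(1)] p(2) c(2) by metis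
    obtain x y where xy: "x \<in> P" "y \<in> Q" using sides_nonempty[OF sd[OF N(2) p(1)] sd[OF N(2) p(1)] p] by blast
    have "P \<subseteq> face x" "Q \<subseteq> face y" using face_maximal PQ xy by auto
    then have good: "?good q (face x, face y)" if "q \<in> N \<inter> graph" for q
      using sides_mono[OF sd[of q]] that xy PQ(3,4) by auto
    show ?thesis using N good by blast
  qed
  have uniq: "F = F'" if "?good p F" "?good p F'" "p \<in> e" for p F F'
  proof -
    have p: "p \<in> graph" "p \<notin> vertices" using sub that by auto
    have "fst F \<inter> fst F' \<noteq> {}" "snd F \<inter> snd F' \<noteq> {}"
      using sides_nonempty[OF _ _ p] that(1,2) by blast+
    moreover have "G = G'" if G: "G \<in> face ` faces" "G' \<in> face ` faces" "G \<inter> G' \<noteq> {}" for G G'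
    proof -
      obtain x x' z where "G = face x" "G' = face x'" "z \<in> face x" "z \<in> face x'" using G by blast
      then show ?thesis using face_eq by blast
    qed
    ultimately show ?thesis using that(1,2) by (simp add: prod_eq_iff)
  qed
  define F where "F p = (SOME F. ?good p F)" for p
  have F: "?good p (F p)" if "p \<in> e" for p
  proof -
    have "p \<in> graph" using sub that by auto
    then have "\<exists>F. ?good p F" using local[OF that] by blast
    then show ?thesis unfolding F_def by (rule someI_ex)
  qed
  have const: "F p = F q" if "p \<in> e" "q \<in> e" for p q
  proof (rule connectedin_local_const[OF conn that])
    fix p assume p: "p \<in> e"
    obtain N G where N: "openin X N" "p \<in> N" "\<And>q. q \<in> N \<inter> graph \<Longrightarrow> ?good q G" using local[OF p] by blast
    have "F q = G" if "q \<in> N" "q \<in> e" for q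
    proof -
      have "q \<in> N \<inter> graph" using that sub by auto
      then show ?thesis using uniq[OF F[OF that(2)] N(3) that(2)] by blast
    qed
    then have "\<forall>q\<in>(N \<inter> (graph - vertices)) \<inter> e. F q = F p" using p N(2) by auto
    moreover have "openin (skeleton X A m n) (N \<inter> (graph - vertices))"
      unfolding skeleton_def using N(1) by (auto simp: openin_subtopology)
    ultimately show "\<exists>N. openin (skeleton X A m n) N \<and> p \<in> N \<and> (\<forall>q\<in>N \<inter> e. F q = F p)"
      using N(2) p sub by blast
  qed
  obtain p0 where "p0 \<in> e" using ne by blast
  obtain x y where "x \<in> faces" "y \<in> faces" "F p0 = (face x, face y)"
  proof -
    obtain x y where "x \<in> faces" "fst (F p0) = face x" "y \<in> faces" "snd (F p0) = face y"
      using F[OF \<open>p0 \<in> e\<close>] by blast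
    then show thesis using that[of x y] by (simp add: prod_eq_iff)
  qed
  moreover have "sides p (face x) (face y)" if "p \<in> e" for p
  proof -
    have "F p = (face x, face y)" using const[OF \<open>p0 \<in> e\<close> that] \<open>F p0 = (face x, face y)\<close> by metis
    then show ?thesis using F[OF that] by (metis fst_conv snd_conv)
  qed
  ultimately show ?thesis by (intro bexI[of _ x] bexI[of _ y] ballI)
qed

text \<open>A point of the face to the left, and one of the face to the right, of the one-cell \<open>e\<close>.\<close>

definition ends :: "'a set \<Rightarrow> 'a \<times> 'a" where
  "ends e = (SOME xy. fst xy \<in> faces \<and> snd xy \<in> faces \<and> (\<forall>p\<in>e. sides p (face (fst xy)) (face (snd xy))))"

definition left_of :: "'a set \<Rightarrow> 'a" where "left_of e = fst (ends e)"
definition right_of :: "'a set \<Rightarrow> 'a" where "right_of e = snd (ends e)"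

lemma left_right:
  assumes "e \<in> one_cells X A m n"
  shows "left_of e \<in> faces" "right_of e \<in> faces"
    "p \<in> e \<Longrightarrow> sides p (face (left_of e)) (face (right_of e))"
proof -
  have "\<exists>xy. fst xy \<in> faces \<and> snd xy \<in> faces \<and> (\<forall>p\<in>e. sides p (face (fst xy)) (face (snd xy)))"
  proof -
    obtain x y where "x \<in> faces" "y \<in> faces" "\<forall>p\<in>e. sides p (face x) (face y)"
      using edge_sides[OF assms] by (elim bexE)
    then show ?thesis by (intro exI[of _ "(x, y)"]) simp
  qed
  then have "left_of e \<in> faces \<and> right_of e \<in> faces \<and>
      (\<forall>p\<in>e. sides p (face (left_of e)) (face (right_of e)))"
    unfolding left_of_def right_of_def ends_def by (rule someI_ex)
  then show "left_of e \<in> faces" "right_of e \<in> faces"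
    "p \<in> e \<Longrightarrow> sides p (face (left_of e)) (face (right_of e))" by simp_all
qed

sublocale dual_graph "complement X m n" face "one_cells X A m n" left_of right_of
  by unfold_locales (simp_all add: left_right)

end

section \<open>Overlap functions on the dual graph\<close>

context curve_pair
begin

lemma edge_at_cell:
  assumes "p \<in> graph" "p \<notin> vertices"
  shows "edge_at p \<in> one_cells X A m n" "p \<in> edge_at p"
proof -
  have "p \<in> topspace (skeleton X A m n)" unfolding skeleton_def using assms graph_sub by auto
  then show "edge_at p \<in> one_cells X A m n" "p \<in> edge_at p"
    unfolding one_cells_def connected_components_of_def by (auto simp: connected_component_of_refl)
qed

lemma cell_point:
  assumes "e \<in> one_cells X A m n"
  obtains d s U \<phi> where "d \<in> m \<union> n" "d (cis s) \<in> e" "d (cis s) \<notin> vertices" "edge_at (d (cis s)) = e"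
    "(U, \<phi>) \<in> A" "d (cis s) \<in> U"
proof -
  have sk: "topspace (skeleton X A m n) = graph - vertices"
    unfolding skeleton_def using graph_sub by auto
  obtain p where p: "p \<in> graph" "p \<notin> vertices" "e = edge_at p"
    using assms unfolding one_cells_def connected_components_of_def sk by blast
  obtain d s where d: "d \<in> m \<union> n" "p = d (cis s)" using graph_cases[OF p(1)] .
  obtain U \<phi> where "(U, \<phi>) \<in> A" "p \<in> U" using chart_at p(1) graph_sub by blast
  then show thesis using that d p edge_at_cell(2)[OF p(1,2)] by blast
qed

lemma cell_vertices: "e \<in> one_cells X A m n \<Longrightarrow> p \<in> e \<Longrightarrow> p \<notin> vertices \<and> p \<in> graph"
  using connected_components_of_subset[of e "skeleton X A m n"] graph_sub
  unfolding one_cells_def skeleton_def by auto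

lemma loc_const_face:
  assumes "loc_const f" "x \<in> faces" "y \<in> face x" shows "f y = f x"
  using assms face_sub unfolding loc_const_def by blast

lemma lies_beside_iff:
  assumes e: "e \<in> one_cells X A m n" and R: "R = {x \<in> faces. f x = M}" and f: "loc_const f"
  shows "lies_beside A (m \<union> n) 1 R e \<longleftrightarrow> f (left_of e) = M"
    and "lies_beside A (m \<union> n) (- 1) R e \<longleftrightarrow> f (right_of e) = M"
proof -
  have both: "lies_beside A (m \<union> n) \<sigma> R e \<longleftrightarrow> f z = M"
    if z: "z \<in> faces"
    and pz: "\<And>d s U \<phi>. d \<in> m \<union> n \<Longrightarrow> d (cis s) \<in> e \<Longrightarrow> (U, \<phi>) \<in> A \<Longrightarrow> d (cis s) \<in> U \<Longrightarrow>
      \<forall>\<^sub>F u in at_right 0. inv_into U \<phi> (\<phi> (d (cis s)) + of_real (\<sigma> * u) * (\<i> * velocity \<phi> (angular d) s)) \<in> face z"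
    for \<sigma> z
  proof
    assume "f z = M"
    then have "face z \<subseteq> R" using loc_const_face[OF f z] face_sub unfolding R by blast
    obtain d s U \<phi> where d: "d \<in> m \<union> n" "d (cis s) \<in> e" "(U, \<phi>) \<in> A" "d (cis s) \<in> U"
      by (rule cell_point[OF e]) 
    have "\<forall>\<^sub>F u in at_right 0. inv_into U \<phi> (\<phi> (d (cis s)) + of_real (\<sigma> * u) * (\<i> * velocity \<phi> (angular d) s)) \<in> R"
      using pz[OF d] by (rule eventually_mono) (use \<open>face z \<subseteq> R\<close> in blast)
    then show "lies_beside A (m \<union> n) \<sigma> R e" unfolding lies_beside_def using d by blast
  next
    assume "lies_beside A (m \<union> n) \<sigma> R e"
    then obtain d s U \<phi> where d: "d \<in> m \<union> n" "d (cis s) \<in> e" "(U, \<phi>) \<in> A" "d (cis s) \<in> U"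
      and ev: "\<forall>\<^sub>F u in at_right 0. inv_into U \<phi> (\<phi> (d (cis s)) + of_real (\<sigma> * u) * (\<i> * velocity \<phi> (angular d) s)) \<in> R"
      unfolding lies_beside_def by blast
    have "\<forall>\<^sub>F u in at_right 0. inv_into U \<phi> (\<phi> (d (cis s)) + of_real (\<sigma> * u) * (\<i> * velocity \<phi> (angular d) s)) \<in> R \<inter> face z"
      using ev pz[OF d] by eventually_elim blast
    then obtain x where "x \<in> R \<inter> face z"
      using eventually_happens'[OF trivial_limit_at_right_real] by blast
    then show "f z = M" using loc_const_face[OF f z, of x] unfolding R by auto
  qed
  show "lies_beside A (m \<union> n) 1 R e \<longleftrightarrow> f (left_of e) = M"
  proof (rule both[OF left_right(1)[OF e]])
    fix d s U \<phi> assume d: "d \<in> m \<union> n" "d (cis s) \<in> e" "(U, \<phi>) \<in> A" "d (cis s) \<in> U"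
    show "\<forall>\<^sub>F u in at_right 0. inv_into U \<phi> (\<phi> (d (cis s)) + of_real (1 * u) * (\<i> * velocity \<phi> (angular d) s))
        \<in> face (left_of e)"
      using sides_push(1)[OF left_right(3)[OF e d(2)] d(1) _ d(3,4)] cell_vertices[OF e d(2)] by simp
  qed
  show "lies_beside A (m \<union> n) (- 1) R e \<longleftrightarrow> f (right_of e) = M"
  proof (rule both[OF left_right(2)[OF e]])
    fix d s U \<phi> assume d: "d \<in> m \<union> n" "d (cis s) \<in> e" "(U, \<phi>) \<in> A" "d (cis s) \<in> U"
    show "\<forall>\<^sub>F u in at_right 0. inv_into U \<phi> (\<phi> (d (cis s)) + of_real (- 1 * u) * (\<i> * velocity \<phi> (angular d) s))
        \<in> face (right_of e)"
      using sides_push(2)[OF left_right(3)[OF e d(2)] d(1) _ d(3,4)] cell_vertices[OF e d(2)] by simp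
  qed
qed

lemma boundary_chain_eq:
  assumes "loc_const f"
  shows "boundary_chain X A m n {x \<in> faces. f x = M} = cobd (\<lambda>x. of_bool (f x = M))"
  using lies_beside_iff[OF _ refl assms] by (auto simp: boundary_chain_def cobd_def fun_eq_iff)

lemma crosses_leftwardE:
  assumes "crosses_leftward A \<gamma> s \<eta> t"
  obtains U \<phi> where "(U, \<phi>) \<in> A" "\<gamma> s \<in> U" "regular_at A \<gamma> s" "regular_at A \<eta> t" "\<gamma> s = \<eta> t"
    "0 < Im (cnj (velocity \<phi> \<gamma> s) * velocity \<phi> \<eta> t)"
proof -
  obtain C where "C \<in> A" "\<gamma> s \<in> fst C" "0 < Im (cnj (velocity (snd C) \<gamma> s) * velocity (snd C) \<eta> t)"
    using assms unfolding crosses_leftward_def case_prod_beta by blast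
  then show thesis using that[of "fst C" "snd C"] assms unfolding crosses_leftward_def by simp
qed

lemma crossing_sides:
  assumes c: "c \<in> m \<union> n" and sd: "sides (\<eta> t) P Q"
  shows "crosses_leftward A (angular c) s \<eta> t \<Longrightarrow>
      (\<forall>\<^sub>F u in at_right 0. \<eta> (t + u) \<in> P) \<and> (\<forall>\<^sub>F u in at_right 0. \<eta> (t - u) \<in> Q)"
    and "crosses_leftward A \<eta> t (angular c) s \<Longrightarrow>
      (\<forall>\<^sub>F u in at_right 0. \<eta> (t + u) \<in> Q) \<and> (\<forall>\<^sub>F u in at_right 0. \<eta> (t - u) \<in> P)"
proof -
  have iv: "initial_velocity (U, \<phi>) (\<lambda>u. \<eta> (t + \<sigma> * u)) (\<sigma> *\<^sub>R velocity \<phi> \<eta> t)"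
    if reg: "regular_at A \<eta> t" and C: "(U, \<phi>) \<in> A" "\<eta> t \<in> U" and "\<sigma> \<noteq> 0" for U \<phi> \<sigma>
  proof -
    note r = regular_velocity[OF reg C]
    have f: "filterlim (\<lambda>u. t + \<sigma> * u) (at t) (at_right 0)"
      unfolding filterlim_at using \<open>\<sigma> \<noteq> 0\<close>
      by (auto intro!: tendsto_eq_intros simp: eventually_at_right_field intro: exI[of _ 1])
    have "\<forall>\<^sub>F u in at_right 0. \<eta> (t + \<sigma> * u) \<in> U"
      using limit_chart(1)[OF C r(3)] f by (rule eventually_compose_filterlim)
    moreover have "((\<lambda>u. t + \<sigma> * u) has_vector_derivative \<sigma>) (at 0)"
      by (auto intro!: derivative_eq_intros simp: has_vector_derivative_def)
    then have "((\<lambda>s. \<phi> (\<eta> s)) \<circ> (\<lambda>u. t + \<sigma> * u) has_vector_derivative (\<sigma> *\<^sub>R velocity \<phi> \<eta> t)) (at 0)"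
      by (rule vector_diff_chain_at) (use r(1) in simp)
    then have "((\<lambda>u. \<phi> (\<eta> (t + \<sigma> * u))) has_vector_derivative (\<sigma> *\<^sub>R velocity \<phi> \<eta> t)) (at 0 within {0..})"
      by (simp add: comp_def has_vector_derivative_at_within)
    ultimately show ?thesis using C(2) by (simp add: initial_velocity_def)
  qed
  show "(\<forall>\<^sub>F u in at_right 0. \<eta> (t + u) \<in> P) \<and> (\<forall>\<^sub>F u in at_right 0. \<eta> (t - u) \<in> Q)"
    if cr: "crosses_leftward A (angular c) s \<eta> t"
  proof -
    obtain U \<phi> where C: "(U, \<phi>) \<in> A" "c (cis s) \<in> U" and reg: "regular_at A \<eta> t" and eq: "c (cis s) = \<eta> t"
      and pos: "0 < Im (cnj (velocity \<phi> (angular c) s) * velocity \<phi> \<eta> t)"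
      using cr by (rule crosses_leftwardE)
    note C = C(1) C(2)[unfolded eq]
    note a = iv[OF reg C, of 1] and b = iv[OF reg C, of "-1"]
    have "\<forall>\<^sub>F u in at_right 0. \<eta> (t + 1 * u) \<in> P"
      by (rule sidesD(1)[OF sd c eq C(1) _ a]) (use pos in simp_all)
    moreover have "\<forall>\<^sub>F u in at_right 0. \<eta> (t + - 1 * u) \<in> Q"
      by (rule sidesD(2)[OF sd c eq C(1) _ b]) (use pos in simp_all)
    ultimately show ?thesis by simp
  qed
  show "(\<forall>\<^sub>F u in at_right 0. \<eta> (t + u) \<in> Q) \<and> (\<forall>\<^sub>F u in at_right 0. \<eta> (t - u) \<in> P)"
    if cr: "crosses_leftward A \<eta> t (angular c) s"
  proof -
    obtain U \<phi> where C: "(U, \<phi>) \<in> A" "\<eta> t \<in> U" and reg: "regular_at A \<eta> t" and eq: "\<eta> t = c (cis s)"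
      and "0 < Im (cnj (velocity \<phi> \<eta> t) * velocity \<phi> (angular c) s)"
      using cr by (rule crosses_leftwardE)
    note eq = eq[symmetric]
    from \<open>0 < Im _\<close> have neg: "Im (cnj (velocity \<phi> (angular c) s) * velocity \<phi> \<eta> t) < 0" by (simp add: algebra_simps)
    note a = iv[OF reg C, of 1] and b = iv[OF reg C, of "-1"]
    have "\<forall>\<^sub>F u in at_right 0. \<eta> (t + 1 * u) \<in> Q"
      by (rule sidesD(2)[OF sd c eq C(1) _ a]) (use neg in simp_all)
    moreover have "\<forall>\<^sub>F u in at_right 0. \<eta> (t + - 1 * u) \<in> P"
      by (rule sidesD(1)[OF sd c eq C(1) _ b]) (use neg in simp_all)
    ultimately show ?thesis by simp
  qed
qed

text \<open>A transverse arc passes from the right side to the left side where the crossing sign is 1, and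
  conversely where it is -1. In particular the two conditions in \<^const>\<open>crossing_sign\<close> exclude each other.\<close>

lemma crossing_sign_cases:
  assumes q: "\<eta> t \<in> graph" "\<eta> t \<notin> vertices"
    and tr: "\<forall>c\<in>m \<union> n. \<forall>s. c (cis s) = \<eta> t \<longrightarrow> transverse_at A (angular c) s \<eta> t"
    and sd: "sides (\<eta> t) P Q"
  shows "crossing_sign A (m \<union> n) \<eta> t = 1 \<and>
      (\<forall>\<^sub>F u in at_right 0. \<eta> (t + u) \<in> P) \<and> (\<forall>\<^sub>F u in at_right 0. \<eta> (t - u) \<in> Q) \<or>
    crossing_sign A (m \<union> n) \<eta> t = - 1 \<and>
      (\<forall>\<^sub>F u in at_right 0. \<eta> (t + u) \<in> Q) \<and> (\<forall>\<^sub>F u in at_right 0. \<eta> (t - u) \<in> P)"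
proof -
  obtain c s where c: "c \<in> m \<union> n" "\<eta> t = c (cis s)" using graph_cases[OF q(1)] .
  obtain P' Q' where disj: "P' \<inter> Q' = {}" and sd': "sides (\<eta> t) P' Q'"
    using local_model[OF c(1)] q c(2) by metis
  have excl: False
    if "c1 \<in> m \<union> n" "crosses_leftward A (angular c1) s1 \<eta> t"
      "c2 \<in> m \<union> n" "crosses_leftward A \<eta> t (angular c2) s2" for c1 s1 c2 s2
  proof -
    have "\<forall>\<^sub>F u in at_right 0. \<eta> (t + u) \<in> P' \<inter> Q'"
      using crossing_sides(1)[OF that(1) sd' that(2)] crossing_sides(2)[OF that(3) sd' that(4)]
      by (auto elim: eventually_elim2)
    then show False using disj eventually_happens'[OF trivial_limit_at_right_real] by auto
  qed
  have "transverse_at A (angular c) s \<eta> t" using tr c by metis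
  then consider "crosses_leftward A (angular c) s \<eta> t" | "crosses_leftward A \<eta> t (angular c) s"
    unfolding transverse_at_def by blast
  then show ?thesis
  proof cases
    case 1
    then have "\<not> (\<exists>c\<in>m \<union> n. \<exists>s. crosses_leftward A \<eta> t (angular c) s)" using excl c(1) by blast
    moreover have "\<exists>c\<in>m \<union> n. \<exists>s. crosses_leftward A (angular c) s \<eta> t" using 1 c(1) by blast
    ultimately have "crossing_sign A (m \<union> n) \<eta> t = 1" unfolding crossing_sign_def by simp
    then show ?thesis using crossing_sides(1)[OF c(1) sd 1] by blast
  next
    case 2
    then have "\<not> (\<exists>c\<in>m \<union> n. \<exists>s. crosses_leftward A (angular c) s \<eta> t)" using excl c(1) by blast
    moreover have "\<exists>c\<in>m \<union> n. \<exists>s. crosses_leftward A \<eta> t (angular c) s" using 2 c(1) by blast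
    ultimately have "crossing_sign A (m \<union> n) \<eta> t = - 1" unfolding crossing_sign_def by simp
    then show ?thesis using crossing_sides(2)[OF c(1) sd 2] by blast
  qed
qed

lemma arc_difference:
  assumes f: "loc_const f" and a: "\<And>e. e \<in> one_cells X A m n \<Longrightarrow> a e = cobd f e"
    and arc: "oriented_arc X A \<eta>" and gp: "arc_general_position X A m n \<eta>"
  shows "f (\<eta> 1) - f (\<eta> 0) = algebraic_intersection X A m n a \<eta>"
proof -
  define T where "T = {t \<in> {0..1}. \<eta> t \<in> graph}"
  have fin: "finite T" and e01: "\<eta> 0 \<in> faces" "\<eta> 1 \<in> faces"
    and gpt: "\<And>t. t \<in> {0..1} \<Longrightarrow> \<eta> t \<notin> vertices"
      "\<And>t. t \<in> {0..1} \<Longrightarrow> \<forall>c\<in>m \<union> n. \<forall>s. c (cis s) = \<eta> t \<longrightarrow> transverse_at A (angular c) s \<eta> t"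
    using gp unfolding arc_general_position_def T_def by auto
  have path: "continuous_map (top_of_set {0..1}) X \<eta>" using arc by (simp add: oriented_arc_def pathin_def)
  have "f (\<eta> 1) - f (\<eta> 0) = sum (\<lambda>t. a (edge_at (\<eta> t)) * crossing_sign A (m \<union> n) \<eta> t) T"
  proof (rule sum_of_jumps[where h = "\<lambda>t. f (\<eta> t)", OF fin])
    have "0 \<notin> T" "1 \<notin> T" using e01 by (auto simp: T_def complement_def)
    then show "T \<subseteq> {0<..<1}" unfolding T_def by (auto simp: less_le)
    fix t assume "t \<in> T"
    then have t: "t \<in> {0..1}" "\<eta> t \<in> graph" by (auto simp: T_def)
    define e where "e = edge_at (\<eta> t)"
    have e: "e \<in> one_cells X A m n" "\<eta> t \<in> e" unfolding e_def using edge_at_cell[OF t(2) gpt(1)[OF t(1)]] .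
    note lr = left_right[OF e(1)]
    have ev: "\<forall>\<^sub>F u in at_right 0. f (g u) = f z"
      if "\<forall>\<^sub>F u in at_right 0. g u \<in> face z" "z \<in> faces" for g :: "real \<Rightarrow> 'a" and z
      using that(1) by (rule eventually_mono) (rule loc_const_face[OF f that(2)])
    have ae: "a (edge_at (\<eta> t)) = f (left_of e) - f (right_of e)"
      using a[OF e(1)] e(1) by (simp add: cobd_def flip: e_def)
    from crossing_sign_cases[OF t(2) gpt[OF t(1)] lr(3)[OF e(2)]]
    show "\<exists>p q. (\<forall>\<^sub>F u in at_right 0. f (\<eta> (t + u)) = p) \<and> (\<forall>\<^sub>F u in at_right 0. f (\<eta> (t - u)) = q) \<and>
        p - q = a (edge_at (\<eta> t)) * crossing_sign A (m \<union> n) \<eta> t"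
    proof (elim disjE conjE)
      assume "crossing_sign A (m \<union> n) \<eta> t = 1" "\<forall>\<^sub>F u in at_right 0. \<eta> (t + u) \<in> face (left_of e)"
        "\<forall>\<^sub>F u in at_right 0. \<eta> (t - u) \<in> face (right_of e)"
      then show ?thesis
        using ev[of "\<lambda>u. \<eta> (t + u)"] ev[of "\<lambda>u. \<eta> (t - u)"] lr(1,2) ae
        by (intro exI[of _ "f (left_of e)"] exI[of _ "f (right_of e)"]) simp
    next
      assume "crossing_sign A (m \<union> n) \<eta> t = - 1" "\<forall>\<^sub>F u in at_right 0. \<eta> (t + u) \<in> face (right_of e)"
        "\<forall>\<^sub>F u in at_right 0. \<eta> (t - u) \<in> face (left_of e)"
      then show ?thesis
        using ev[of "\<lambda>u. \<eta> (t + u)"] ev[of "\<lambda>u. \<eta> (t - u)"] lr(1,2) ae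
        by (intro exI[of _ "f (right_of e)"] exI[of _ "f (left_of e)"]) simp
    qed
  next
    fix t assume t: "t \<in> {0..1} - T"
    then have tf: "\<eta> t \<in> faces"
      using continuous_map_image_subset_topspace[OF path] by (auto simp: T_def complement_def)
    have "openin (top_of_set {0..1}) {u \<in> topspace (top_of_set {0..1}). \<eta> u \<in> face (\<eta> t)}"
      using path open_face by (rule openin_continuous_map_preimage)
    then obtain G where G: "open G" "{u \<in> {0..1}. \<eta> u \<in> face (\<eta> t)} = {0..1} \<inter> G"
      by (auto simp: openin_open)
    then have "t \<in> G" using t face_refl[OF tf] by blast
    then obtain \<epsilon> where "\<epsilon> > 0" "ball t \<epsilon> \<subseteq> G" using G(1) by (meson openE)
    then have "f (\<eta> u) = f (\<eta> t)" if u: "u \<in> {0..1}" "\<bar>u - t\<bar> < \<epsilon>" for u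
    proof -
      have "u \<in> ball t \<epsilon>" using u(2) by (simp add: dist_real_def abs_minus_commute)
      then have "\<eta> u \<in> face (\<eta> t)" using u(1) G(2) \<open>ball t \<epsilon> \<subseteq> G\<close> by blast
      then show ?thesis by (rule loc_const_face[OF f tf])
    qed
    then show "\<exists>\<epsilon>>0. \<forall>u\<in>{0..1}. \<bar>u - t\<bar> < \<epsilon> \<longrightarrow> f (\<eta> u) = f (\<eta> t)" using \<open>\<epsilon> > 0\<close> by blast
  qed
  then show ?thesis unfolding algebraic_intersection_def T_def .
qed

text \<open>A short arc that crosses a single one-cell once, along its left normal. It shows that an overlap
  function determines its chain.\<close>

lemma short_arc:
  assumes e: "e \<in> one_cells X A m n"
  obtains \<eta> where "oriented_arc X A \<eta>" "arc_general_position X A m n \<eta>"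
    "\<eta> 1 \<in> face (left_of e)" "\<eta> 0 \<in> face (right_of e)"
    "\<And>a. algebraic_intersection X A m n a \<eta> = a e"
proof -
  obtain d s U \<phi> where d: "d \<in> m \<union> n" "d (cis s) \<in> e" "d (cis s) \<notin> vertices" "edge_at (d (cis s)) = e"
    and C: "(U, \<phi>) \<in> A" "d (cis s) \<in> U" by (rule cell_point[OF e])
  define p where "p = d (cis s)"
  define v where "v = velocity \<phi> (angular d) s"
  define \<xi> where "\<xi> x = inv_into U \<phi> (\<phi> p + of_real x * (\<i> * v))" for x
  note lr = left_right[OF e]
  note sd = lr(3)[OF d(2)]
  have v: "v \<noteq> 0" using push(4)[OF d(1,3) C, of 1] by (simp add: v_def)
  have "\<forall>\<^sub>F u in at_right 0. \<xi> (1 * u) \<in> face (left_of e)" "\<forall>\<^sub>F u in at_right 0. \<xi> (- 1 * u) \<in> face (right_of e)"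
    unfolding \<xi>_def p_def v_def using sides_push[OF sd d(1,3) C] by simp_all
  then obtain b1 b2 where b: "b1 > 0" "\<And>u. 0 < u \<Longrightarrow> u < b1 \<Longrightarrow> \<xi> u \<in> face (left_of e)"
      "b2 > 0" "\<And>u. 0 < u \<Longrightarrow> u < b2 \<Longrightarrow> \<xi> (- u) \<in> face (right_of e)"
    unfolding eventually_at_right_field by auto
  have "open (\<phi> ` U)" "\<phi> p \<in> \<phi> ` U" using chart_open[OF C(1)] C(2) by (auto simp: p_def)
  then obtain r where r: "r > 0" "ball (\<phi> p) r \<subseteq> \<phi> ` U" by (meson openE)
  define \<delta> where "\<delta> = min (min b1 b2) (r / cmod v) / 2"
  have \<delta>: "0 < \<delta>" "\<delta> < b1" "\<delta> < b2" "\<delta> * cmod v < r"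
  proof -
    have m: "0 < min (min b1 b2) (r / cmod v)" using b r v by simp
    show "0 < \<delta>" using m by (simp add: \<delta>_def)
    then have "\<delta> < min (min b1 b2) (r / cmod v)" unfolding \<delta>_def by linarith
    then show "\<delta> < b1" "\<delta> < b2" "\<delta> * cmod v < r" using v by (simp_all add: pos_less_divide_eq)
  qed
  \<comment> \<open>The arc is straight in the chart, and passes through the one-cell at time 1/2.\<close>
  define g where "g u = (\<phi> p - of_real \<delta> * (\<i> * v)) + u *\<^sub>R (of_real (2 * \<delta>) * (\<i> * v))" for u :: real
  define \<eta> where "\<eta> u = inv_into U \<phi> (g u)" for u
  have g_eq: "g u = \<phi> p + of_real ((2 * u - 1) * \<delta>) * (\<i> * v)" for u
    by (simp add: g_def scaleR_conv_of_real algebra_simps)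
  have \<eta>\<xi>: "\<eta> u = \<xi> ((2 * u - 1) * \<delta>)" for u unfolding \<eta>_def \<xi>_def g_eq ..
  have gU: "g u \<in> \<phi> ` U" if "u \<in> {0..1}" for u
  proof -
    have "\<bar>(2 * u - 1) * \<delta>\<bar> \<le> \<delta>" using that \<delta>(1) by (simp add: abs_mult abs_le_iff)
    then have "cmod (of_real ((2 * u - 1) * \<delta>) * (\<i> * v)) \<le> \<delta> * cmod v"
      unfolding norm_mult norm_of_real by (simp add: mult_right_mono)
    then have "g u \<in> ball (\<phi> p) r" using \<delta>(4) unfolding g_eq by (simp add: dist_norm)
    then show ?thesis using r(2) by blast
  qed
  have \<eta>U: "\<eta> u \<in> U" "\<phi> (\<eta> u) = g u" if "u \<in> {0..1}" for u
    unfolding \<eta>_def using chart_inverse[OF C(1)] gU[OF that] by auto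
  have smooth: "smooth_arc A \<eta> a b" if "0 \<le> a" "b \<le> 1" for a b
    unfolding smooth_arc_def
  proof
    fix t assume "t \<in> {a..b}"
    have "smooth_on g {t - 1<..<t + 1}" unfolding g_def by (rule smooth_on_affine)
    moreover have "vector_derivative g (at x) = of_real (2 * \<delta>) * (\<i> * v)" for x
      unfolding g_def by (rule vector_derivative_at) (auto intro!: derivative_eq_intros)
    ultimately have "\<exists>\<epsilon>>0. \<exists>g. smooth_on g {t-\<epsilon><..<t+\<epsilon>} \<and>
        (\<forall>s\<in>{t-\<epsilon><..<t+\<epsilon>}. vector_derivative g (at s) \<noteq> 0) \<and>
        (\<forall>s\<in>{a..b} \<inter> {t-\<epsilon><..<t+\<epsilon>}. \<eta> s \<in> U \<and> \<phi> (\<eta> s) = g s)"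
      using \<eta>U that v \<delta>(1) by (intro exI[of _ 1] conjI exI[of _ g]) auto
    then show "\<exists>(U, \<phi>)\<in>A. \<exists>\<epsilon>>0. \<exists>g. smooth_on g {t-\<epsilon><..<t+\<epsilon>} \<and>
        (\<forall>s\<in>{t-\<epsilon><..<t+\<epsilon>}. vector_derivative g (at s) \<noteq> 0) \<and>
        (\<forall>s\<in>{a..b} \<inter> {t-\<epsilon><..<t+\<epsilon>}. \<eta> s \<in> U \<and> \<phi> (\<eta> s) = g s)"
      using C(1) by (intro bexI[of _ "(U, \<phi>)"]) simp_all
  qed
  have reg\<eta>: "regular_at A \<eta> (1 / 2)"
    unfolding regular_at_def by (intro exI[of _ "1 / 2"] conjI smooth) auto
  have path: "pathin X \<eta>"
    unfolding pathin_def continuous_map_def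
  proof (intro conjI allI impI)
    show "\<eta> \<in> topspace (top_of_set {0..1}) \<rightarrow> topspace X" using \<eta>U chart_sub[OF C(1)] by auto
    fix W assume "openin X W"
    then have oW: "open (\<phi> ` (U \<inter> W))" by (rule chart_image_open[OF C(1)])
    have "{u \<in> topspace (top_of_set {0..1}). \<eta> u \<in> W} = {0..1} \<inter> g -` (\<phi> ` (U \<inter> W))"
    proof -
      have "\<eta> u \<in> W \<longleftrightarrow> g u \<in> \<phi> ` (U \<inter> W)" if "u \<in> {0..1}" for u
        using \<eta>U[OF that] chart_inj[OF C(1)] unfolding \<eta>_def by (force dest: inj_onD simp: chart_inverse[OF C(1)])
      then show ?thesis by auto
    qed
    moreover have "continuous_on {0..1} g" unfolding g_def by (intro continuous_intros)
    ultimately show "openin (top_of_set {0..1}) {u \<in> topspace (top_of_set {0..1}). \<eta> u \<in> W}"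
      using oW by (simp add: continuous_openin_preimage_gen)
  qed
  have inj: "inj_on \<eta> {0..1}"
  proof (rule inj_onI)
    fix x y assume "x \<in> {0..1::real}" "y \<in> {0..1::real}" "\<eta> x = \<eta> y"
    then have "g x = g y" using \<eta>U by metis
    then show "x = y" using v \<delta>(1) by (simp add: g_def)
  qed
  have arc: "oriented_arc X A \<eta>"
    unfolding oriented_arc_def using path inj smooth by (auto intro!: exI[of _ "{}"])
  have mid: "\<eta> (1 / 2) = p" unfolding \<eta>\<xi> \<xi>_def using chart_inverse(1)[OF C] by (simp add: p_def)
  have up: "\<eta> u \<in> face (left_of e)" if "1 / 2 < u" "u \<le> 1" for u
  proof -
    have "0 < (2 * u - 1) * \<delta>" using that \<delta>(1) by simp
    moreover have "(2 * u - 1) * \<delta> \<le> 1 * \<delta>" using that \<delta>(1) by (intro mult_right_mono) auto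
    ultimately show ?thesis unfolding \<eta>\<xi> using b(2) \<delta>(2) by simp
  qed
  have down: "\<eta> u \<in> face (right_of e)" if "0 \<le> u" "u < 1 / 2" for u
  proof -
    have "0 < (1 - 2 * u) * \<delta>" using that \<delta>(1) by simp
    moreover have "(1 - 2 * u) * \<delta> \<le> 1 * \<delta>" using that \<delta>(1) by (intro mult_right_mono) auto
    moreover have "(2 * u - 1) * \<delta> = - ((1 - 2 * u) * \<delta>)" by (simp add: algebra_simps)
    ultimately show ?thesis unfolding \<eta>\<xi> using b(4)[of "(1 - 2 * u) * \<delta>"] \<delta>(3) by simp
  qed
  have p: "p \<in> graph" "p \<notin> vertices" "p \<in> e" using d curve_in_graph[OF d(1)] by (auto simp: p_def)
  have meet: "{t \<in> {0..1}. \<eta> t \<in> graph} = {1 / 2}"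
  proof -
    have "t = 1 / 2" if "t \<in> {0..1}" "\<eta> t \<in> graph" for t
    proof (rule ccontr)
      assume "t \<noteq> 1 / 2"
      then have "t < 1 / 2 \<or> 1 / 2 < t" by auto
      then have "\<eta> t \<in> faces" using up[of t] down[of t] that(1) face_sub by (auto; blast)
      then show False using that(2) by (simp add: complement_def)
    qed
    then show ?thesis using mid p(1) by auto
  qed
  have velg: "velocity \<phi> \<eta> (1 / 2) = of_real (2 * \<delta>) * (\<i> * v)"
  proof -
    have "(g has_vector_derivative of_real (2 * \<delta>) * (\<i> * v)) (at (1 / 2))"
      unfolding g_def by (auto intro!: derivative_eq_intros)
    then have "((\<lambda>u. \<phi> (\<eta> u)) has_vector_derivative of_real (2 * \<delta>) * (\<i> * v)) (at (1 / 2))"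
      by (rule has_vector_derivative_transform_within_open[where S = "{0<..<1}"]) (use \<eta>U in auto)
    then show ?thesis by (simp add: vector_derivative_at comp_def)
  qed
  have cross: "crosses_leftward A (angular c) t \<eta> (1 / 2)" if c: "c \<in> m \<union> n" "c (cis t) = p" for c t
  proof -
    have eq: "c = d" "cis t = cis s" using curve_unique[OF c(1) d(1), of "cis t" "cis s"] c(2) p(2) by (auto simp: p_def)
    have "velocity \<phi> (angular c) t = v" unfolding v_def
      by (rule velocity_shift) (use eq in \<open>simp flip: cis_mult\<close>)
    then have "0 < Im (cnj (velocity \<phi> (angular c) t) * velocity \<phi> \<eta> (1 / 2))"
      unfolding velg using push(3)[OF d(1,3) C, of "2 * \<delta>"] \<delta>(1) v by (simp flip: v_def)
    moreover have "regular_at A (angular c) t" using curve_regular[OF c(1)] c(2) p(2) by simp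
    ultimately show ?thesis unfolding crosses_leftward_def using C reg\<eta> mid c(2) by (auto simp: p_def)
  qed
  have gp: "arc_general_position X A m n \<eta>"
    unfolding arc_general_position_def
  proof (intro conjI ballI)
    show "\<eta> 0 \<in> faces" "\<eta> 1 \<in> faces" using up[of 1] down[of 0] face_sub by auto
    show "finite {t \<in> {0..1}. \<eta> t \<in> graph}" unfolding meet by simp
    fix t assume t: "t \<in> {0..1::real}"
    have *: "t = 1 / 2" if "\<eta> t \<in> graph" using meet t that by blast
    show "\<eta> t \<notin> vertices" using * vertices_graph mid p(2) by blast
    fix c assume c: "c \<in> m \<union> n"
    show "\<forall>s. c (cis s) = \<eta> t \<longrightarrow> transverse_at A (angular c) s \<eta> t"
    proof (intro allI impI)
      fix s assume s: "c (cis s) = \<eta> t"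
      then have "t = 1 / 2" using * curve_in_graph[OF c] by metis
      then show "transverse_at A (angular c) s \<eta> t"
        unfolding transverse_at_def using cross[OF c] s mid by metis
    qed
  qed
  have sign: "crossing_sign A (m \<union> n) \<eta> (1 / 2) = 1"
  proof -
    have "\<exists>c\<in>m \<union> n. \<exists>s. crosses_leftward A (angular c) s \<eta> (1 / 2)" using cross[OF d(1)] d(1) by (auto simp: p_def)
    then have "0 \<le> crossing_sign A (m \<union> n) \<eta> (1 / 2)" unfolding crossing_sign_def by simp
    moreover have "\<forall>c\<in>m \<union> n. \<forall>s. c (cis s) = \<eta> (1 / 2) \<longrightarrow> transverse_at A (angular c) s \<eta> (1 / 2)"
      using gp unfolding arc_general_position_def by auto
    ultimately show ?thesis
      using crossing_sign_cases[of \<eta> "1 / 2", OF _ _ _ lr(3)] p mid by force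
  qed
  show thesis
  proof (rule that[OF arc gp])
    show "\<eta> 1 \<in> face (left_of e)" "\<eta> 0 \<in> face (right_of e)" using up[of 1] down[of 0] by auto
    show "algebraic_intersection X A m n a \<eta> = a e" for a
      unfolding algebraic_intersection_def meet using sign mid d(4) by (simp add: p_def)
  qed
qed

lemma overlap_function_iff: "overlap_function X A m n a f \<longleftrightarrow> overlap a f"
proof
  assume o: "overlap_function X A m n a f"
  then have lc: "loc_const f" using continuous_iff_face unfolding overlap_function_def loc_const_def by blast
  have "a e = cobd f e" if e: "e \<in> one_cells X A m n" for e
  proof -
    obtain \<eta> where \<eta>: "oriented_arc X A \<eta>" "arc_general_position X A m n \<eta>"
      "\<eta> 1 \<in> face (left_of e)" "\<eta> 0 \<in> face (right_of e)" "algebraic_intersection X A m n a \<eta> = a e"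
      using short_arc[OF e] by metis
    have "f (\<eta> 1) - f (\<eta> 0) = a e" using o \<eta> unfolding overlap_function_def by metis
    then show ?thesis
      using loc_const_face[OF lc _ \<eta>(3)] loc_const_face[OF lc _ \<eta>(4)] left_right[OF e] e by (simp add: cobd_def)
  qed
  then show "overlap a f" using o lc unfolding overlap_function_def overlap_def by blast
next
  assume o: "overlap a f"
  then have "loc_const f" "\<And>e. e \<in> one_cells X A m n \<Longrightarrow> a e = cobd f e" by (auto simp: overlap_def)
  note arc = arc_difference[OF this]
  show "overlap_function X A m n a f"
    unfolding overlap_function_def continuous_iff_face
    using o arc unfolding overlap_def loc_const_def by blast
qed

lemma tight_overlap_iff: "tight_overlap X A m n a f M \<longleftrightarrow> tight a f M"
  unfolding tight_overlap_def tight_def overlap_function_iff ..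

lemma descent_iff:
  "\<gamma>s \<noteq> [] \<and> \<gamma>s ! 0 = a \<and>
     (\<forall>i<length \<gamma>s. \<exists>f M.
        tight_overlap X A m n (\<lambda>e. b e - (\<gamma>s ! i) e) f M \<and>
        (if Suc i = length \<gamma>s then M = 1
         else M \<noteq> 1 \<and>
           \<gamma>s ! Suc i = (\<lambda>e. (\<gamma>s ! i) e + boundary_chain X A m n {x\<in>faces. f x = M} e))) \<longleftrightarrow>
   descent a b \<gamma>s"
proof -
  have "(if Suc i = length \<gamma>s then M = 1
         else M \<noteq> 1 \<and> \<gamma>s ! Suc i = (\<lambda>e. (\<gamma>s ! i) e + boundary_chain X A m n {x\<in>faces. f x = M} e)) \<longleftrightarrow>
      (if Suc i = length \<gamma>s then M = 1
         else M \<noteq> 1 \<and> \<gamma>s ! Suc i = (\<lambda>e. (\<gamma>s ! i) e + cobd (\<lambda>x. of_bool (f x = M)) e))"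
    if "tight c f M" for c f M i
    using that boundary_chain_eq[of f M] unfolding tight_def overlap_def by simp
  then show ?thesis
    unfolding descent_def tight_overlap_iff by (simp cong: conj_cong)
qed

lemma construction_iff:
  "construction X A m n \<gamma>s \<longleftrightarrow> descent (cellular X A m n m) (cellular X A m n n) \<gamma>s"
  unfolding construction_def by (rule descent_iff)

end

section \<open>Functions without coboundary\<close>

context curve_pair
begin

text \<open>The function \<open>k\<close> on the faces has the value \<open>j\<close> near \<open>p\<close>, where \<open>p\<close> may lie on the graph. A function in
  \<^const>\<open>kernel\<close> takes the same value on both sides of a one-cell, and since a punctured disc is
  connected, it also extends over the vertices; this gives a locally constant function on the whole surface.\<close>

definition germ :: "('a \<Rightarrow> int) \<Rightarrow> 'a \<Rightarrow> int \<Rightarrow> bool" where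
  "germ k p j \<longleftrightarrow> (\<exists>N. openin X N \<and> p \<in> N \<and> (\<forall>x\<in>N \<inter> faces. k x = j))"

lemma faces_dense:
  assumes N: "openin X N" "p \<in> N" shows "N \<inter> faces \<noteq> {}"
proof -
  have generic: "N \<inter> faces \<noteq> {}" if N: "openin X N" "p \<in> N" "p \<notin> vertices" for N p
  proof (cases "p \<in> graph")
    case False
    then show ?thesis using N openin_subset[OF N(1)] by (auto simp: complement_def)
  next
    case True
    obtain d s where d: "d \<in> m \<union> n" "p = d (cis s)" using graph_cases[OF True] .
    obtain U \<phi> where C: "(U, \<phi>) \<in> A" "p \<in> U" using chart_at openin_subset[OF N(1)] N(2) by blast
    have e: "edge_at p \<in> one_cells X A m n" "p \<in> edge_at p" using edge_at_cell[OF True N(3)] .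
    have dv: "d (cis s) \<notin> vertices" "d (cis s) \<in> U" using N(3) C(2) d(2) by auto
    define \<xi> where "\<xi> u = inv_into U \<phi> (\<phi> (d (cis s)) + of_real (1 * u) * (\<i> * velocity \<phi> (angular d) s))" for u
    have "\<forall>\<^sub>F u in at_right 0. \<xi> u \<in> face (left_of (edge_at p))"
      unfolding \<xi>_def by (rule sides_push(1)[OF _ d(1) dv(1) C(1) dv(2)]) (use left_right(3)[OF e] d(2) in simp)
    moreover have "\<forall>\<^sub>F u in at_right 0. \<xi> u \<in> N"
      using push(5)[OF d(1) dv(1) C(1) dv(2), of 1] N(1,2) d(2) unfolding \<xi>_def limitin_def by simp
    ultimately have "\<forall>\<^sub>F u in at_right 0. \<xi> u \<in> N \<inter> faces"
      by eventually_elim (use face_sub in blast)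
    then show ?thesis using eventually_happens'[OF trivial_limit_at_right_real] by blast
  qed
  obtain U \<phi> r where r: "(U, \<phi>) \<in> A" "p \<in> U" "0 < r" "ball (\<phi> p) r \<subseteq> \<phi> ` U"
    "inv_into U \<phi> ` ball (\<phi> p) r \<subseteq> N"
    using chart_ball[OF N] by metis
  have "infinite (ball (\<phi> p) r)" using r(3) uncountable_ball[of r "\<phi> p"] countable_finite by blast
  moreover have "inj_on (inv_into U \<phi>) (ball (\<phi> p) r)" using r(4) inj_on_inv_into by blast
  ultimately have "infinite (inv_into U \<phi> ` ball (\<phi> p) r)" using finite_imageD by blast
  then have "\<not> inv_into U \<phi> ` ball (\<phi> p) r \<subseteq> vertices"
    using finite_subset[OF _ finite_vertices] by metis
  then obtain q where "q \<in> inv_into U \<phi> ` ball (\<phi> p) r" "q \<notin> vertices" by blast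
  then show ?thesis using generic[OF N(1)] r(5) by blast
qed

lemma germ_unique: "germ k p i \<Longrightarrow> germ k p j \<Longrightarrow> i = j"
proof -
  assume "germ k p i" "germ k p j"
  then obtain N N' where N: "openin X N" "p \<in> N" "\<forall>x\<in>N \<inter> faces. k x = i"
    "openin X N'" "p \<in> N'" "\<forall>x\<in>N' \<inter> faces. k x = j"
    unfolding germ_def by blast
  then have "openin X (N \<inter> N')" "p \<in> N \<inter> N'" by auto
  from faces_dense[OF this] obtain x where "x \<in> N \<inter> N' \<inter> faces" by blast
  then show "i = j" using N(3,6) by auto
qed

lemma germ_generic:
  assumes k: "k \<in> kernel" and p: "p \<in> topspace X" "p \<notin> vertices"
  shows "\<exists>j. germ k p j"
proof (cases "p \<in> graph")
  case False
  then have pf: "p \<in> faces" using p by (simp add: complement_def)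
  have lc: "loc_const k" using k by (simp add: kernel_def)
  show ?thesis unfolding germ_def
    using open_face face_refl[OF pf] loc_const_face[OF lc pf] by blast
next
  case True
  have lc: "loc_const k" using k by (simp add: kernel_def)
  obtain c t where c: "c \<in> m \<union> n" "p = c (cis t)" using graph_cases[OF True] .
  have e: "edge_at p \<in> one_cells X A m n" "p \<in> edge_at p" using edge_at_cell[OF True p(2)] .
  obtain N P Q where N: "openin X N" "p \<in> N" and PQ: "connectedin X P" "connectedin X Q" "P \<subseteq> faces" "Q \<subseteq> faces"
    and NPQ: "N \<subseteq> P \<union> Q \<union> edge_at p"
    and sd: "\<And>q. q \<in> N \<Longrightarrow> q \<in> graph \<Longrightarrow> sides q P Q"
    using local_model[OF c(1)] p(2) c(2) by metis
  note ne = sides_nonempty[OF sd[OF N(2) True] left_right(3)[OF e] True p(2)]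
  have const: "k x = k z" if R: "x \<in> R" "connectedin X R" "R \<subseteq> faces" "R \<inter> face z \<noteq> {}" "z \<in> faces" for R x z
  proof -
    obtain y where y: "y \<in> R" "y \<in> face z" using R(4) by blast
    have "x \<in> face y" using face_maximal[OF R(2,3) y(1)] R(1) by blast
    then show ?thesis using loc_const_face[OF lc R(5)] face_eq[OF y(2)] by blast
  qed
  have eq: "k (left_of (edge_at p)) = k (right_of (edge_at p))" using k e(1) by (simp add: kernel_def)
  have "k x = k (left_of (edge_at p))" if "x \<in> N \<inter> faces" for x
  proof -
    have "x \<notin> edge_at p" using that cell_vertices[OF e(1), of x] by (auto simp: complement_def)
    then have "x \<in> P \<or> x \<in> Q" using that NPQ by blast
    then show ?thesis
      using const[of x P] const[of x Q] PQ ne left_right(1,2)[OF e(1)] eq by metis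
  qed
  then show ?thesis unfolding germ_def using N by blast
qed

lemma germ_exists:
  assumes k: "k \<in> kernel" and p: "p \<in> topspace X"
  shows "\<exists>j. germ k p j"
proof (cases "p \<in> vertices")
  case False then show ?thesis using germ_generic[OF k p] by blast
next
  case True
  have "closedin X (vertices - {p})"
    using finite_vertices vertices_graph graph_sub Hausdorff
    by (meson Diff_subset Hausdorff_imp_t1_space finite_Diff order_trans t1_space_closedin_finite)
  then have "openin X (topspace X - (vertices - {p}))" "p \<in> topspace X - (vertices - {p})" using p by auto
  from chart_ball[OF this] obtain U \<phi> r where C: "(U, \<phi>) \<in> A" "p \<in> U" and r: "0 < r" "ball (\<phi> p) r \<subseteq> \<phi> ` U"
    and im: "inv_into U \<phi> ` ball (\<phi> p) r \<subseteq> topspace X - (vertices - {p})"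
    and op: "openin X (inv_into U \<phi> ` ball (\<phi> p) r)"
    and cn: "\<And>T. connected T \<Longrightarrow> T \<subseteq> ball (\<phi> p) r \<Longrightarrow> connectedin X (inv_into U \<phi> ` T)"
    by metis
  define D where "D = inv_into U \<phi> ` (ball (\<phi> p) r - {\<phi> p})"
  have cD: "connectedin X D" unfolding D_def by (intro cn connected_punctured_ball) auto
  have D: "inv_into U \<phi> ` ball (\<phi> p) r = insert p D"
  proof -
    have "ball (\<phi> p) r = insert (\<phi> p) (ball (\<phi> p) r - {\<phi> p})" using r(1) by auto
    then show ?thesis unfolding D_def using chart_inverse(1)[OF C] image_insert by metis
  qed
  have pD: "p \<notin> D"
  proof
    assume "p \<in> D"
    then obtain z where "z \<in> ball (\<phi> p) r" "z \<noteq> \<phi> p" "p = inv_into U \<phi> z" unfolding D_def by blast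
    then show False using chart_inverse(2)[OF C(1), of z] r(2) by auto
  qed
  define \<kappa> where "\<kappa> q = (SOME j. germ k q j)" for q
  have \<kappa>: "germ k q (\<kappa> q)" if "q \<in> D" for q
  proof -
    have "q \<in> topspace X" "q \<notin> vertices" using that im D pD by auto
    then show ?thesis unfolding \<kappa>_def using germ_generic[OF k] by (metis someI_ex)
  qed
  have const: "\<kappa> x = \<kappa> y" if "x \<in> D" "y \<in> D" for x y
  proof (rule connectedin_local_const[OF cD that])
    fix q assume q: "q \<in> D"
    obtain N where N: "openin X N" "q \<in> N" "\<forall>x\<in>N \<inter> faces. k x = \<kappa> q" using \<kappa>[OF q] unfolding germ_def by blast
    then have "germ k q' (\<kappa> q)" if "q' \<in> N" for q' using that unfolding germ_def by blast
    then have "\<kappa> q' = \<kappa> q" if "q' \<in> N \<inter> D" for q'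
      using germ_unique[OF \<kappa>] that by blast
    then show "\<exists>N. openin X N \<and> q \<in> N \<and> (\<forall>q'\<in>N \<inter> D. \<kappa> q' = \<kappa> q)" using N by blast
  qed
  have kk: "k x = \<kappa> x" if "x \<in> D" "x \<in> faces" for x using \<kappa>[OF that(1)] that unfolding germ_def by blast
  have "p \<notin> faces" using True vertices_graph by (auto simp: complement_def)
  then have "\<exists>j. \<forall>x\<in>insert p D \<inter> faces. k x = j" using kk const by (metis IntE insertE)
  then show ?thesis unfolding germ_def using op D by (metis insertI1)
qed

lemma kernel_const:
  assumes "connected_space X" and k: "k \<in> kernel" and xy: "x \<in> faces" "y \<in> faces"
  shows "k x = k y"
proof -
  define \<kappa> where "\<kappa> q = (SOME j. germ k q j)" for q
  have \<kappa>: "germ k q (\<kappa> q)" if "q \<in> topspace X" for q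
    unfolding \<kappa>_def using germ_exists[OF k that] by (rule someI_ex)
  have V: "x \<in> topspace X" "y \<in> topspace X" using xy faces_sub by auto
  have "connectedin X (topspace X)" using assms(1) by (simp add: connectedin_topspace)
  then have "\<kappa> x = \<kappa> y" using V
  proof (rule connectedin_local_const)
    fix q assume q: "q \<in> topspace X"
    obtain N where N: "openin X N" "q \<in> N" "\<forall>x\<in>N \<inter> faces. k x = \<kappa> q" using \<kappa>[OF q] unfolding germ_def by blast
    then have "germ k q' (\<kappa> q)" if "q' \<in> N" for q' using that unfolding germ_def by blast
    then have "\<kappa> q' = \<kappa> q" if "q' \<in> N \<inter> topspace X" for q'
      using germ_unique[OF \<kappa>] that by blast
    then show "\<exists>N. openin X N \<and> q \<in> N \<and> (\<forall>q'\<in>N \<inter> topspace X. \<kappa> q' = \<kappa> q)" using N by blast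
  qed
  moreover have "k z = \<kappa> z" if "z \<in> faces" for z
    using \<kappa>[of z] that faces_sub unfolding germ_def by blast
  ultimately show ?thesis using xy by metis
qed

end

section \<open>Interchanging the two multicurves\<close>

lemma zero_cells_swap: "zero_cells A n m = zero_cells A m n"
  unfolding zero_cells_def by (simp add: Int_commute Un_commute)

lemma skeleton_swap: "skeleton X A n m = skeleton X A m n"
  unfolding skeleton_def zero_cells_swap[of A n m] by (simp add: Un_commute)

lemma one_cells_swap: "one_cells X A n m = one_cells X A m n"
  unfolding one_cells_def skeleton_swap[of X A n m] ..

lemma complement_swap: "complement X n m = complement X m n"
  unfolding complement_def by (simp add: Un_commute)

lemma cellular_swap: "cellular X A n m = cellular X A m n"
  unfolding cellular_def[abs_def] one_cells_swap[of X A n m] ..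

lemma boundary_chain_swap: "boundary_chain X A n m = boundary_chain X A m n"
  unfolding boundary_chain_def[abs_def] one_cells_swap[of X A n m] Un_commute[of n m] ..

lemma overlap_function_swap: "overlap_function X A n m = overlap_function X A m n"
  unfolding overlap_function_def[abs_def] arc_general_position_def algebraic_intersection_def
    complement_swap[of X n m] zero_cells_swap[of A n m] skeleton_swap[of X A n m]
    Un_commute[of n m] Un_commute[of "locus n" "locus m"] ..

lemma tight_overlap_swap: "tight_overlap X A n m = tight_overlap X A m n"
  unfolding tight_overlap_def[abs_def] overlap_function_swap[of X A n m] complement_swap[of X n m] ..

lemma chain_class_swap: "chain_class X A n m = chain_class X A m n"
  unfolding chain_class_def[abs_def] realizes_def one_cells_swap[of X A n m]
    Un_commute[of n m] Un_commute[of "locus n" "locus m"] ..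

lemma HC_path_rev: "HC_path X A \<alpha> (rev P) \<longleftrightarrow> HC_path X A \<alpha> P"
  by (simp add: HC_path_def successively_rev insert_commute)

context curve_pair
begin

text \<open>Both constructions take place on the dual graph of the same cell complex, with the two chains
  interchanged.\<close>

lemma construction_swap_iff:
  "construction X A n m \<gamma>s \<longleftrightarrow> descent (cellular X A m n n) (cellular X A m n m) \<gamma>s"
  using descent_iff[of \<gamma>s "cellular X A m n n" "cellular X A m n m"]
  unfolding construction_def tight_overlap_swap[of X A n m] cellular_swap[of X A n m]
    boundary_chain_swap[of X A n m] complement_swap[of X n m] .

lemma cellular_off: "e \<notin> one_cells X A m n \<Longrightarrow> cellular X A m n k e = 0"
  by (simp add: cellular_def)

lemma constructed_path_rev:
  assumes "constructed_path X A m n P" shows "constructed_path X A n m (rev P)"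
proof -
  obtain \<gamma>s where \<gamma>s: "construction X A m n \<gamma>s"
    and P: "P = homotopy_class X A m # map (chain_class X A m n) (tl \<gamma>s) @ [homotopy_class X A n]"
    using assms unfolding constructed_path_def by blast
  have "construction X A n m (cellular X A m n n # rev (tl \<gamma>s))"
    using descent_reverse[OF \<gamma>s[unfolded construction_iff] cellular_off cellular_off]
    unfolding construction_swap_iff .
  moreover have "rev P = homotopy_class X A n #
      map (chain_class X A n m) (tl (cellular X A m n n # rev (tl \<gamma>s))) @ [homotopy_class X A m]"
    unfolding P chain_class_swap[of X A n m] by (simp add: rev_map)
  ultimately show ?thesis unfolding constructed_path_def by blast
qed

lemma constructed_path_unique:
  assumes "connected_space X" "constructed_path X A m n P" "constructed_path X A m n Q"
  shows "P = Q"
proof -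
  obtain \<gamma>s where \<gamma>s: "construction X A m n \<gamma>s"
    and P: "P = homotopy_class X A m # map (chain_class X A m n) (tl \<gamma>s) @ [homotopy_class X A n]"
    using assms(2) unfolding constructed_path_def by blast
  obtain \<delta>s where \<delta>s: "construction X A m n \<delta>s"
    and Q: "Q = homotopy_class X A m # map (chain_class X A m n) (tl \<delta>s) @ [homotopy_class X A n]"
    using assms(3) unfolding constructed_path_def by blast
  have "\<gamma>s = \<delta>s"
    using descent_unique[OF kernel_const[OF assms(1)]] \<gamma>s \<delta>s unfolding construction_iff by blast
  then show ?thesis using P Q by simp
qed

end

theorem theorem9:
  fixes X :: "'a topology" and A :: "'a chart set"
    and m1 m2 :: "(complex \<Rightarrow> 'a) set" and \<alpha> :: "'a chain set"
  assumes "closed_oriented_surface X A"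
    and "\<forall>C\<in>connected_components_of X. \<exists>g\<ge>2. has_genus (subtopology X C) g"
    and "\<alpha> \<in> carrier (homology_group 1 X)" and "\<alpha> \<noteq> \<one>\<^bsub>homology_group 1 X\<^esub>"
    and "multicurve X A m1" and "homology_class X m1 = \<alpha>"
    and "multicurve X A m2" and "homology_class X m2 = \<alpha>"
    and "minimal_position X A m1 m2"
  shows "(\<forall>P. (constructed_path X A m1 m2 P \<longleftrightarrow> constructed_path X A m2 m1 (rev P)) \<and>
              (HC_path X A \<alpha> P \<longleftrightarrow> HC_path X A \<alpha> (rev P))) \<and>
         (connected_space X \<longrightarrow>
            (\<forall>P Q. constructed_path X A m1 m2 P \<and> constructed_path X A m2 m1 Q \<longrightarrow> Q = rev P))"
proof -
  have fin: "finite (locus m1 \<inter> locus m2)"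
    using assms(9) by (simp add: minimal_position_def general_position_def)
  interpret forward: curve_pair X A m1 m2
    using assms(1,5,7) fin by unfold_locales (simp_all add: multicurve_def)
  interpret backward: curve_pair X A m2 m1
    using assms(1,5,7) fin by unfold_locales (simp_all add: multicurve_def Int_commute)
  have rev: "constructed_path X A m1 m2 P \<longleftrightarrow> constructed_path X A m2 m1 (rev P)" for P
    using forward.constructed_path_rev[of P] backward.constructed_path_rev[of "rev P"] by auto
  moreover have "Q = rev P"
    if "connected_space X" "constructed_path X A m1 m2 P" "constructed_path X A m2 m1 Q" for P Q
    using backward.constructed_path_unique[OF that(1,3)] rev that(2) by blast
  ultimately show ?thesis using HC_path_rev[of X A \<alpha>] by blast
qed

end
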